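(* Let $\Omega\subset\mathbb{H}^n$ be a domain. (1) If $u\in\mathcal{QPSH}(\Omega)$ and $u\not\equiv-\infty$, then $u\in L^p_{loc}(\Omega)$ for any (positive) $p<2$. The bound on $p$ is optimal: for every $n\ge1$ and every $p\geq 2$ there exist a domain in $\mathbb{H}^n$ and a quaternionic plurisubharmonic function $\not\equiv-\infty$ on it which is not in $L^p_{loc}$. (2) If $u_j\not\equiv-\infty$ is a sequence of functions in $\mathcal{QPSH}(\Omega)$ converging in $L^1_{loc}(\Omega)$ to some $u$ (which then necessarily belongs to $\mathcal{QPSH}(\Omega)$, i.e. coincides almost everywhere with a function in $\mathcal{QPSH}(\Omega)$), then $u_j\to u$ in $L^p_{loc}(\Omega)$ for any (positive) $p<2$.
   Context: $\mathbb{H}^n$ is regarded as a right module over the quaternions $\mathbb{H}$ and is identified with $\mathbb{R}^{4n}$; $L^p_{loc}$ is with respect to Lebesgue measure. An upper semicontinuous function $u:\Omega\to[-\infty,\infty)$ on a domain $\Omega\subset\mathbb{H}^n$ is quaternionic plurisubharmonic (qpsh) if its restriction to every affine right quaternionic line $\{a+b\lambda:\lambda\in\mathbb{H}\}$ ($a,b\in\mathbb{H}^n$, $b\neq0$) intersected with $\Omega$ is subharmonic as a function on an open subset of $\mathbb{R}^4$ (on each connected component the function $\equiv-\infty$ is allowed). $\mathcal{QPSH}(\Omega)$ denotes the set of all qpsh functions on $\Omega$. *)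

theory Defs
  imports "HOL-Analysis.Analysis"
begin

text \<open>
  The quaternion \<open>x1 + x2 i + x3 j + x4 k\<close> is the vector \<open>(x1, x2, x3, x4)\<close>, so that
  quaternionic \<open>n\<close>-space is \<open>quat ^ 'n\<close> with \<open>n = CARD('n)\<close>, and its Euclidean structure and
  Lebesgue measure are those of real \<open>4n\<close>-space. The product is the Hamilton product
  (\<open>i j = k = - j i\<close>, \<open>i i = j j = k k = -1\<close>), not the componentwise product of vectors.
\<close>

type_synonym quat = "real ^ 4"

definition qmult :: "quat \<Rightarrow> quat \<Rightarrow> quat" (infixl \<open>\<otimes>\<^sub>q\<close> 70) where
  "x \<otimes>\<^sub>q y = vector
    [x$1 * y$1 - x$2 * y$2 - x$3 * y$3 - x$4 * y$4,
     x$1 * y$2 + x$2 * y$1 + x$3 * y$4 - x$4 * y$3,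
     x$1 * y$3 - x$2 * y$4 + x$3 * y$1 + x$4 * y$2,
     x$1 * y$4 + x$2 * y$3 - x$3 * y$2 + x$4 * y$1]"

definition qscale_right :: "quat ^ 'n \<Rightarrow> quat \<Rightarrow> quat ^ 'n" where
  "qscale_right b q = (\<chi> i. b$i \<otimes>\<^sub>q q)"

definition domain :: "'a::topological_space set \<Rightarrow> bool" where
  "domain \<Omega> \<longleftrightarrow> open \<Omega> \<and> connected \<Omega> \<and> \<Omega> \<noteq> {}"

definition usc_on :: "'a::topological_space set \<Rightarrow> ('a \<Rightarrow> ereal) \<Rightarrow> bool" where
  "usc_on U u \<longleftrightarrow> (\<forall>x\<in>U. \<forall>c. u x < c \<longrightarrow> (\<forall>\<^sub>F y in at x within U. u y < c))"

text \<open>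
  The integral of an extended real function, as the difference of the integrals of its positive
  and negative parts (\<open>e2ennreal\<close> sends negative values to 0). Below it is used only for functions
  bounded above on a set of finite measure, where the first integral is finite and no
  \<open>\<infinity> - \<infinity>\<close> arises.
\<close>

definition ereal_integral :: "'a measure \<Rightarrow> ('a \<Rightarrow> ereal) \<Rightarrow> ereal" where
  "ereal_integral M f =
    enn2ereal (\<integral>\<^sup>+x. e2ennreal (f x) \<partial>M) - enn2ereal (\<integral>\<^sup>+x. e2ennreal (- f x) \<partial>M)"

text \<open>
  Subharmonicity is upper semicontinuity together with the sub-mean-value inequality over all
  closed balls inside the open set; the function may be \<open>-\<infinity>\<close> identically on components.
\<close>

definition subharmonic_on :: "'a::euclidean_space set \<Rightarrow> ('a \<Rightarrow> ereal) \<Rightarrow> bool" where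
  "subharmonic_on U u \<longleftrightarrow>
    open U \<and> (\<forall>x\<in>U. u x < \<infinity>) \<and> usc_on U u \<and>
    (\<forall>x r. r > 0 \<and> cball x r \<subseteq> U \<longrightarrow>
      u x \<le> ereal_integral (uniform_measure lborel (cball x r)) u)"

definition QPSH :: "(quat ^ 'n) set \<Rightarrow> (quat ^ 'n \<Rightarrow> ereal) set" where
  "QPSH \<Omega> = {u. (\<forall>x\<in>\<Omega>. u x < \<infinity>) \<and> usc_on \<Omega> u \<and>
    (\<forall>a b. b \<noteq> 0 \<longrightarrow>
      subharmonic_on {q. a + qscale_right b q \<in> \<Omega>} (\<lambda>q. u (a + qscale_right b q)))}"

definition abs_powr :: "ereal \<Rightarrow> real \<Rightarrow> ennreal" where
  "abs_powr y p = (if \<bar>y\<bar> = \<infinity> then \<infinity> else ennreal (\<bar>real_of_ereal y\<bar> powr p))"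

definition Lp_loc :: "real \<Rightarrow> 'a::euclidean_space set \<Rightarrow> ('a \<Rightarrow> ereal) \<Rightarrow> bool" where
  "Lp_loc p \<Omega> u \<longleftrightarrow>
    u \<in> borel_measurable (lebesgue_on \<Omega>) \<and>
    (\<forall>K. compact K \<and> K \<subseteq> \<Omega> \<longrightarrow> (\<integral>\<^sup>+x\<in>K. abs_powr (u x) p \<partial>lebesgue) < \<infinity>)"

text \<open>
  All functions involved are finite almost everywhere on \<open>\<Omega>\<close>, so the value of the
  \<open>ereal\<close> difference at points where it is \<open>\<infinity> - \<infinity>\<close> is immaterial.
\<close>

definition Lp_loc_tendsto ::
    "real \<Rightarrow> 'a::euclidean_space set \<Rightarrow> (nat \<Rightarrow> 'a \<Rightarrow> ereal) \<Rightarrow> ('a \<Rightarrow> ereal) \<Rightarrow> bool" where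
  "Lp_loc_tendsto p \<Omega> f u \<longleftrightarrow>
    (\<forall>j. Lp_loc p \<Omega> (f j)) \<and> Lp_loc p \<Omega> u \<and>
    (\<forall>K. compact K \<and> K \<subseteq> \<Omega> \<longrightarrow>
      (\<lambda>j. \<integral>\<^sup>+x\<in>K. abs_powr (f j x - u x) p \<partial>lebesgue) \<longlonglongrightarrow> 0)"

end

theory Submission
  imports Defs
begin

text \<open>
  On a line through \<open>a\<close> with \<open>u a > -\<infinity>\<close> and \<open>u \<le> M\<close>, the function \<open>w = M - u\<close> is superharmonic
  and nonnegative on a ball of real 4-space. Comparing \<open>w\<close> with \<open>t\<close> times a normalised Newton potential
  \<open>\<integral>\<^sub>K |x - z|\<^sup>-\<^sup>2 dz\<close> of a compact set \<open>K \<subseteq> {w > t}\<close>, which is at most \<open>C |K|\<^bsup>1/2\<^esup>\<close>, yields the weak-type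
  bound \<open>|{w > t}| \<le> C (w a / t)\<^sup>2\<close>. Integrating it over the lines through \<open>a\<close> gives the same bound in
  quaternionic \<open>n\<close>-space, hence \<open>L\<^sup>p\<close> bounds for \<open>p < 2\<close> that depend only on \<open>M\<close>, \<open>u a\<close> and the radius;
  connectedness makes them local bounds on the whole domain. The function \<open>-1 / |x\<^sub>i|\<^sup>2\<close> excludes \<open>p = 2\<close>.

  Applying the mean value inequality in the coordinate lines one after the other bounds \<open>u\<close> by its
  averages \<open>A\<^sub>r u\<close> over polydiscs. If \<open>u\<^sub>j \<longrightarrow> f\<close> in \<open>L\<^sup>1\<close> locally, then \<open>A\<^sub>r u\<^sub>j \<longrightarrow> A\<^sub>r f\<close> pointwise, the
  limit of \<open>A\<^sub>r f\<close> as \<open>r\<close> tends to 0 exists, equals the infimum over \<open>r\<close>, is plurisubharmonic by Fatou's lemma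
  and agrees with \<open>f\<close> almost everywhere. The \<open>L\<^sup>q\<close> bounds are uniform in \<open>j\<close>, so interpolating between them and
  the \<open>L\<^sup>1\<close> convergence gives convergence in \<open>L\<^sup>p\<close>.
\<close>

section \<open>Quaternions and similarities\<close>

text \<open>The exponent 2 is that of the Newton kernel: up to a constant \<open>1 / |x|^2\<close>
  is the fundamental solution of the Laplacian on real 4-space, and near 0 it lies in weak L^2 but
  not in L^2. Every line through \<open>a\<close> starts from the same value \<open>w a\<close>, so
  the exponent does not deteriorate with \<open>n\<close>. No Riesz measure enters. Subharmonicity
  is semicontinuity together with a mean value inequality, so the comparison with a potential has to
  be made through ball means at a single minimum point. For this the kernel is smoothed to
  \<open>1 / (|x|^2 + \<epsilon>)\<close>: off the pole its Laplacian has size \<epsilon>, and a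
  term \<open>\<eta> |x|^2\<close> with \<epsilon> small against \<eta> tips the sign. A bound
  \<open>A_r f x < c\<close> is instead passed to all small radii by continuity of
  \<open>A_r f\<close> and the inequality between \<open>u_j\<close> and its means. All constants
  are fixed before the function is, because the point near which \<open>u_j\<close> is bounded below
  moves with \<open>j\<close>.\<close>

lemma vector_4_nth:
  "(vector [a, b, c, d] :: 'a::zero ^ 4) $ 1 = a" "(vector [a, b, c, d] :: 'a ^ 4) $ 2 = b"
  "(vector [a, b, c, d] :: 'a ^ 4) $ 3 = c" "(vector [a, b, c, d] :: 'a ^ 4) $ 4 = d"
  unfolding vector_def by simp_all

lemma qmult_nth:
  "(x \<otimes>\<^sub>q y) $ 1 = x$1 * y$1 - x$2 * y$2 - x$3 * y$3 - x$4 * y$4"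
  "(x \<otimes>\<^sub>q y) $ 2 = x$1 * y$2 + x$2 * y$1 + x$3 * y$4 - x$4 * y$3"
  "(x \<otimes>\<^sub>q y) $ 3 = x$1 * y$3 - x$2 * y$4 + x$3 * y$1 + x$4 * y$2"
  "(x \<otimes>\<^sub>q y) $ 4 = x$1 * y$4 + x$2 * y$3 - x$3 * y$2 + x$4 * y$1"
  by (simp_all add: qmult_def vector_4_nth)

lemma inner_quat: "(x::quat) \<bullet> y = x$1 * y$1 + x$2 * y$2 + x$3 * y$3 + x$4 * y$4"
  by (simp add: inner_vec_def sum_4)

lemma norm_quat: "(norm (x::quat))\<^sup>2 = (x$1)\<^sup>2 + (x$2)\<^sup>2 + (x$3)\<^sup>2 + (x$4)\<^sup>2"
  unfolding power2_norm_eq_inner inner_quat by (simp add: power2_eq_square)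

text \<open>Euler's four-square identity. It makes both one-sided multiplications
  similarities.\<close>

lemma norm_qmult: "norm (x \<otimes>\<^sub>q y) = norm x * norm y"
proof -
  have "(norm (x \<otimes>\<^sub>q y))\<^sup>2 = (norm x * norm y)\<^sup>2"
    unfolding power_mult_distrib norm_quat qmult_nth by algebra
  then show ?thesis by (simp add: power2_eq_iff_nonneg)
qed

lemma linear_qmult_right: "linear (\<lambda>y. x \<otimes>\<^sub>q y)"
  by (rule linearI) (simp_all add: vec_eq_iff forall_4 qmult_nth algebra_simps)

lemma linear_qmult_left: "linear (\<lambda>x. x \<otimes>\<^sub>q y)"
  by (rule linearI) (simp_all add: vec_eq_iff forall_4 qmult_nth algebra_simps)

lemma qmult_assoc: "(x \<otimes>\<^sub>q y) \<otimes>\<^sub>q z = x \<otimes>\<^sub>q (y \<otimes>\<^sub>q z)"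
  by (simp add: vec_eq_iff forall_4 qmult_nth algebra_simps)

lemma one_qmult: "axis 1 1 \<otimes>\<^sub>q y = y"
  by (simp add: vec_eq_iff forall_4 qmult_nth axis_def)

lemma qmult_right_inverse:
  assumes "x \<noteq> 0" obtains y where "x \<otimes>\<^sub>q y = axis 1 1"
proof
  \<comment> \<open>The conjugate of \<open>x\<close> divided by \<open>|x|^2\<close>.\<close>
  let ?y = "(1 / (norm x)\<^sup>2) *\<^sub>R vector [x$1, - x$2, - x$3, - x$4] :: quat"
  have "(x$1)\<^sup>2 + (x$2)\<^sup>2 + (x$3)\<^sup>2 + (x$4)\<^sup>2 \<noteq> 0"
    using assms norm_quat[of x] by (metis norm_eq_zero power_eq_0_iff)
  then show "x \<otimes>\<^sub>q ?y = axis 1 1"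
    by (simp add: vec_eq_iff forall_4 qmult_nth vector_4_nth axis_def norm_quat divide_simps)
      (simp add: power2_eq_square)
qed

lemma linear_qscale_right: "linear (qscale_right b)"
  by (rule linearI; subst vec_eq_iff; unfold qscale_right_def)
    (simp_all only: vec_lambda_beta vector_add_component vector_scaleR_component
      linear_add[OF linear_qmult_right] linear_cmul[OF linear_qmult_right] simp_thms)

lemma linear_qscale_left: "linear (\<lambda>b. qscale_right b q)"
  by (rule linearI; subst vec_eq_iff; unfold qscale_right_def)
    (simp_all only: vec_lambda_beta vector_add_component vector_scaleR_component
      linear_add[OF linear_qmult_left] linear_cmul[OF linear_qmult_left] simp_thms)

lemma norm_qscale_right: "norm (qscale_right b q) = norm b * norm q"
  by (simp add: qscale_right_def norm_vec_def[of "_ :: quat ^ 'n"] norm_vec_def[of b] norm_qmult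
      L2_set_left_distrib)

lemma qscale_right_0 [simp]: "qscale_right b 0 = 0" "qscale_right 0 q = 0"
  using norm_qscale_right[of b 0] norm_qscale_right[of 0 q] by simp_all

lemma continuous_qscale_right: "continuous_on S (qscale_right b)"
  by (rule linear_continuous_on[OF linear_conv_bounded_linear[THEN iffD1, OF linear_qscale_right]])

lemma continuous_on_qmult:
  fixes f g :: "'a::topological_space \<Rightarrow> quat"
  assumes "continuous_on S f" "continuous_on S g"
  shows "continuous_on S (\<lambda>x. f x \<otimes>\<^sub>q g x)"
proof -
  have e: "(\<lambda>x. f x \<otimes>\<^sub>q g x) = (\<lambda>x. \<chi> i. (f x \<otimes>\<^sub>q g x) $ i)"
    by (simp add: vec_eq_iff)
  have "continuous_on S (\<lambda>x. (f x \<otimes>\<^sub>q g x) $ i)" for i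
    using exhaust_4[of i]
    by (elim disjE; hypsubst; unfold qmult_nth; intro continuous_intros assms)
  then show ?thesis unfolding e by (intro continuous_on_vec_lambda)
qed

lemma continuous_on_qscale_right:
  fixes f :: "'a::topological_space \<Rightarrow> quat ^ 'n"
  assumes "continuous_on S f" "continuous_on S g"
  shows "continuous_on S (\<lambda>x. qscale_right (f x) (g x))"
  unfolding qscale_right_def
  by (intro continuous_on_vec_lambda continuous_on_qmult continuous_intros assms)

text \<open>
  A translation-invariant measure is a multiple of Lebesgue measure: exchange the order of
  integration in the double integral of \<open>indicator A (x + y) * indicator B y\<close>.
\<close>

lemma translation_invariant_measure:
  fixes M :: "'a::euclidean_space measure"
  assumes "sigma_finite_measure M" and sets: "sets M = sets borel"
    and inv: "\<And>A x. A \<in> sets borel \<Longrightarrow> emeasure M ((\<lambda>y. y + x) -` A) = emeasure M A"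
    and A: "A \<in> sets borel" and B: "B \<in> sets borel" and sym: "uminus -` B = B"
  shows "emeasure M A * emeasure lborel B = emeasure lborel A * emeasure M B"
proof -
  interpret M: sigma_finite_measure M by fact
  interpret pair_sigma_finite M lborel ..
  have [measurable_cong]: "sets M = sets borel" by fact
  have [measurable]: "A \<in> sets borel" "B \<in> sets borel" using A B by auto
  have sp[simp]: "space M = UNIV" using sets_eq_imp_space_eq[OF sets] by simp
  have invn: "(\<integral>\<^sup>+x. indicator A (x + y) \<partial>M) = emeasure M A" for y
  proof -
    have "(\<lambda>x. x + y) -` A \<in> sets M"
    proof -
      have "(\<lambda>x. x + y) -` A \<inter> space borel \<in> sets borel" by measurable
      then show ?thesis by (simp add: sets)
    qed
    have "(\<integral>\<^sup>+x. indicator A (x + y) \<partial>M) = (\<integral>\<^sup>+x. indicator ((\<lambda>x. x + y) -` A) x \<partial>M)"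
      by (intro nn_integral_cong) (auto simp: indicator_def)
    also have "\<dots> = emeasure M ((\<lambda>x. x + y) -` A)"
      by (rule nn_integral_indicator) fact
    finally show ?thesis by (simp add: inv)
  qed
  \<comment> \<open>Symmetry of \<open>B\<close> turns the reflection \<open>y - x\<close> into a
    translation of \<open>x\<close>, to which invariance of \<open>M\<close> applies.\<close>
  have B': "(\<lambda>x. y - x) -` B = (\<lambda>x. x + - y) -` B" for y
  proof -
    have "- z \<in> B \<longleftrightarrow> z \<in> B" for z using sym by (auto simp: vimage_def set_eq_iff)
    from this[of "y - x" for x] have "y - x \<in> B \<longleftrightarrow> x + - y \<in> B" for x by simp
    then show ?thesis by (simp add: vimage_def)
  qed
  have invB: "(\<integral>\<^sup>+x. indicator B (y - x) \<partial>M) = emeasure M B" for y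
  proof -
    have m: "(\<lambda>x. y - x) -` B \<in> sets M"
    proof -
      have "(\<lambda>x. y - x) -` B \<inter> space borel \<in> sets borel" by measurable
      then show ?thesis by (simp add: sets)
    qed
    have "(\<integral>\<^sup>+x. indicator B (y - x) \<partial>M) = (\<integral>\<^sup>+x. indicator ((\<lambda>x. y - x) -` B) x \<partial>M)"
      by (intro nn_integral_cong) (auto simp: indicator_def)
    also have "\<dots> = emeasure M ((\<lambda>x. y - x) -` B)" by (rule nn_integral_indicator) fact
    finally show ?thesis by (simp only: B' inv[OF B])
  qed
  have "emeasure M A * emeasure lborel B = (\<integral>\<^sup>+y. emeasure M A * indicator B y \<partial>lborel)"
    by (simp add: nn_integral_cmult)
  also have "\<dots> = (\<integral>\<^sup>+y. (\<integral>\<^sup>+x. indicator A (x + y) * indicator B y \<partial>M) \<partial>lborel)"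
    by (rule nn_integral_cong) (simp add: nn_integral_multc invn)
  also have "\<dots> = (\<integral>\<^sup>+x. (\<integral>\<^sup>+y. indicator A (x + y) * indicator B y \<partial>lborel) \<partial>M)"
    by (rule Fubini') measurable
  also have "\<dots> = (\<integral>\<^sup>+x. (\<integral>\<^sup>+y. indicator A y * indicator B (y - x) \<partial>lborel) \<partial>M)"
  proof (rule nn_integral_cong)
    fix x
    have "(\<integral>\<^sup>+y. indicator A y * indicator B (y - x) \<partial>lborel) =
      (\<integral>\<^sup>+y. indicator A y * indicator B (y - x) \<partial>distr lborel borel ((+) x))"
      by (simp add: lborel_distr_plus)
    also have "\<dots> = (\<integral>\<^sup>+y. indicator A (x + y) * indicator B y \<partial>lborel)"
      by (subst nn_integral_distr) auto
    finally show "(\<integral>\<^sup>+y. indicator A (x + y) * indicator B y \<partial>lborel) =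
      (\<integral>\<^sup>+y. indicator A y * indicator B (y - x) \<partial>lborel)" ..
  qed
  also have "\<dots> = (\<integral>\<^sup>+y. (\<integral>\<^sup>+x. indicator A y * indicator B (y - x) \<partial>M) \<partial>lborel)"
    by (rule Fubini'[symmetric]) measurable
  also have "\<dots> = (\<integral>\<^sup>+y. emeasure M B * indicator A y \<partial>lborel)"
    by (rule nn_integral_cong) (simp add: nn_integral_cmult invB mult.commute)
  also have "\<dots> = emeasure lborel A * emeasure M B"
    by (subst nn_integral_cmult_indicator) (simp_all add: mult.commute)
  finally show ?thesis .
qed

lemma emeasure_lborel_cball_pos:
  "0 < r \<Longrightarrow> 0 < emeasure lborel (cball (x::'a::euclidean_space) r)"
  by (simp add: emeasure_cball zero_less_mult_iff)

lemma emeasure_lborel_cball_finite: "emeasure lborel (cball (x::'a::euclidean_space) r) < \<infinity>"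
  by (rule emeasure_bounded_finite) simp

lemma emeasure_lborel_translate:
  fixes A :: "'a::euclidean_space set"
  assumes [measurable]: "A \<in> sets borel"
  shows "emeasure lborel ((\<lambda>y. y + x) -` A) = emeasure lborel A"
proof -
  have "emeasure lborel A = emeasure (distr lborel borel ((+) x)) A"
    by (simp add: lborel_distr_plus)
  also have "\<dots> = emeasure lborel ((\<lambda>y. y + x) -` A)"
    by (subst emeasure_distr) (auto simp: add.commute[of x] vimage_def)
  finally show ?thesis ..
qed

text \<open>The image of Lebesgue measure under \<open>T\<close> is translation invariant because
  \<open>T\<close> is linear and onto, hence a multiple of Lebesgue measure; the factor is read off
  from the unit ball, whose preimage is a ball again. No determinant of
  \<open>b \<mapsto> b q\<close> on quaternionic \<open>n\<close>-space has to be computed.\<close>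

lemma emeasure_lborel_similarity:
  fixes T :: "'a::euclidean_space \<Rightarrow> 'a"
  assumes T: "linear T" and c: "c > 0" and norm: "\<And>x. norm (T x) = c * norm x"
    and A[measurable]: "A \<in> sets borel"
  shows "emeasure lborel A = ennreal (c ^ DIM('a)) * emeasure lborel (T -` A)"
proof -
  have [measurable]: "T \<in> borel_measurable borel"
    using T by (intro borel_measurable_continuous_onI linear_continuous_on)
      (simp add: linear_conv_bounded_linear)
  define M where "M = distr lborel borel T"
  have setsM: "sets M = sets borel" "space M = UNIV" by (simp_all add: M_def)
  have M: "emeasure M B = emeasure lborel (T -` B)" if [measurable]: "B \<in> sets borel" for B
    unfolding M_def by (subst emeasure_distr) auto
  have "inj T"
    using c norm by (intro linear_inj_iff_eq_0[OF T, THEN iffD2]) (metis mult_eq_0_iff norm_eq_zero order_less_irrefl)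
  then have "surj T" using T linear_injective_imp_surjective by blast
  have inv: "emeasure M ((\<lambda>y. y + x) -` B) = emeasure M B" if [measurable]: "B \<in> sets borel" for B x
  proof -
    obtain z where z: "x = T z" using \<open>surj T\<close> by auto
    have "(\<lambda>y. y + x) -` B \<in> sets borel"
      using measurable_sets[of "\<lambda>y. y + x" borel borel B] that by simp
    then have "emeasure M ((\<lambda>y. y + x) -` B) = emeasure lborel (T -` (\<lambda>y. y + x) -` B)"
      by (rule M)
    also have "T -` (\<lambda>y. y + x) -` B = (\<lambda>y. y + z) -` (T -` B)"
      by (auto simp: z linear_add[OF T])
    also have "emeasure lborel \<dots> = emeasure lborel (T -` B)"
      using measurable_sets[of T borel borel B] that by (intro emeasure_lborel_translate) simp
    finally show ?thesis using M that by simp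
  qed
  have pre: "T -` cball 0 r = cball 0 (r / c)" for r
    using c by (auto simp: norm field_simps)
  have "sigma_finite_measure M"
  proof
    let ?\<A> = "range (\<lambda>n::nat. cball (0::'a) (real n))"
    have "\<Union>?\<A> = UNIV"
    proof -
      have "x \<in> \<Union>?\<A>" for x using real_arch_simple[of "norm x"] by auto
      then show ?thesis by blast
    qed
    then show "\<exists>A. countable A \<and> A \<subseteq> sets M \<and> \<Union> A = space M \<and> (\<forall>a\<in>A. emeasure M a \<noteq> \<infinity>)"
      by (intro exI[of _ ?\<A>])
        (use emeasure_lborel_cball_finite[of "0::'a"] in
          \<open>auto simp: setsM M pre less_top[symmetric] less_imp_neq\<close>)
  qed
  then have eq: "emeasure M A * emeasure lborel (cball (0::'a) 1) = emeasure lborel A * emeasure M (cball 0 1)"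
    by (rule translation_invariant_measure) (auto simp: inv setsM)
  define V where "V = unit_ball_vol (real DIM('a))"
  have V: "V > 0" by (simp add: V_def)
  have "emeasure lborel (cball (0::'a) 1) = ennreal V"
    by (simp add: emeasure_cball V_def)
  moreover have "emeasure M (cball (0::'a) 1) = ennreal V * ennreal (1 / c ^ DIM('a))"
    using c by (simp add: M pre emeasure_cball V_def power_divide flip: ennreal_mult)
  ultimately have "ennreal V * emeasure M A = ennreal V * (ennreal (1 / c ^ DIM('a)) * emeasure lborel A)"
    using eq by (simp add: mult_ac)
  then have "emeasure M A = ennreal (1 / c ^ DIM('a)) * emeasure lborel A"
    using V by (simp add: ennreal_mult_cancel_left)
  then have "ennreal (c ^ DIM('a)) * emeasure M A = ennreal (c ^ DIM('a) * (1 / c ^ DIM('a))) * emeasure lborel A"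
    using c by (subst ennreal_mult) (simp_all add: mult.assoc)
  then show ?thesis using c by (simp add: M)
qed

lemma distr_lborel_isometry:
  fixes T :: "'a::euclidean_space \<Rightarrow> 'a"
  assumes T: "linear T" and norm: "\<And>x. norm (T x) = norm x"
  shows "distr lborel borel T = lborel"
proof (rule measure_eqI)
  have [measurable]: "T \<in> borel_measurable borel"
    using T by (intro borel_measurable_continuous_onI linear_continuous_on)
      (simp add: linear_conv_bounded_linear)
  fix A assume "A \<in> sets (distr lborel borel T)"
  then have [measurable]: "A \<in> sets borel" by simp
  show "emeasure (distr lborel borel T) A = emeasure lborel A"
    using emeasure_lborel_similarity[OF T, of 1 A] norm by (subst emeasure_distr) auto
qed simp

section \<open>Mean value inequalities for functions bounded above\<close>

lemma ereal_e2ennreal_diff: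
  assumes "v \<le> ereal M"
  shows "e2ennreal (ereal M - v) + e2ennreal v + ennreal (- M) = e2ennreal (- v) + ennreal M"
proof (cases v)
  case (real r)
  then have "r \<le> M" using assms by simp
  have e: "ereal M - v = ereal (M - r)" "- v = ereal (- r)" using real by auto
  show ?thesis
  proof (cases "r \<ge> 0")
    case True
    then show ?thesis using \<open>r \<le> M\<close>
      by (simp add: real e e2ennreal_ereal ennreal_neg flip: ennreal_plus)
  next
    case False
    then show ?thesis using \<open>r \<le> M\<close>
      by (cases "M \<ge> 0") (simp_all add: real e e2ennreal_ereal ennreal_neg flip: ennreal_plus)
  qed
qed (use assms in \<open>auto simp: e2ennreal_neg e2ennreal_infty\<close>)

text \<open>Integration of the preceding pointwise identity, which is additive in positive parts
  only, so that it survives the truncated subtraction of \<open>ennreal\<close>. The positive part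
  of \<open>v\<close> has a finite integral, and the two cases separate finite from infinite
  integrals of \<open>M - v\<close>.\<close>

lemma ereal_integral_eq:
  assumes "finite_measure N" and emeasure_space_1: "emeasure N (space N) = 1"
    and [measurable]: "v \<in> borel_measurable N" and AE: "AE x in N. v x \<le> ereal M"
  shows "ereal_integral N v = ereal M - enn2ereal (\<integral>\<^sup>+x. e2ennreal (ereal M - v x) \<partial>N)"
proof -
  interpret finite_measure N by fact
  let ?Q = "\<integral>\<^sup>+x. e2ennreal (ereal M - v x) \<partial>N" and ?P = "\<integral>\<^sup>+x. e2ennreal (v x) \<partial>N"
    and ?N = "\<integral>\<^sup>+x. e2ennreal (- v x) \<partial>N"
  have "?Q + ?P + ennreal (- M) = (\<integral>\<^sup>+x. e2ennreal (ereal M - v x) + e2ennreal (v x) + ennreal (- M) \<partial>N)"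
    by (simp add: nn_integral_add emeasure_space_1)
  also have "\<dots> = (\<integral>\<^sup>+x. e2ennreal (- v x) + ennreal M \<partial>N)"
    using AE by (intro nn_integral_cong_AE) (auto elim!: eventually_mono simp: ereal_e2ennreal_diff)
  also have "\<dots> = ?N + ennreal M"
    by (simp add: nn_integral_add emeasure_space_1)
  finally have eq: "?Q + ?P + ennreal (- M) = ?N + ennreal M" .
  have "?P \<le> (\<integral>\<^sup>+x. ennreal M \<partial>N)"
    using AE by (intro nn_integral_mono_AE) (auto elim!: eventually_mono simp: e2ennreal_mono simp flip: e2ennreal_ereal)
  then have P: "?P < \<infinity>" by (auto simp: emeasure_space_1 le_less_trans)
  then obtain p where p: "?P = ennreal p" "p \<ge> 0" by (cases ?P) auto
  have *: "ereal M = max 0 (ereal M) - max 0 (ereal (- M))" by (auto simp: max_def)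
  show ?thesis
  proof (cases "?Q = \<infinity>")
    case True
    then have "?N = \<infinity>" using eq by (metis ennreal_add_eq_top ennreal_neq_top infinity_ennreal_def top_add)
    then show ?thesis using True p by (simp add: ereal_integral_def)
  next
    case False
    then obtain q where q: "?Q = ennreal q" "q \<ge> 0" by (cases ?Q) auto
    then have "?N \<noteq> \<infinity>" using eq p by (metis ennreal_add_eq_top ennreal_neq_top infinity_ennreal_def)
    then obtain n where n: "?N = ennreal n" "n \<ge> 0" by (cases ?N) auto
    have "q + p + max 0 (- M) = n + max 0 M"
    proof -
      have "ennreal (q + p + max 0 (- M)) = ennreal (n + max 0 M)"
        using eq p q n by (simp add: ennreal_max_0)
      then show ?thesis using p q n by (subst (asm) ennreal_inj) auto
    qed
    then have "p - n = M - q" by linarith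
    then show ?thesis using p q n by (simp add: ereal_integral_def)
  qed
qed

text \<open>The bridge from the sub-mean-value inequality of \<open>v\<close> to the
  super-mean-value inequality of the nonnegative \<open>M - v\<close>. Later estimates use the
  second form, where infinite values are harmless and Fubini and Fatou apply directly. Measurability
  is asked of the extension by 0, since \<open>v\<close> is controlled on \<open>S\<close>
  only.\<close>

lemma le_ereal_integral_iff:
  assumes S: "S \<in> sets borel" "emeasure lborel S \<noteq> 0" "emeasure lborel S \<noteq> \<infinity>"
    and v: "(\<lambda>x. if x \<in> S then v x else 0) \<in> borel_measurable borel"
    and M: "\<And>y. y \<in> S \<Longrightarrow> v y \<le> ereal M" and x: "x0 \<le> ereal M"
  shows "x0 \<le> ereal_integral (uniform_measure lborel S) v \<longleftrightarrow>
    (\<integral>\<^sup>+y\<in>S. e2ennreal (ereal M - v y) \<partial>lborel) \<le> emeasure lborel S * e2ennreal (ereal M - x0)"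
proof -
  let ?U = "uniform_measure lborel S" and ?v = "\<lambda>x. if x \<in> S then v x else 0"
  let ?Q = "\<integral>\<^sup>+y\<in>S. e2ennreal (ereal M - v y) \<partial>lborel"
  have 1: "emeasure ?U (space ?U) = 1"
    using S by (simp add: emeasure_uniform_measure less_top)
  then interpret finite_measure ?U by (intro finite_measureI) simp
  have AS: "AE x in ?U. x \<in> S"
    using S by (intro AE_uniform_measureI) auto
  have "ereal_integral ?U v = ereal_integral ?U ?v"
    unfolding ereal_integral_def
    by (intro arg_cong2[where f = minus] arg_cong[where f = enn2ereal] nn_integral_cong_AE)
      (use AS in \<open>auto elim!: eventually_mono\<close>)
  also have "\<dots> = ereal M - enn2ereal (\<integral>\<^sup>+x. e2ennreal (ereal M - ?v x) \<partial>?U)"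
    using v M
    by (intro ereal_integral_eq 1 finite_measure_axioms eventually_mono[OF AS]) auto
  also have "(\<integral>\<^sup>+x. e2ennreal (ereal M - ?v x) \<partial>?U) =
      (\<integral>\<^sup>+x. e2ennreal (ereal M - ?v x) * indicator S x \<partial>lborel) / emeasure lborel S"
    using v S by (intro nn_integral_uniform_measure) auto
  also have "(\<integral>\<^sup>+x. e2ennreal (ereal M - ?v x) * indicator S x \<partial>lborel) = ?Q"
    by (intro nn_integral_cong) (auto simp: indicator_def)
  finally have 1: "ereal_integral ?U v = ereal M - enn2ereal (?Q / emeasure lborel S)" .
  have "x0 \<le> ereal M - enn2ereal (?Q / emeasure lborel S) \<longleftrightarrow>
    ?Q / emeasure lborel S \<le> e2ennreal (ereal M - x0)"
  proof (cases x0)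
    case (real r)
    then have "r \<le> M" using x by simp
    then show ?thesis
      using real by (cases "?Q / emeasure lborel S") (auto simp: e2ennreal_ereal top_unique)
  qed (use x in \<open>auto simp: e2ennreal_infty\<close>)
  also have "\<dots> \<longleftrightarrow> ?Q \<le> emeasure lborel S * e2ennreal (ereal M - x0)"
  proof
    assume "?Q / emeasure lborel S \<le> e2ennreal (ereal M - x0)"
    then have "?Q / emeasure lborel S * emeasure lborel S \<le> e2ennreal (ereal M - x0) * emeasure lborel S"
      by (rule mult_right_mono) simp
    moreover have "?Q / emeasure lborel S * emeasure lborel S = ?Q"
      using S by (simp add: ennreal_divide_times less_top)
    ultimately show "?Q \<le> emeasure lborel S * e2ennreal (ereal M - x0)" by (simp add: mult.commute)
  next
    assume "?Q \<le> emeasure lborel S * e2ennreal (ereal M - x0)"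
    then show "?Q / emeasure lborel S \<le> e2ennreal (ereal M - x0)"
      using S by (intro divide_le_posI_ennreal) (auto simp: zero_less_iff_neq_zero)
  qed
  finally show ?thesis using 1 by simp
qed

section \<open>Upper semicontinuous functions\<close>

lemma usc_on_open_iff:
  fixes u :: "'a::topological_space \<Rightarrow> ereal"
  assumes "open U"
  shows "usc_on U u \<longleftrightarrow> (\<forall>c. open {x\<in>U. u x < c})"
proof
  assume usc: "usc_on U u"
  show "\<forall>c. open {x\<in>U. u x < c}"
  proof (rule allI, subst open_subopen, clarify)
    fix c x assume x: "x \<in> U" "u x < c"
    then have "\<forall>\<^sub>F y in at x. u y < c"
      using usc assms unfolding usc_on_def by (metis at_within_open)
    then obtain T where T: "open T" "x \<in> T" "\<And>y. y \<in> T \<Longrightarrow> y \<noteq> x \<Longrightarrow> u y < c"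
      by (auto simp: eventually_at_topological)
    then show "\<exists>T. open T \<and> x \<in> T \<and> T \<subseteq> {x \<in> U. u x < c}"
      using x assms by (intro exI[of _ "T \<inter> U"]) auto
  qed
next
  assume o: "\<forall>c. open {x\<in>U. u x < c}"
  show "usc_on U u"
    unfolding usc_on_def
  proof (intro ballI allI impI)
    fix x c assume "x \<in> U" "u x < c"
    then show "\<forall>\<^sub>F y in at x within U. u y < c"
      unfolding eventually_at_topological using o by (intro exI[of _ "{x\<in>U. u x < c}"]) auto
  qed
qed

lemma usc_on_borel_measurable:
  fixes u :: "'a::topological_space \<Rightarrow> ereal"
  assumes "open U" "usc_on U u"
  shows "(\<lambda>x. if x \<in> U then u x else 0) \<in> borel_measurable borel"
proof (rule borel_measurableI_less)
  fix c :: ereal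
  have "{x. (if x \<in> U then u x else 0) < c} = {x\<in>U. u x < c} \<union> (if 0 < c then - U else {})"
    by auto
  moreover have "open {x\<in>U. u x < c}" using assms usc_on_open_iff by blast
  ultimately show "{x \<in> space borel. (if x \<in> U then u x else 0) < c} \<in> sets borel"
    using \<open>open U\<close> by (auto intro!: sets.Un)
qed

lemma usc_on_borel_measurable_subset:
  fixes u :: "'a::topological_space \<Rightarrow> ereal"
  assumes "open U" "usc_on U u" and [measurable]: "S \<in> sets borel" and "S \<subseteq> U"
  shows "(\<lambda>x. if x \<in> S then u x else 0) \<in> borel_measurable borel"
proof -
  have [measurable]: "(\<lambda>x. if x \<in> U then u x else 0) \<in> borel_measurable borel"
    by (rule usc_on_borel_measurable) fact+
  have "(\<lambda>x. if x \<in> S then u x else 0) = (\<lambda>x. if x \<in> S then (if x \<in> U then u x else 0) else 0)"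
    using \<open>S \<subseteq> U\<close> by (auto simp: fun_eq_iff)
  then show ?thesis by simp
qed

lemma usc_on_locally_bounded_above:
  fixes u :: "'a::euclidean_space \<Rightarrow> ereal"
  assumes "open U" "usc_on U u" "\<And>x. x \<in> U \<Longrightarrow> u x < \<infinity>" and "compact K" "K \<subseteq> U"
  obtains M :: real where "0 \<le> M" "\<And>x. x \<in> K \<Longrightarrow> u x \<le> ereal M"
proof -
  let ?C = "(\<lambda>n::nat. {x\<in>U. u x < ereal (real n)}) ` UNIV"
  have "K \<subseteq> \<Union>?C"
  proof
    fix x assume "x \<in> K"
    then have "x \<in> U" "u x < \<infinity>" using assms by auto
    then obtain n :: nat where "u x < ereal (real n)"
      using less_PInf_Ex_of_nat[of "u x"] by auto
    then show "x \<in> \<Union>?C" using \<open>x \<in> U\<close> by blast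
  qed
  moreover have "open B" if "B \<in> ?C" for B using that assms usc_on_open_iff by blast
  ultimately obtain D where D: "D \<subseteq> ?C" "finite D" "K \<subseteq> \<Union>D"
    using \<open>compact K\<close> by (meson compactE)
  then obtain N where N: "finite N" "D = (\<lambda>n::nat. {x\<in>U. u x < ereal (real n)}) ` N"
    by (meson finite_subset_image)
  show thesis
  proof
    show "0 \<le> real (Max (insert 0 N))" by simp
    fix x assume "x \<in> K"
    then obtain n where "n \<in> N" "u x < ereal (real n)" using D N by auto
    moreover have "real n \<le> real (Max (insert 0 N))" using N \<open>n \<in> N\<close> by simp
    ultimately show "u x \<le> ereal (real (Max (insert 0 N)))"
      by (meson ereal_less_eq(3) less_imp_le order_trans)
  qed
qed

section \<open>Mean values of smooth superharmonic functions\<close>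

lemma integrable_bounded_support:
  fixes f :: "'a \<Rightarrow> real"
  assumes "f \<in> borel_measurable M" "S \<in> sets M" "emeasure M S < \<infinity>"
    "\<And>x. x \<in> S \<Longrightarrow> \<bar>f x\<bar> \<le> B" "\<And>x. x \<notin> S \<Longrightarrow> f x = 0"
  shows "integrable M f"
proof (rule Bochner_Integration.integrable_bound)
  show "integrable M (\<lambda>x. indicator S x * B)"
    using assms(2,3) by (intro integrable_mult_left integrable_real_indicator)
  show "AE x in M. norm (f x) \<le> norm (indicator S x * B)"
    using assms(4,5) by (intro AE_I2) (force simp: indicator_def)
qed fact

lemma integral_lborel_translate:
  fixes f :: "'a::euclidean_space \<Rightarrow> real"
  assumes "f \<in> borel_measurable borel"
  shows "(\<integral>x. f (x + c) \<partial>lborel) = (\<integral>x. f x \<partial>lborel)"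
    and "integrable lborel (\<lambda>x. f (x + c)) \<longleftrightarrow> integrable lborel f"
proof -
  have "(\<integral>x. f x \<partial>lborel) = (\<integral>x. f x \<partial>distr lborel borel ((+) c))"
    by (simp add: lborel_distr_plus)
  also have "\<dots> = (\<integral>x. f (x + c) \<partial>lborel)"
    using assms by (subst integral_distr) (auto simp: add.commute)
  finally show "(\<integral>x. f (x + c) \<partial>lborel) = (\<integral>x. f x \<partial>lborel)" ..
  have "integrable lborel f \<longleftrightarrow> integrable (distr lborel borel ((+) c)) f"
    by (simp add: lborel_distr_plus)
  also have "\<dots> \<longleftrightarrow> integrable lborel (\<lambda>x. f (x + c))"
    using assms by (subst integrable_distr_eq) (auto simp: add.commute)
  finally show "integrable lborel (\<lambda>x. f (x + c)) \<longleftrightarrow> integrable lborel f" ..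
qed

text \<open>By translation invariance every difference quotient of \<open>G\<close> has integral 0,
  and the Lipschitz bound lets the step tend to 0 under the integral. Differentiability almost
  everywhere suffices, which admits a kink on the unit sphere.\<close>

lemma integral_directional_derivative_eq_0:
  fixes G G' :: "'a::euclidean_space \<Rightarrow> real"
  assumes [measurable]: "G \<in> borel_measurable borel" "G' \<in> borel_measurable borel"
    and supp: "\<And>x. norm x > 1 \<Longrightarrow> G x = 0" and bound: "\<And>x. \<bar>G x\<bar> \<le> B"
    and lip: "\<And>x t. 0 < t \<Longrightarrow> t \<le> 1 \<Longrightarrow> \<bar>G (x + t *\<^sub>R e) - G x\<bar> \<le> L * t"
    and e: "norm e = 1"
    and D: "AE x in lborel. ((\<lambda>t. G (x + t *\<^sub>R e)) has_real_derivative G' x) (at 0)"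
  shows "(\<integral>x. G' x \<partial>lborel) = 0"
proof -
  define d where "d n = inverse (real (Suc n))" for n
  have d: "0 < d n" "d n \<le> 1" for n by (auto simp: d_def field_simps)
  define s where "s n x = (G (x + d n *\<^sub>R e) - G x) / d n" for n x
  have [measurable]: "s n \<in> borel_measurable borel" for n unfolding s_def by measurable
  have intG: "integrable lborel G"
    by (rule integrable_bounded_support[where S = "cball 0 1" and B = B])
      (use supp bound emeasure_lborel_cball_finite in \<open>auto simp: not_le\<close>)
  have s0: "(\<integral>x. s n x \<partial>lborel) = 0" for n
    using intG integral_lborel_translate[of G "d n *\<^sub>R e"] by (simp add: s_def)
  have fl: "filterlim d (at 0) sequentially"
    unfolding d_def using LIMSEQ_inverse_real_of_nat by (simp add: filterlim_at del: of_nat_Suc)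
  have lim: "(\<lambda>n. \<integral>x. s n x \<partial>lborel) \<longlonglongrightarrow> (\<integral>x. G' x \<partial>lborel)"
  \<comment> \<open>The quotients vanish outside \<open>cball 0 2\<close>: \<open>G\<close> is
    supported in the unit ball and the steps have length at most 1.\<close>
  proof (rule integral_dominated_convergence[where w = "\<lambda>x. indicator (cball 0 2) x * L"])
    show "integrable lborel (\<lambda>x. indicator (cball 0 2) x * L)"
      using emeasure_lborel_cball_finite by (intro integrable_mult_left integrable_real_indicator) auto
    show "AE x in lborel. (\<lambda>n. s n x) \<longlonglongrightarrow> G' x"
      using D
    proof eventually_elim
      case (elim x)
      then have "(\<lambda>h. (G (x + h *\<^sub>R e) - G x) / h) \<midarrow>0\<rightarrow> G' x" by (simp add: DERIV_def)
      from filterlim_compose[OF this fl] show ?case by (simp add: s_def)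
    qed
    show "AE x in lborel. norm (s n x) \<le> indicator (cball 0 2) x * L" for n
    proof (intro AE_I2)
      fix x
      show "norm (s n x) \<le> indicator (cball 0 2) x * L"
      proof (cases "x \<in> cball 0 2")
        case True
        then show ?thesis using lip[OF d, of x n] d[of n] by (simp add: s_def field_simps)
      next
        case False
        then have "norm x > 2" by simp
        moreover have "norm (x + d n *\<^sub>R e) \<ge> norm x - 1"
          using norm_triangle_ineq4[of "x + d n *\<^sub>R e" "d n *\<^sub>R e"] d[of n] e by simp
        ultimately show ?thesis using supp by (simp add: s_def)
      qed
    qed
  qed simp_all
  then show ?thesis using s0 by (simp add: LIMSEQ_const_iff)
qed

lemma max_one_minus_square_lipschitz:
  fixes a b :: real
  assumes "0 \<le> a" "0 \<le> b" "\<bar>a - b\<bar> \<le> t"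
  shows "\<bar>max 0 (1 - a\<^sup>2) - max 0 (1 - b\<^sup>2)\<bar> \<le> 2 * t"
proof -
  have m: "max 0 (1 - c\<^sup>2) = 1 - (min 1 c)\<^sup>2" if "c \<ge> 0" for c :: real
    using that power_le_one[of c 2] one_le_power[of c 2] by (cases "c \<le> 1") auto
  let ?a = "min 1 a" and ?b = "min 1 b"
  have "\<bar>?b\<^sup>2 - ?a\<^sup>2\<bar> = \<bar>?b - ?a\<bar> * \<bar>?b + ?a\<bar>"
    by (simp add: power2_eq_square flip: abs_mult) (simp add: algebra_simps)
  also have "\<dots> \<le> t * 2" using assms by (intro mult_mono) auto
  finally show ?thesis using assms by (simp add: m)
qed

text \<open>
  The derivative of a ball mean with respect to the radius is a positive multiple of the integral of
  the Laplacian against \<open>1 - |h|\<^sup>2\<close>: this is the vanishing of the integral of the divergence of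
  \<open>(1 - |h|\<^sup>2) \<nabla>f\<close> over the unit ball.
\<close>

lemma integral_radial_derivative_nonpos:
  fixes g g2 :: "'a::euclidean_space \<Rightarrow> 'a \<Rightarrow> real"
  assumes g: "\<And>e y. e \<in> Basis \<Longrightarrow> ((\<lambda>t. g e (y + t *\<^sub>R e)) has_real_derivative g2 e y) (at 0)"
    and gL: "\<And>e y. e \<in> Basis \<Longrightarrow> \<bar>g e y\<bar> \<le> L" "\<And>e y. e \<in> Basis \<Longrightarrow> \<bar>g2 e y\<bar> \<le> L"
    and [measurable]: "\<And>e. g e \<in> borel_measurable borel" "\<And>e. g2 e \<in> borel_measurable borel"
    and lap: "\<And>y. (\<Sum>e\<in>Basis. g2 e y) \<le> 0" and \<rho>: "\<rho> \<ge> 0"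
  shows "(\<integral>h. indicator (cball 0 1) h * (\<Sum>e\<in>Basis. (h \<bullet> e) * g e (x + \<rho> *\<^sub>R h)) \<partial>lborel) \<le> 0"
proof -
  define D where "D h = max 0 (1 - (norm h)\<^sup>2)" for h :: 'a
  \<comment> \<open>\<open>G\<close> collects the components of the vector field
    \<open>(1 - |h|^2) \<nabla>f\<close>, cut off at the unit sphere. The derivative of
    \<open>G e\<close> in direction \<open>e\<close> is \<open>\<rho> * Q e - 2 * P e\<close>: the
    first term differentiates \<open>g e\<close>, the second the cut-off \<open>D\<close>.\<close>
  define G where "G e h = D h * g e (x + \<rho> *\<^sub>R h)" for e h
  define P where "P e h = indicator (cball 0 1) h * ((h \<bullet> e) * g e (x + \<rho> *\<^sub>R h))" for e h
  define Q where "Q e h = D h * g2 e (x + \<rho> *\<^sub>R h)" for e h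
  have [measurable]: "D \<in> borel_measurable borel" unfolding D_def by measurable
  have [measurable]: "cball (0::'a) 1 \<in> sets borel" by simp
  have [measurable]: "P e \<in> borel_measurable borel" for e unfolding P_def by measurable
  have [measurable]: "Q e \<in> borel_measurable borel" for e unfolding Q_def by measurable
  have D01: "0 \<le> D h" "D h \<le> 1" for h by (auto simp: D_def)
  have D0: "D h = 0" if "norm h \<ge> 1" for h using that by (simp add: D_def one_le_power)
  have L0: "L \<ge> 0"
    using gL(1)[OF SOME_Basis] abs_ge_zero order_trans by blast
  have intQ: "integrable lborel (Q e)" if "e \<in> Basis" for e
  proof (rule integrable_bounded_support[where S = "cball 0 1" and B = L])
    show "\<bar>Q e h\<bar> \<le> L" for h
      using mult_mono[OF D01(2) gL(2)[OF that]] D01 L0 by (simp add: Q_def abs_mult)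
  qed (use emeasure_lborel_cball_finite in \<open>auto simp: Q_def D0\<close>)
  have intP: "integrable lborel (P e)" if "e \<in> Basis" for e
  proof (rule integrable_bounded_support[where S = "cball 0 1" and B = L])
    show "\<bar>P e h\<bar> \<le> L" if "h \<in> cball 0 1" for h
    proof -
      have "\<bar>h \<bullet> e\<bar> \<le> 1" using Basis_le_norm[OF \<open>e \<in> Basis\<close>, of h] that by simp
      then show ?thesis
        using mult_mono[OF _ gL(1)[OF \<open>e \<in> Basis\<close>], of "\<bar>h \<bullet> e\<bar>" 1 "x + \<rho> *\<^sub>R h"] L0 that
        by (simp add: P_def abs_mult)
    qed
  qed (use emeasure_lborel_cball_finite in \<open>auto simp: P_def\<close>)
  have zero: "(\<integral>h. \<rho> * Q e h - 2 * P e h \<partial>lborel) = 0" if e: "e \<in> Basis" for e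
  \<comment> \<open>The Lipschitz constant is that of a product: \<open>D\<close> is 2-Lipschitz and
    \<open>g e\<close> is bounded by \<open>L\<close>, while \<open>D\<close> is at most 1 and
    \<open>g e\<close> along \<open>x + \<rho> h\<close> is
    \<open>L * \<rho>\<close>-Lipschitz.\<close>
  proof (rule integral_directional_derivative_eq_0[where G = "G e" and e = e and B = L and L = "2 * L + L * \<rho>"])
    show "G e \<in> borel_measurable borel" unfolding G_def by measurable
    show "norm e = 1" using e by simp
    show "G e h = 0" if "norm h > 1" for h using that by (simp add: G_def D0)
    show "\<bar>G e h\<bar> \<le> L" for h
      using mult_mono[OF D01(2) gL(1)[OF e]] D01 L0 by (simp add: G_def abs_mult)
    show "\<bar>G e (h + t *\<^sub>R e) - G e h\<bar> \<le> (2 * L + L * \<rho>) * t" if t: "0 < t" "t \<le> 1" for h t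
    proof -
      have "\<bar>D (h + t *\<^sub>R e) - D h\<bar> \<le> 2 * t"
        unfolding D_def
      proof (rule max_one_minus_square_lipschitz)
        show "\<bar>norm (h + t *\<^sub>R e) - norm h\<bar> \<le> t"
          using norm_triangle_ineq3[of "h + t *\<^sub>R e" h] e t by simp
      qed auto
      then have 1: "\<bar>D (h + t *\<^sub>R e) - D h\<bar> * \<bar>g e (x + \<rho> *\<^sub>R (h + t *\<^sub>R e))\<bar> \<le> (2 * t) * L"
        using gL(1)[OF e] by (intro mult_mono) auto
      let ?y = "x + \<rho> *\<^sub>R h"
      have der: "((\<lambda>s. g e (?y + s *\<^sub>R e)) has_real_derivative g2 e (?y + s *\<^sub>R e)) (at s)" for s
        using g[OF e, of "?y + s *\<^sub>R e"] DERIV_shift[of "\<lambda>s. g e (?y + s *\<^sub>R e)" _ 0 s]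
        by (simp add: algebra_simps)
      have "\<bar>g e (?y + (\<rho> * t) *\<^sub>R e) - g e ?y\<bar> \<le> L * (\<rho> * t)"
      proof (cases "\<rho> * t = 0")
        case False
        then have "0 < \<rho> * t" using \<rho> t by simp
        from MVT2[OF this der] obtain z where
          "g e (?y + (\<rho> * t) *\<^sub>R e) - g e (?y + 0 *\<^sub>R e) = (\<rho> * t - 0) * g2 e (?y + z *\<^sub>R e)" by blast
        then show ?thesis using mult_left_mono[OF gL(2)[OF e, of "?y + z *\<^sub>R e"], of "\<rho> * t"] \<rho> t
          by (simp add: abs_mult mult_ac)
      qed (use t L0 in auto)
      then have "\<bar>g e (x + \<rho> *\<^sub>R (h + t *\<^sub>R e)) - g e (x + \<rho> *\<^sub>R h)\<bar> \<le> L * (\<rho> * t)"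
        by (simp add: algebra_simps)
      then have 2: "D h * \<bar>g e (x + \<rho> *\<^sub>R (h + t *\<^sub>R e)) - g e (x + \<rho> *\<^sub>R h)\<bar> \<le> 1 * (L * (\<rho> * t))"
        using D01 by (intro mult_mono) auto
      have "G e (h + t *\<^sub>R e) - G e h = (D (h + t *\<^sub>R e) - D h) * g e (x + \<rho> *\<^sub>R (h + t *\<^sub>R e)) +
        D h * (g e (x + \<rho> *\<^sub>R (h + t *\<^sub>R e)) - g e (x + \<rho> *\<^sub>R h))"
        by (simp add: G_def algebra_simps)
      then have "\<bar>G e (h + t *\<^sub>R e) - G e h\<bar> \<le>
        \<bar>D (h + t *\<^sub>R e) - D h\<bar> * \<bar>g e (x + \<rho> *\<^sub>R (h + t *\<^sub>R e))\<bar> +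
        D h * \<bar>g e (x + \<rho> *\<^sub>R (h + t *\<^sub>R e)) - g e (x + \<rho> *\<^sub>R h)\<bar>"
        using D01(1)[of h] by (simp add: abs_mult[symmetric]) (metis abs_mult abs_of_nonneg abs_triangle_ineq)
      also have "\<dots> \<le> (2 * t) * L + 1 * (L * (\<rho> * t))" using 1 2 by (rule add_mono)
      finally show ?thesis by (simp add: algebra_simps)
    qed
    \<comment> \<open>On the unit sphere \<open>D\<close> has its kink; the sphere is a null
      set.\<close>
    have "AE h in lborel. (h::'a) \<notin> sphere 0 1"
      using negligible_sphere[of "0::'a" 1]
      by (intro AE_not_in) (simp add: negligible_iff_null_sets null_sets_completion_iff)
    then show "AE h in lborel. ((\<lambda>t. G e (h + t *\<^sub>R e)) has_real_derivative \<rho> * Q e h - 2 * P e h) (at 0)"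
    proof eventually_elim
      case (elim h)
      then consider "norm h < 1" | "norm h > 1" by fastforce
      then show ?case
      proof cases
        case 1
        have lim: "((\<lambda>t. norm (h + t *\<^sub>R e)) \<longlongrightarrow> norm (h + 0 *\<^sub>R e)) (at 0)"
          by (intro tendsto_intros)
        then have ev: "\<forall>\<^sub>F t in at 0. norm (h + t *\<^sub>R e) < 1"
          using 1 by (intro order_tendstoD) auto
        then have "\<forall>\<^sub>F t in nhds 0. norm (h + t *\<^sub>R e) < 1"
          using 1 by (simp add: eventually_nhds_conv_at)
        then have eq: "\<forall>\<^sub>F t in nhds 0. G e (h + t *\<^sub>R e) =
            (1 - (h + t *\<^sub>R e) \<bullet> (h + t *\<^sub>R e)) * g e ((x + \<rho> *\<^sub>R h) + (\<rho> * t) *\<^sub>R e)"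
        proof eventually_elim
          case (elim t)
          then have "(norm (h + t *\<^sub>R e))\<^sup>2 \<le> 1" by (simp add: power_le_one)
          then show ?case by (simp add: G_def D_def power2_norm_eq_inner[symmetric] algebra_simps)
        qed
        have c: "((\<lambda>t. g e ((x + \<rho> *\<^sub>R h) + (\<rho> * t) *\<^sub>R e)) has_real_derivative g2 e (x + \<rho> *\<^sub>R h) * \<rho>) (at 0)"
          by (rule DERIV_chain'[where f = "\<lambda>t. \<rho> * t" and g = "\<lambda>s. g e ((x + \<rho> *\<^sub>R h) + s *\<^sub>R e)"])
            (auto intro!: derivative_eq_intros simp: g[OF e])
        have i: "(h + t *\<^sub>R e) \<bullet> (h + t *\<^sub>R e) = h \<bullet> h + 2 * t * (h \<bullet> e) + t * t" for t
          using e by (simp add: inner_add_left inner_add_right inner_commute algebra_simps)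
        have "((\<lambda>t. (1 - (h + t *\<^sub>R e) \<bullet> (h + t *\<^sub>R e)) * g e ((x + \<rho> *\<^sub>R h) + (\<rho> * t) *\<^sub>R e))
          has_real_derivative \<rho> * Q e h - 2 * P e h) (at 0)"
          unfolding i
        proof (rule DERIV_cong[OF DERIV_mult[OF _ c]])
          show "((\<lambda>t. 1 - (h \<bullet> h + 2 * t * (h \<bullet> e) + t * t)) has_real_derivative - 2 * (h \<bullet> e)) (at 0)"
            by (auto intro!: derivative_eq_intros)
          show "- 2 * (h \<bullet> e) * g e (x + \<rho> *\<^sub>R h + (\<rho> * 0) *\<^sub>R e) +
            g2 e (x + \<rho> *\<^sub>R h) * \<rho> * (1 - (h \<bullet> h + 2 * 0 * (h \<bullet> e) + 0 * 0)) = \<rho> * Q e h - 2 * P e h"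
            using 1 by (simp add: Q_def P_def D_def power2_norm_eq_inner[symmetric] power_le_one algebra_simps)
        qed
        then show ?thesis using DERIV_cong_ev[OF refl eq refl] by simp
      next
        case 2
        have lim: "((\<lambda>t. norm (h + t *\<^sub>R e)) \<longlongrightarrow> norm (h + 0 *\<^sub>R e)) (at 0)"
          by (intro tendsto_intros)
        then have ev: "\<forall>\<^sub>F t in at 0. norm (h + t *\<^sub>R e) > 1"
          using 2 by (intro order_tendstoD) auto
        then have "\<forall>\<^sub>F t in nhds 0. norm (h + t *\<^sub>R e) > 1"
          using 2 by (simp add: eventually_nhds_conv_at)
        then have eq: "\<forall>\<^sub>F t in nhds 0. G e (h + t *\<^sub>R e) = 0"
          by eventually_elim (simp add: G_def D0)
        have "((\<lambda>t. 0) has_real_derivative \<rho> * Q e h - 2 * P e h) (at 0)"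
          using 2 by (simp add: Q_def P_def D0)
        then show ?thesis using DERIV_cong_ev[OF refl eq refl] by simp
      qed
    qed
  qed simp
  have PQ: "2 * (\<integral>h. P e h \<partial>lborel) = \<rho> * (\<integral>h. Q e h \<partial>lborel)" if "e \<in> Basis" for e
    using zero[OF that] intP[OF that] intQ[OF that] by simp
  have "(\<integral>h. indicator (cball 0 1) h * (\<Sum>e\<in>Basis. (h \<bullet> e) * g e (x + \<rho> *\<^sub>R h)) \<partial>lborel) =
    (\<integral>h. (\<Sum>e\<in>Basis. P e h) \<partial>lborel)" by (simp add: P_def sum_distrib_left)
  also have "\<dots> = (\<Sum>e\<in>Basis. \<integral>h. P e h \<partial>lborel)" by (rule Bochner_Integration.integral_sum) (rule intP)
  finally have "2 * (\<integral>h. indicator (cball 0 1) h * (\<Sum>e\<in>Basis. (h \<bullet> e) * g e (x + \<rho> *\<^sub>R h)) \<partial>lborel) =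
    \<rho> * (\<Sum>e\<in>Basis. \<integral>h. Q e h \<partial>lborel)"
    by (simp add: sum_distrib_left PQ)
  also have "(\<Sum>e\<in>Basis. \<integral>h. Q e h \<partial>lborel) = (\<integral>h. (\<Sum>e\<in>Basis. Q e h) \<partial>lborel)"
    by (rule Bochner_Integration.integral_sum[symmetric]) (rule intQ)
  also have "\<dots> = (\<integral>h. D h * (\<Sum>e\<in>Basis. g2 e (x + \<rho> *\<^sub>R h)) \<partial>lborel)"
    by (simp add: Q_def sum_distrib_left)
  also have "\<rho> * \<dots> \<le> 0"
  proof (rule mult_nonneg_nonpos[OF \<rho>])
    have "0 \<le> (\<integral>h. - (D h * (\<Sum>e\<in>Basis. g2 e (x + \<rho> *\<^sub>R h))) \<partial>lborel)"
      using D01 lap by (intro Bochner_Integration.integral_nonneg) (simp add: mult_nonneg_nonpos)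
    then show "(\<integral>h. D h * (\<Sum>e\<in>Basis. g2 e (x + \<rho> *\<^sub>R h)) \<partial>lborel) \<le> 0" by simp
  qed
  finally show ?thesis by simp
qed

text \<open>Along each ray \<open>f (x + r h) - f x\<close> is the integral of the radial derivative
  over radii up to \<open>r\<close>. After Fubini, every radius contributes a nonpositive amount by
  the preceding lemma. The global bound \<open>L\<close> makes the double integral absolutely
  convergent.\<close>

lemma ball_mean_superharmonic:
  fixes f :: "'a::euclidean_space \<Rightarrow> real"
  assumes f: "\<And>y v. ((\<lambda>t. f (y + t *\<^sub>R v)) has_real_derivative (\<Sum>e\<in>Basis. (v \<bullet> e) * g e y)) (at 0)"
    and g: "\<And>e y. e \<in> Basis \<Longrightarrow> ((\<lambda>t. g e (y + t *\<^sub>R e)) has_real_derivative g2 e y) (at 0)"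
    and gL: "\<And>e y. e \<in> Basis \<Longrightarrow> \<bar>g e y\<bar> \<le> L" "\<And>e y. e \<in> Basis \<Longrightarrow> \<bar>g2 e y\<bar> \<le> L"
    and cont: "continuous_on UNIV f" "\<And>e. continuous_on UNIV (g e)"
    and [measurable]: "\<And>e. g2 e \<in> borel_measurable borel"
    and lap: "\<And>y. (\<Sum>e\<in>Basis. g2 e y) \<le> 0" and r: "r \<ge> 0"
  shows "(\<integral>h. indicator (cball 0 1) h * (f (x + r *\<^sub>R h) - f x) \<partial>lborel) \<le> 0"
proof -
  have [measurable]: "f \<in> borel_measurable borel" "\<And>e. g e \<in> borel_measurable borel"
    using cont by (auto intro: borel_measurable_continuous_onI)
  have [measurable]: "cball (0::'a) 1 \<in> sets borel" by simp
  define F where "F h \<rho> = (\<Sum>e\<in>Basis. (h \<bullet> e) * g e (x + \<rho> *\<^sub>R h))" for h \<rho>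
  have L0: "L \<ge> 0"
    using gL(1)[OF SOME_Basis] abs_ge_zero order_trans by blast
  have FTC: "(\<integral>\<rho>. F h \<rho> * indicator {0..r} \<rho> \<partial>lborel) = f (x + r *\<^sub>R h) - f x" for h
  proof -
    have "(\<integral>\<rho>. F h \<rho> * indicator {0..r} \<rho> \<partial>lborel) = f (x + r *\<^sub>R h) - f (x + 0 *\<^sub>R h)"
    proof (rule integral_FTC_Icc_real[OF r])
      fix \<rho>
      show "((\<lambda>\<rho>. f (x + \<rho> *\<^sub>R h)) has_real_derivative F h \<rho>) (at \<rho>)"
        using f[of "x + \<rho> *\<^sub>R h" h] DERIV_shift[of "\<lambda>\<rho>. f (x + \<rho> *\<^sub>R h)" _ 0 \<rho>]
        by (simp add: algebra_simps F_def)
      have "continuous_on UNIV (\<lambda>\<rho>. g e (x + \<rho> *\<^sub>R h))" for e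
        by (rule continuous_on_compose2[OF cont(2)]) (auto intro!: continuous_intros)
      then have "continuous_on UNIV (F h)" unfolding F_def by (intro continuous_intros)
      then show "isCont (F h) \<rho>" by (simp add: continuous_on_eq_continuous_at)
    qed
    then show ?thesis by simp
  qed
  have int: "integrable (lborel \<Otimes>\<^sub>M lborel) (\<lambda>(h, \<rho>). indicator (cball 0 1) h * (F h \<rho> * indicator {0..r} \<rho>))"
  proof (rule integrable_bounded_support[where S = "cball 0 1 \<times> {0..r}" and B = "real DIM('a) * L"])
    show "(\<lambda>(h, \<rho>). indicator (cball 0 1) h * (F h \<rho> * indicator {0..r} \<rho>)) \<in> borel_measurable (lborel \<Otimes>\<^sub>M lborel)"
      unfolding F_def by measurable
    show "emeasure (lborel \<Otimes>\<^sub>M lborel) (cball (0::'a) 1 \<times> {0..r}) < \<infinity>"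
      using emeasure_lborel_cball_finite[of "0::'a" 1] r
      by (subst lborel.emeasure_pair_measure_Times) (auto simp: ennreal_mult_less_top)
    fix z assume "z \<in> cball (0::'a) 1 \<times> {0..r}"
    then obtain h \<rho> where z: "z = (h, \<rho>)" "norm h \<le> 1" by auto
    have "\<bar>F h \<rho>\<bar> \<le> (\<Sum>e\<in>(Basis::'a set). L)"
      unfolding F_def
    proof (rule order_trans[OF sum_abs sum_mono])
      fix e :: 'a assume e: "e \<in> Basis"
      have "\<bar>h \<bullet> e\<bar> \<le> 1" using Basis_le_norm[OF e, of h] z by simp
      then show "\<bar>(h \<bullet> e) * g e (x + \<rho> *\<^sub>R h)\<bar> \<le> L"
        using mult_mono[OF _ gL(1)[OF e], of "\<bar>h \<bullet> e\<bar>" 1 "x + \<rho> *\<^sub>R h"] L0 by (simp add: abs_mult)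
    qed
    then show "\<bar>case z of (h, \<rho>) \<Rightarrow> indicator (cball 0 1) h * (F h \<rho> * indicator {0..r} \<rho>)\<bar> \<le> real DIM('a) * L"
      using L0 by (auto simp: z indicator_def)
  qed (auto simp: indicator_def)
  have "(\<integral>h. indicator (cball 0 1) h * (f (x + r *\<^sub>R h) - f x) \<partial>lborel) =
    (\<integral>h. (\<integral>\<rho>. indicator (cball 0 1) h * (F h \<rho> * indicator {0..r} \<rho>) \<partial>lborel) \<partial>lborel)"
    by (simp add: FTC)
  also have "\<dots> = (\<integral>\<rho>. (\<integral>h. indicator (cball 0 1) h * (F h \<rho> * indicator {0..r} \<rho>) \<partial>lborel) \<partial>lborel)"
    using lborel_pair.Fubini_integral[OF int] by simp
  also have "\<dots> = - (\<integral>\<rho>. indicator {0..r} \<rho> * - (\<integral>h. indicator (cball 0 1) h * F h \<rho> \<partial>lborel) \<partial>lborel)"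
    by (simp add: mult.commute[of _ "indicator {0..r} _"] mult.left_commute[of _ "indicator {0..r} _"])
  also have "\<dots> \<le> 0"
  proof -
    have "(\<integral>h. indicator (cball 0 1) h * F h \<rho> \<partial>lborel) \<le> 0" if "\<rho> \<ge> 0" for \<rho>
      unfolding F_def by (rule integral_radial_derivative_nonpos[OF g gL _ _ lap that]) auto
    then have "0 \<le> (\<integral>\<rho>. indicator {0..r} \<rho> * - (\<integral>h. indicator (cball 0 1) h * F h \<rho> \<partial>lborel) \<partial>lborel)"
      by (intro Bochner_Integration.integral_nonneg) (auto simp: indicator_def)
    then show ?thesis by simp
  qed
  finally show ?thesis .
qed


text \<open>Regularised fundamental solution of real 4-space, with decay exponent
  \<open>2 = 4 - 2\<close>. For \<open>\<epsilon> > 0\<close> it is smooth and bounded at the origin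
  and still superharmonic everywhere.\<close>

definition newton_kernel :: "real \<Rightarrow> quat \<Rightarrow> real" where
  "newton_kernel \<epsilon> y = 1 / (y \<bullet> y + \<epsilon>)"

lemma newton_kernel_bounds:
  assumes "\<epsilon> > 0"
  shows "0 < newton_kernel \<epsilon> y" "newton_kernel \<epsilon> y \<le> 1 / \<epsilon>"
    "\<delta> > 0 \<Longrightarrow> \<delta> \<le> norm y \<Longrightarrow> newton_kernel \<epsilon> y \<le> 1 / \<delta>\<^sup>2"
proof -
  have "0 < y \<bullet> y + \<epsilon>" using assms by (simp add: add_nonneg_pos)
  then show "0 < newton_kernel \<epsilon> y" "newton_kernel \<epsilon> y \<le> 1 / \<epsilon>"
    using assms by (auto simp: newton_kernel_def intro!: divide_left_mono)
  assume "\<delta> > 0" "\<delta> \<le> norm y"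
  then have "\<delta>\<^sup>2 \<le> y \<bullet> y + \<epsilon>"
    using assms power_mono[of \<delta> "norm y" 2] by (simp add: power2_norm_eq_inner)
  then show "newton_kernel \<epsilon> y \<le> 1 / \<delta>\<^sup>2"
    using \<open>\<delta> > 0\<close> \<open>0 < y \<bullet> y + \<epsilon>\<close> by (auto simp: newton_kernel_def intro!: divide_left_mono)
qed

lemma continuous_on_newton_kernel: "\<epsilon> > 0 \<Longrightarrow> continuous_on S (newton_kernel \<epsilon>)"
  unfolding newton_kernel_def
  by (intro continuous_intros) (metis add_nonneg_pos inner_ge_zero less_numeral_extra(3))

lemma borel_measurable_newton_kernel [measurable]: "newton_kernel \<epsilon> \<in> borel_measurable borel"
  unfolding newton_kernel_def by measurable

text \<open>The Laplacian of \<open>1 / (|y|\<^sup>2 + \<epsilon>)\<close> on real 4-space is \<open>-8 \<epsilon> / (|y|\<^sup>2 + \<epsilon>)\<^sup>3\<close>.\<close>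

lemma newton_kernel_mean_scaled:
  assumes \<epsilon>: "\<epsilon> > 0" and "r \<ge> 0"
  shows "(\<integral>h. indicator (cball 0 1) h * (newton_kernel \<epsilon> (x + r *\<^sub>R h) - newton_kernel \<epsilon> x) \<partial>lborel) \<le> 0"
proof -
  define s where "s y = y \<bullet> y + \<epsilon>" for y :: quat
  define g where "g e y = - 2 * (y \<bullet> e) / (s y)\<^sup>2" for e y
  define g2 where "g2 e y = - 2 / (s y)\<^sup>2 + 8 * (y \<bullet> e)\<^sup>2 / (s y) ^ 3" for e y
  have s: "s y > 0" "s y \<ge> \<epsilon>" for y using \<epsilon> by (auto simp: s_def add_nonneg_pos)
  have s': "s (y + t *\<^sub>R v) = s y + 2 * t * (y \<bullet> v) + t\<^sup>2 * (v \<bullet> v)" for y v t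
    by (simp add: s_def inner_add_left inner_add_right inner_commute algebra_simps power2_eq_square)
  have cs: "continuous_on UNIV s" unfolding s_def by (intro continuous_intros)
  have s0: "s y \<noteq> 0" for y using s(1)[of y] by simp
  show ?thesis
  \<comment> \<open>One constant for both derivatives: \<open>g\<close> needs
    \<open>2 / \<epsilon>^2 + 2 / \<epsilon>\<close>, while \<open>g2\<close> needs
    \<open>2 / \<epsilon>^2 + 8 / \<epsilon>^2\<close>.\<close>
  proof (rule ball_mean_superharmonic[where g = g and ?g2.0 = g2 and L = "2 / \<epsilon>\<^sup>2 + 2 / \<epsilon> + 8 / \<epsilon>\<^sup>2"])
    fix y v :: quat
    have "(\<Sum>e\<in>Basis. (v \<bullet> e) * g e y) = - 2 / (s y)\<^sup>2 * (\<Sum>e\<in>Basis. (y \<bullet> e) * (v \<bullet> e))"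
      unfolding sum_distrib_left by (intro sum.cong) (auto simp: g_def)
    then have e: "(\<Sum>e\<in>Basis. (v \<bullet> e) * g e y) = - (2 * (y \<bullet> v)) / (s y)\<^sup>2"
      by (simp add: euclidean_inner[of y v])
    have "((\<lambda>t. 1 / (s y + 2 * t * (y \<bullet> v) + t\<^sup>2 * (v \<bullet> v))) has_real_derivative
        - (2 * (y \<bullet> v)) / (s y)\<^sup>2) (at 0)"
      using s0[of y] by (auto intro!: derivative_eq_intros simp: power2_eq_square)
    then show "((\<lambda>t. newton_kernel \<epsilon> (y + t *\<^sub>R v)) has_real_derivative (\<Sum>e\<in>Basis. (v \<bullet> e) * g e y)) (at 0)"
      unfolding e newton_kernel_def s_def[symmetric] s' .
  next
    fix e y :: quat assume e: "e \<in> Basis"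
    then have ee: "e \<bullet> e = 1" by (simp add: inner_same_Basis)
    have i: "(y + t *\<^sub>R e) \<bullet> e = y \<bullet> e + t" for t by (simp add: inner_add_left ee)
    show "((\<lambda>t. g e (y + t *\<^sub>R e)) has_real_derivative g2 e y) (at 0)"
      unfolding g_def s' i ee using s0[of y]
      by (auto intro!: derivative_eq_intros simp: g2_def divide_simps) (simp add: eval_nat_numeral algebra_simps)
    have yb: "\<bar>y \<bullet> e\<bar> \<le> norm y" using Basis_le_norm[OF e] .
    have ns: "(norm y)\<^sup>2 \<le> s y" using \<epsilon> by (simp add: s_def power2_norm_eq_inner)
    have s2: "1 / (s y)\<^sup>2 \<le> 1 / \<epsilon>\<^sup>2" "1 / s y \<le> 1 / \<epsilon>"
      using s[of y] \<epsilon> by (auto intro!: divide_left_mono power_mono)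
    have "norm y \<le> 1 + s y"
    proof (cases "norm y \<le> 1")
      case False
      then have "norm y \<le> (norm y)\<^sup>2" by (intro self_le_power) auto
      then show ?thesis using ns by simp
    qed (use s[of y] in simp)
    then have "\<bar>g e y\<bar> \<le> 2 * (1 + s y) / (s y)\<^sup>2"
      using yb s[of y] by (simp add: g_def abs_mult divide_right_mono)
    also have "\<dots> = 2 * (1 / (s y)\<^sup>2) + 2 * (1 / s y)"
      using s0[of y] by (simp add: power2_eq_square add_divide_distrib)
    finally have "\<bar>g e y\<bar> \<le> 2 * (1 / (s y)\<^sup>2) + 2 * (1 / s y)" .
    moreover have "2 * (1 / (s y)\<^sup>2) \<le> 2 / \<epsilon>\<^sup>2" "2 * (1 / s y) \<le> 2 / \<epsilon>" "0 \<le> 8 / \<epsilon>\<^sup>2"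
      using s2 by simp_all
    ultimately show "\<bar>g e y\<bar> \<le> 2 / \<epsilon>\<^sup>2 + 2 / \<epsilon> + 8 / \<epsilon>\<^sup>2" by linarith
    have "(y \<bullet> e)\<^sup>2 \<le> s y" using power_mono[OF yb, of 2] ns by simp
    then have "8 * (y \<bullet> e)\<^sup>2 / (s y) ^ 3 \<le> 8 * s y / (s y) ^ 3"
      using s[of y] by (intro divide_right_mono) auto
    also have "\<dots> = 8 * (1 / (s y)\<^sup>2)" using s0[of y] by (simp add: power2_eq_square power3_eq_cube)
    finally have "8 * (y \<bullet> e)\<^sup>2 / (s y) ^ 3 \<le> 8 / \<epsilon>\<^sup>2" using s2 by simp
    moreover have "0 \<le> 8 * (y \<bullet> e)\<^sup>2 / (s y) ^ 3" using s[of y] by simp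
    moreover have "0 \<le> 2 / (s y)\<^sup>2" "2 / (s y)\<^sup>2 \<le> 2 / \<epsilon>\<^sup>2" using s2 by simp_all
    moreover have "0 \<le> 2 / \<epsilon>" "0 \<le> 8 / \<epsilon>\<^sup>2" using \<epsilon> by simp_all
    moreover have "g2 e y = 8 * (y \<bullet> e)\<^sup>2 / (s y) ^ 3 - 2 / (s y)\<^sup>2" by (simp add: g2_def)
    ultimately show "\<bar>g2 e y\<bar> \<le> 2 / \<epsilon>\<^sup>2 + 2 / \<epsilon> + 8 / \<epsilon>\<^sup>2" by linarith
  next
    fix e :: quat
    show "continuous_on UNIV (g e)" unfolding g_def by (intro continuous_intros cs) (simp add: s0)
    show "g2 e \<in> borel_measurable borel" unfolding g2_def s_def by measurable
  next
    fix y
    \<comment> \<open>The 4 is the real dimension; with it the terms in \<open>|y|^2\<close> cancel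
      and only a negative multiple of \<epsilon> is left.\<close>
    have "(\<Sum>e\<in>Basis. g2 e y) = 4 * (- 2 / (s y)\<^sup>2) + 8 * (\<Sum>e\<in>Basis. (y \<bullet> e)\<^sup>2) / (s y) ^ 3"
      by (simp add: g2_def sum.distrib sum_distrib_left sum_divide_distrib sum_negf sum_subtractf)
    also have "(\<Sum>e\<in>Basis. (y \<bullet> e)\<^sup>2) = y \<bullet> y"
      by (subst (2) euclidean_inner) (simp add: power2_eq_square)
    also have "4 * (- 2 / (s y)\<^sup>2) + 8 * (y \<bullet> y) / (s y) ^ 3 = - 8 * \<epsilon> / (s y) ^ 3"
      using s0[of y] by (simp add: power2_eq_square power3_eq_cube divide_simps) (simp add: s_def algebra_simps)
    also have "\<dots> \<le> 0" using \<epsilon> s[of y] by simp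
    finally show "(\<Sum>e\<in>Basis. g2 e y) \<le> 0" .
  qed (use \<open>r \<ge> 0\<close> continuous_on_newton_kernel[OF \<epsilon>] in auto)
qed

lemma nn_integral_cball_scale:
  fixes f :: "'a::euclidean_space \<Rightarrow> ennreal"
  assumes [measurable]: "f \<in> borel_measurable borel" and r: "r > 0"
  shows "(\<integral>\<^sup>+y\<in>cball x r. f y \<partial>lborel) =
    ennreal (r ^ DIM('a)) * (\<integral>\<^sup>+h\<in>cball 0 1. f (x + r *\<^sub>R h) \<partial>lborel)"
proof -
  have [measurable]: "cball x r \<in> sets borel" by simp
  have "(\<integral>\<^sup>+y\<in>cball x r. f y \<partial>lborel) =
    (\<integral>\<^sup>+y\<in>cball x r. f y \<partial>density (distr lborel borel (\<lambda>h. x + r *\<^sub>R h)) (\<lambda>_. ennreal (\<bar>r\<bar> ^ DIM('a))))"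
    using r lborel_affine[of r x] by simp
  also have "\<dots> = ennreal (r ^ DIM('a)) * (\<integral>\<^sup>+h. f (x + r *\<^sub>R h) * indicator (cball x r) (x + r *\<^sub>R h) \<partial>lborel)"
    using r by (subst nn_integral_density, simp, simp, subst nn_integral_distr)
      (simp_all add: nn_integral_cmult)
  also have "(\<integral>\<^sup>+h. f (x + r *\<^sub>R h) * indicator (cball x r) (x + r *\<^sub>R h) \<partial>lborel) = (\<integral>\<^sup>+h\<in>cball 0 1. f (x + r *\<^sub>R h) \<partial>lborel)"
    using r by (intro nn_integral_cong) (auto simp: indicator_def dist_norm)
  finally show ?thesis .
qed

lemma newton_kernel_mean:
  assumes \<epsilon>: "\<epsilon> > 0" and r: "r > 0"
  shows "(\<integral>\<^sup>+y\<in>cball x r. ennreal (newton_kernel \<epsilon> y) \<partial>lborel) \<le> emeasure lborel (cball x r) * ennreal (newton_kernel \<epsilon> x)"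
proof -
  have [measurable]: "cball (0::quat) 1 \<in> sets borel" by simp
  note nk = newton_kernel_bounds[OF \<epsilon>]
  let ?f = "\<lambda>h. indicator (cball 0 1) h * newton_kernel \<epsilon> (x + r *\<^sub>R h)"
  have fin: "emeasure lborel (cball (0::quat) 1) < \<infinity>" by (rule emeasure_lborel_cball_finite)
  have i1: "integrable lborel ?f"
    by (rule integrable_bounded_support[where S = "cball 0 1" and B = "1 / \<epsilon>"])
      (use fin nk in \<open>auto simp: abs_of_pos\<close>)
  have i2: "integrable lborel (\<lambda>h::quat. indicator (cball 0 1) h * newton_kernel \<epsilon> x)"
    using fin by (intro integrable_mult_left integrable_real_indicator) auto
  have "(\<integral>h. ?f h \<partial>lborel) - measure lborel (cball (0::quat) 1) * newton_kernel \<epsilon> x =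
    (\<integral>h. indicator (cball 0 1) h * (newton_kernel \<epsilon> (x + r *\<^sub>R h) - newton_kernel \<epsilon> x) \<partial>lborel)"
    using i1 i2 by (simp add: right_diff_distrib)
  also have "\<dots> \<le> 0" using newton_kernel_mean_scaled[OF \<epsilon>, of r x] r by simp
  finally have le: "(\<integral>h. ?f h \<partial>lborel) \<le> measure lborel (cball (0::quat) 1) * newton_kernel \<epsilon> x" by simp
  have "(\<integral>\<^sup>+h\<in>cball 0 1. ennreal (newton_kernel \<epsilon> (x + r *\<^sub>R h)) \<partial>lborel) = (\<integral>\<^sup>+h. ennreal (?f h) \<partial>lborel)"
    by (intro nn_integral_cong) (auto simp: indicator_def)
  also have "\<dots> = ennreal (\<integral>h. ?f h \<partial>lborel)"
    using nk(1) by (intro nn_integral_eq_integral i1) (auto simp: less_imp_le)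
  also have "\<dots> \<le> ennreal (measure lborel (cball (0::quat) 1) * newton_kernel \<epsilon> x)" by (rule ennreal_leI[OF le])
  also have "\<dots> = emeasure lborel (cball (0::quat) 1) * ennreal (newton_kernel \<epsilon> x)"
  proof -
    have "emeasure lborel (cball (0::quat) 1) = ennreal (measure lborel (cball (0::quat) 1))"
      using fin by (intro emeasure_eq_ennreal_measure) auto
    then show ?thesis using nk(1)[of x] by (simp add: ennreal_mult')
  qed
  finally have "ennreal (r ^ DIM(quat)) * (\<integral>\<^sup>+h\<in>cball 0 1. ennreal (newton_kernel \<epsilon> (x + r *\<^sub>R h)) \<partial>lborel) \<le>
    ennreal (r ^ DIM(quat)) * (emeasure lborel (cball (0::quat) 1) * ennreal (newton_kernel \<epsilon> x))"
    by (rule mult_left_mono) simp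
  moreover have "ennreal (r ^ DIM(quat)) * emeasure lborel (cball (0::quat) 1) = emeasure lborel (cball x r)"
    using r by (simp add: emeasure_cball mult.commute flip: ennreal_mult)
  moreover have "(\<integral>\<^sup>+y\<in>cball x r. ennreal (newton_kernel \<epsilon> y) \<partial>lborel) =
      ennreal (r ^ DIM(quat)) * (\<integral>\<^sup>+h\<in>cball 0 1. ennreal (newton_kernel \<epsilon> (x + r *\<^sub>R h)) \<partial>lborel)"
    by (rule nn_integral_cball_scale[OF _ r]) measurable
  ultimately show ?thesis by (simp only: mult.assoc[symmetric])
qed

text \<open>\<open>inverse\<close> on \<open>ennreal\<close> is \<open>\<infinity>\<close> at 0, so this includes the pole.\<close>

lemma inverse_norm_square_mean:
  fixes x :: quat
  assumes r: "r > 0"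
  shows "(\<integral>\<^sup>+y\<in>cball x r. inverse (ennreal ((norm y)\<^sup>2)) \<partial>lborel) \<le>
    emeasure lborel (cball x r) * inverse (ennreal ((norm x)\<^sup>2))"
proof -
  have [measurable]: "cball x r \<in> sets borel" by simp
  define d where "d n = inverse (real (Suc n))" for n
  have d: "d n > 0" for n by (simp add: d_def)
  have dl: "d \<longlonglongrightarrow> 0" unfolding d_def by (rule LIMSEQ_inverse_real_of_nat)
  let ?k = "\<lambda>y::quat. inverse (ennreal ((norm y)\<^sup>2))"
  have le: "ennreal (newton_kernel (d n) y) \<le> ?k y" for n y
  proof (cases "y = 0")
    case False
    then have "newton_kernel (d n) y \<le> inverse ((norm y)\<^sup>2)"
      using d[of n] add_nonneg_pos[OF inner_ge_zero d, of y n]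
      by (auto simp: newton_kernel_def power2_norm_eq_inner divide_simps)
    then show ?thesis using False by (simp add: inverse_ennreal ennreal_leI)
  qed simp
  have "?k y \<le> liminf (\<lambda>n. ennreal (newton_kernel (d n) y))" if "y \<noteq> 0" for y
  proof -
    have "(\<lambda>n. newton_kernel (d n) y) \<longlonglongrightarrow> 1 / (y \<bullet> y + 0)"
      unfolding newton_kernel_def using that by (intro tendsto_intros dl) auto
    then have "(\<lambda>n. ennreal (newton_kernel (d n) y)) \<longlonglongrightarrow> ennreal (1 / (y \<bullet> y))" by (simp add: tendsto_ennrealI)
    then have "liminf (\<lambda>n. ennreal (newton_kernel (d n) y)) = ennreal (1 / (y \<bullet> y))"
      by (intro lim_imp_Liminf) auto
    then show ?thesis using that by (simp add: inverse_ennreal power2_norm_eq_inner inverse_eq_divide)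
  qed
  \<comment> \<open>Fatou's lemma along \<open>\<epsilon> = d n\<close>, with the pole discarded as
    a null set. On the right the smoothed values at \<open>x\<close> are at most the kernel itself,
    so no limit is taken there.\<close>
  then have "(\<integral>\<^sup>+y\<in>cball x r. ?k y \<partial>lborel) \<le> (\<integral>\<^sup>+y. liminf (\<lambda>n. ennreal (newton_kernel (d n) y) * indicator (cball x r) y) \<partial>lborel)"
    using AE_lborel_singleton[of "0::quat"]
    by (intro nn_integral_mono_AE) (auto elim!: eventually_mono simp: indicator_def)
  also have "\<dots> \<le> liminf (\<lambda>n. \<integral>\<^sup>+y\<in>cball x r. ennreal (newton_kernel (d n) y) \<partial>lborel)"
    by (rule nn_integral_liminf) measurable
  also have "\<dots> \<le> emeasure lborel (cball x r) * ?k x"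
  proof (intro Liminf_le always_eventually allI)
    fix n
    have "emeasure lborel (cball x r) * ennreal (newton_kernel (d n) x) \<le> emeasure lborel (cball x r) * ?k x"
      by (rule mult_left_mono[OF le]) simp
    then show "(\<integral>\<^sup>+y\<in>cball x r. ennreal (newton_kernel (d n) y) \<partial>lborel) \<le> emeasure lborel (cball x r) * ?k x"
      using newton_kernel_mean[OF d r, of n x] by simp
  qed simp
  finally show ?thesis .
qed

section \<open>Weak-type estimate on quaternionic lines\<close>

text \<open>The convex function \<open>1 / x\<close> lies above its tangent at the mean
  \<open>m\<close>; four such inequalities are added.\<close>

lemma am_hm_four:
  fixes x1 x2 x3 x4 m :: real
  assumes "x1 > 0" "x2 > 0" "x3 > 0" "x4 > 0" and m: "x1 + x2 + x3 + x4 = 4 * m"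
  shows "4 / m \<le> 1 / x1 + 1 / x2 + 1 / x3 + 1 / x4"
proof -
  have m0: "m > 0" using assms by linarith
  have tangent: "2 / m - x / m\<^sup>2 \<le> 1 / x" if "x > 0" for x :: real
  proof -
    have "1 / x - (2 / m - x / m\<^sup>2) = (x - m)\<^sup>2 / (x * m\<^sup>2)"
      using that m0 by (simp add: field_simps power2_eq_square)
    also have "\<dots> \<ge> 0" using that m0 by simp
    finally show ?thesis by simp
  qed
  have "4 / m = 4 * (2 / m) - (x1 + x2 + x3 + x4) / m\<^sup>2"
    using m0 unfolding m by (simp add: power2_eq_square)
  also have "\<dots> = (2 / m - x1 / m\<^sup>2) + (2 / m - x2 / m\<^sup>2) + (2 / m - x3 / m\<^sup>2) + (2 / m - x4 / m\<^sup>2)"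
    by (simp add: add_divide_distrib)
  finally show ?thesis using tangent assms(1-4) by (smt (verit))
qed

text \<open>The units 1, i, j, k, indexed by naturals so that sums over the frame run over
  \<open>k < 4\<close>.\<close>

definition quat_unit :: "nat \<Rightarrow> quat" where
  "quat_unit k = (if k = 0 then axis 1 1 else if k = 1 then axis 2 1 else if k = 2 then axis 3 1 else axis 4 1)"

lemma norm_quat_unit: "norm (quat_unit k) = 1"
  by (simp add: quat_unit_def norm_eq_sqrt_inner inner_axis_axis)

text \<open>The vectors \<open>h\<close>, \<open>h i\<close>, \<open>h j\<close>, \<open>h k\<close> form an orthogonal frame.\<close>

lemma quat_frame:
  "(d \<bullet> (h \<otimes>\<^sub>q quat_unit 0))\<^sup>2 + (d \<bullet> (h \<otimes>\<^sub>q quat_unit 1))\<^sup>2 +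
   (d \<bullet> (h \<otimes>\<^sub>q quat_unit 2))\<^sup>2 + (d \<bullet> (h \<otimes>\<^sub>q quat_unit 3))\<^sup>2 = (d \<bullet> d) * (h \<bullet> h)"
proof -
  have *: "d \<bullet> (h \<otimes>\<^sub>q quat_unit 0) = d$1 * h$1 + d$2 * h$2 + d$3 * h$3 + d$4 * h$4"
    "d \<bullet> (h \<otimes>\<^sub>q quat_unit 1) = - d$1 * h$2 + d$2 * h$1 + d$3 * h$4 - d$4 * h$3"
    "d \<bullet> (h \<otimes>\<^sub>q quat_unit 2) = - d$1 * h$3 - d$2 * h$4 + d$3 * h$1 + d$4 * h$2"
    "d \<bullet> (h \<otimes>\<^sub>q quat_unit 3) = - d$1 * h$4 + d$2 * h$3 - d$3 * h$2 + d$4 * h$1"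
    by (simp_all add: inner_quat qmult_nth quat_unit_def axis_def)
  show ?thesis unfolding * unfolding inner_quat by algebra
qed

text \<open>A lower bound for an eight-point mean that replaces a Taylor expansion. With
  \<open>A = |d|^2 + |h|^2 + \<epsilon>\<close> and \<open>a k\<close> the inner product of
  \<open>d\<close> with a frame vector, the two points of opposite sign contribute
  \<open>2 A / (A^2 - 4 (a k)^2)\<close>. The frame identity fixes the sum of the
  \<open>(a k)^2\<close>, so the inequality between arithmetic and harmonic means applies with mean
  \<open>A^2 - |d|^2 |h|^2\<close>. The assumption \<open>|h|^2 \<le> \<epsilon>\<close> makes the
  remaining error proportional to \<open>\<epsilon> |h|^2\<close>, as the size of the Laplacian
  predicts.\<close>

lemma newton_kernel_frame:
  assumes \<epsilon>: "\<epsilon> > 0" and \<delta>: "\<delta> > 0" "\<delta> \<le> norm d" and h: "(norm h)\<^sup>2 \<le> \<epsilon>"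
  shows "8 * (newton_kernel \<epsilon> d - 2 * \<epsilon> / \<delta> ^ 6 * (norm h)\<^sup>2) \<le>
    (\<Sum>k<4. newton_kernel \<epsilon> (d + h \<otimes>\<^sub>q quat_unit k) + newton_kernel \<epsilon> (d - h \<otimes>\<^sub>q quat_unit k))"
proof -
  define D H where "D = d \<bullet> d" and "H = h \<bullet> h"
  define A where "A = D + H + \<epsilon>"
  define a where "a k = d \<bullet> (h \<otimes>\<^sub>q quat_unit k)" for k
  have D: "D \<ge> \<delta>\<^sup>2" using \<delta> power_mono[of \<delta> "norm d" 2] by (simp add: D_def power2_norm_eq_inner)
  then have D0: "D > 0" using \<delta> by (smt (verit) zero_less_power)
  have H: "H \<ge> 0" "H \<le> \<epsilon>" using h by (auto simp: H_def power2_norm_eq_inner)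
  have A0: "A > 0" using D0 H \<epsilon> by (simp add: A_def)
  have hh: "(h \<otimes>\<^sub>q quat_unit k) \<bullet> (h \<otimes>\<^sub>q quat_unit k) = H" for k
    by (simp add: H_def norm_qmult norm_quat_unit flip: power2_norm_eq_inner)
  have k1: "newton_kernel \<epsilon> (d + h \<otimes>\<^sub>q quat_unit k) = 1 / (A + 2 * a k)" for k
    by (simp add: newton_kernel_def inner_add_left inner_add_right hh A_def D_def a_def inner_commute algebra_simps)
  have k2: "newton_kernel \<epsilon> (d - h \<otimes>\<^sub>q quat_unit k) = 1 / (A - 2 * a k)" for k
    by (simp add: newton_kernel_def inner_diff_left inner_diff_right hh A_def D_def a_def inner_commute algebra_simps)
  have fr: "(a 0)\<^sup>2 + (a 1)\<^sup>2 + (a 2)\<^sup>2 + (a 3)\<^sup>2 = D * H"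
    using quat_frame[of d h] by (simp add: a_def D_def H_def)
  \<comment> \<open>This identity keeps all four denominators positive, because each
    \<open>(a k)^2\<close> is at most \<open>D * H\<close>.\<close>
  have AD: "A\<^sup>2 - 4 * (D * H) > 0"
  proof -
    have "A\<^sup>2 - 4 * (D * H) = (D - H)\<^sup>2 + \<epsilon> * (2 * D + 2 * H + \<epsilon>)"
      by (simp add: A_def power2_eq_square algebra_simps)
    then show ?thesis using \<epsilon> D0 H by (smt (verit) mult_pos_pos zero_le_power2)
  qed
  have x: "A\<^sup>2 - 4 * (a k)\<^sup>2 > 0" if "k \<in> {0,1,2,3}" for k
  proof -
    have "(a 0)\<^sup>2 \<le> D * H" "(a 1)\<^sup>2 \<le> D * H" "(a 2)\<^sup>2 \<le> D * H" "(a 3)\<^sup>2 \<le> D * H"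
      using fr zero_le_power2[of "a 0"] zero_le_power2[of "a 1"] zero_le_power2[of "a 2"] zero_le_power2[of "a 3"]
      by linarith+
    then have "(a k)\<^sup>2 \<le> D * H" using that by auto
    then show ?thesis using AD by simp
  qed
  have pair: "newton_kernel \<epsilon> (d + h \<otimes>\<^sub>q quat_unit k) + newton_kernel \<epsilon> (d - h \<otimes>\<^sub>q quat_unit k) =
      2 * A * (1 / (A\<^sup>2 - 4 * (a k)\<^sup>2))" if "k \<in> {0,1,2,3}" for k
  proof -
    have e: "A\<^sup>2 - 4 * (a k)\<^sup>2 = (A + 2 * a k) * (A - 2 * a k)"
      by (simp add: power2_eq_square algebra_simps)
    then have "A + 2 * a k \<noteq> 0" "A - 2 * a k \<noteq> 0" using x[OF that] by auto
    then show ?thesis unfolding k1 k2 e by (simp add: divide_simps)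
  qed
  have "4 / (A\<^sup>2 - D * H) \<le> 1 / (A\<^sup>2 - 4 * (a 0)\<^sup>2) + 1 / (A\<^sup>2 - 4 * (a 1)\<^sup>2) + 1 / (A\<^sup>2 - 4 * (a 2)\<^sup>2) + 1 / (A\<^sup>2 - 4 * (a 3)\<^sup>2)"
    using x fr by (intro am_hm_four) auto
  from mult_left_mono[OF this, of "2 * A"] have
    "2 * A * (4 / (A\<^sup>2 - D * H)) \<le> 2 * A * (1 / (A\<^sup>2 - 4 * (a 0)\<^sup>2)) + 2 * A * (1 / (A\<^sup>2 - 4 * (a 1)\<^sup>2))
      + 2 * A * (1 / (A\<^sup>2 - 4 * (a 2)\<^sup>2)) + 2 * A * (1 / (A\<^sup>2 - 4 * (a 3)\<^sup>2))"
    using A0 by (simp add: distrib_left)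
  also have "\<dots> = (\<Sum>k<4. newton_kernel \<epsilon> (d + h \<otimes>\<^sub>q quat_unit k) + newton_kernel \<epsilon> (d - h \<otimes>\<^sub>q quat_unit k))"
    using pair by (simp add: eval_nat_numeral)
  finally have le: "8 * (A / (A\<^sup>2 - D * H)) \<le>
    (\<Sum>k<4. newton_kernel \<epsilon> (d + h \<otimes>\<^sub>q quat_unit k) + newton_kernel \<epsilon> (d - h \<otimes>\<^sub>q quat_unit k))" by simp
  have DH0: "0 \<le> D * H" using D0 H by simp
  have AA: "A\<^sup>2 - D * H \<ge> D\<^sup>2"
  proof -
    have "A\<^sup>2 - D * H - D\<^sup>2 = D * H + H\<^sup>2 + \<epsilon> * (2 * D + 2 * H + \<epsilon>)"
      by (simp add: A_def power2_eq_square algebra_simps)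
    also have "\<dots> \<ge> 0" using \<epsilon> D0 H by simp
    finally show ?thesis by simp
  qed
  then have AA0: "A\<^sup>2 - D * H > 0" using D0 by (smt (verit) zero_less_power)
  have De: "D + \<epsilon> > 0" using D0 \<epsilon> by simp
  have "1 / (D + \<epsilon>) - A / (A\<^sup>2 - D * H) = (H * (H + \<epsilon>)) / ((D + \<epsilon>) * (A\<^sup>2 - D * H))"
  proof -
    have "(A\<^sup>2 - D * H) - A * (D + \<epsilon>) = H * (H + \<epsilon>)"
      by (simp add: A_def power2_eq_square algebra_simps)
    then show ?thesis using De AA0 by (simp add: diff_frac_eq mult.commute)
  qed
  also have "\<dots> \<le> (H * (2 * \<epsilon>)) / (\<delta>\<^sup>2 * (\<delta>\<^sup>2)\<^sup>2)"
  proof (rule frac_le)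
    show "H * (H + \<epsilon>) \<le> H * (2 * \<epsilon>)" using H by (intro mult_left_mono) auto
    have "(\<delta>\<^sup>2)\<^sup>2 \<le> D\<^sup>2" using D by (intro power_mono) auto
    then show "\<delta>\<^sup>2 * (\<delta>\<^sup>2)\<^sup>2 \<le> (D + \<epsilon>) * (A\<^sup>2 - D * H)"
      using D AA \<epsilon> De by (intro mult_mono) auto
  qed (use H \<epsilon> \<delta> in auto)
  also have "\<dots> = 2 * \<epsilon> / \<delta> ^ 6 * H" by (simp add: eval_nat_numeral mult_ac)
  finally have "1 / (D + \<epsilon>) - 2 * \<epsilon> / \<delta> ^ 6 * H \<le> A / (A\<^sup>2 - D * H)" by simp
  then show ?thesis using le by (simp add: newton_kernel_def D_def H_def power2_norm_eq_inner)
qed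

lemma nn_integral_lborel_translate:
  fixes f :: "'a::euclidean_space \<Rightarrow> ennreal"
  assumes "f \<in> borel_measurable borel"
  shows "(\<integral>\<^sup>+x. f (x + c) \<partial>lborel) = (\<integral>\<^sup>+x. f x \<partial>lborel)"
proof -
  have "(\<integral>\<^sup>+x. f x \<partial>lborel) = (\<integral>\<^sup>+x. f x \<partial>distr lborel borel ((+) c))"
    by (simp add: lborel_distr_plus)
  also have "\<dots> = (\<integral>\<^sup>+x. f (x + c) \<partial>lborel)"
    using assms by (subst nn_integral_distr) (auto simp: add.commute)
  finally show ?thesis ..
qed

lemma integral_le_nn_integral:
  fixes f :: "'a \<Rightarrow> real"
  assumes f: "integrable M f"
  shows "ennreal (\<integral>x. f x \<partial>M) \<le> (\<integral>\<^sup>+x. ennreal (f x) \<partial>M)"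
proof -
  have "ennreal (\<integral>x. f x \<partial>M) \<le> ennreal (\<integral>x. max 0 (f x) \<partial>M)"
    using f by (intro ennreal_leI integral_mono integrable_max) auto
  also have "\<dots> = (\<integral>\<^sup>+x. ennreal (max 0 (f x)) \<partial>M)"
    using f by (intro nn_integral_eq_integral[symmetric] integrable_max) auto
  finally show ?thesis by (simp add: ennreal_max_0)
qed

lemma integral_cball_isometry:
  fixes f :: "quat \<Rightarrow> real" and T :: "quat \<Rightarrow> quat"
  assumes [measurable]: "f \<in> borel_measurable borel" and T: "linear T" "\<And>h. norm (T h) = norm h"
  shows "(\<integral>h. indicator (cball 0 \<rho>) h * f (T h) \<partial>lborel) = (\<integral>h. indicator (cball 0 \<rho>) h * f h \<partial>lborel)"
proof -
  have [measurable]: "cball (0::quat) \<rho> \<in> sets borel" by simp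
  have [measurable]: "T \<in> borel_measurable borel"
    using T by (intro borel_measurable_continuous_onI linear_continuous_on)
      (simp add: linear_conv_bounded_linear)
  have "(\<integral>h. indicator (cball 0 \<rho>) h * f h \<partial>lborel) = (\<integral>h. indicator (cball 0 \<rho>) h * f h \<partial>distr lborel borel T)"
    by (simp add: distr_lborel_isometry[OF T])
  also have "\<dots> = (\<integral>h. indicator (cball 0 \<rho>) (T h) * f (T h) \<partial>lborel)"
    by (subst integral_distr) auto
  also have "\<dots> = (\<integral>h. indicator (cball 0 \<rho>) h * f (T h) \<partial>lborel)"
    by (intro Bochner_Integration.integral_cong) (auto simp: indicator_def T)
  finally show ?thesis ..
qed

text \<open>For each unit \<open>h \<mapsto> h \<otimes>\<^sub>q quat_unit k\<close> and its
  negative are isometries preserving the ball. Integrating the frame inequality over the ball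
  therefore gives eight copies of the same ball integral.\<close>

lemma newton_kernel_local_mean:
  assumes \<epsilon>: "\<epsilon> > 0" and \<delta>: "\<delta> > 0" "\<delta> \<le> norm d" and \<rho>: "0 < \<rho>" "\<rho>\<^sup>2 \<le> \<epsilon>"
  shows "(\<integral>h. indicator (cball 0 \<rho>) h * (newton_kernel \<epsilon> d - 2 * \<epsilon> / \<delta> ^ 6 * (norm (h::quat))\<^sup>2) \<partial>lborel) \<le>
    (\<integral>h. indicator (cball 0 \<rho>) h * newton_kernel \<epsilon> (d + h) \<partial>lborel)" (is "?L \<le> ?R")
proof -
  have [measurable]: "cball (0::quat) \<rho> \<in> sets borel" by simp
  let ?I = "indicator (cball 0 \<rho>) :: quat \<Rightarrow> real"
  let ?p = "\<lambda>k h. newton_kernel \<epsilon> (d + h \<otimes>\<^sub>q quat_unit k)" and ?m = "\<lambda>k h. newton_kernel \<epsilon> (d - h \<otimes>\<^sub>q quat_unit k)"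
  have [measurable]: "(\<lambda>h. h \<otimes>\<^sub>q quat_unit k) \<in> borel_measurable borel" for k
    using linear_qmult_left[of "quat_unit k"] by (intro borel_measurable_continuous_onI linear_continuous_on)
      (simp add: linear_conv_bounded_linear)
  have fin: "emeasure lborel (cball (0::quat) \<rho>) < \<infinity>" by (rule emeasure_lborel_cball_finite)
  have bnd: "\<bar>newton_kernel \<epsilon> y\<bar> \<le> 1 / \<epsilon>" for y using newton_kernel_bounds(1,2)[OF \<epsilon>, of y] by simp
  have ip: "integrable lborel (\<lambda>h. ?I h * ?p k h)" for k
    by (rule integrable_bounded_support[where S = "cball 0 \<rho>" and B = "1 / \<epsilon>"]) (use fin bnd in auto)
  have im: "integrable lborel (\<lambda>h. ?I h * ?m k h)" for k
    by (rule integrable_bounded_support[where S = "cball 0 \<rho>" and B = "1 / \<epsilon>"]) (use fin bnd in auto)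
  have "(\<integral>h. ?I h * ?p k h \<partial>lborel) = ?R" for k
    using integral_cball_isometry[of "\<lambda>h. newton_kernel \<epsilon> (d + h)" "\<lambda>h. h \<otimes>\<^sub>q quat_unit k" \<rho>]
    by (simp add: linear_qmult_left norm_qmult norm_quat_unit)
  moreover have "(\<integral>h. ?I h * ?m k h \<partial>lborel) = ?R" for k
    using integral_cball_isometry[of "\<lambda>h. newton_kernel \<epsilon> (d + h)" "\<lambda>h. - (h \<otimes>\<^sub>q quat_unit k)" \<rho>]
    by (simp add: linear_qmult_left linear_compose_neg norm_qmult norm_quat_unit)
  ultimately have "8 * ?R = (\<Sum>k<4. (\<integral>h. ?I h * ?p k h \<partial>lborel) + (\<integral>h. ?I h * ?m k h \<partial>lborel))" by simp
  also have "\<dots> = (\<integral>h. (\<Sum>k<4. ?I h * ?p k h + ?I h * ?m k h) \<partial>lborel)"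
    using ip im by (subst Bochner_Integration.integral_sum) simp_all
  also have "\<dots> \<ge> (\<integral>h. 8 * (?I h * (newton_kernel \<epsilon> d - 2 * \<epsilon> / \<delta> ^ 6 * (norm h)\<^sup>2)) \<partial>lborel)"
  proof (rule integral_mono)
    show "integrable lborel (\<lambda>h. 8 * (?I h * (newton_kernel \<epsilon> d - 2 * \<epsilon> / \<delta> ^ 6 * (norm h)\<^sup>2)))"
    proof (intro integrable_mult_right integrable_bounded_support[where S = "cball 0 \<rho>"])
      fix h :: quat assume "h \<in> cball 0 \<rho>"
      then have "norm h \<le> \<rho>" by simp
      then have "2 * \<epsilon> / \<delta> ^ 6 * (norm h)\<^sup>2 \<le> 2 * \<epsilon> / \<delta> ^ 6 * \<rho>\<^sup>2"
        using \<epsilon> \<delta> by (intro mult_left_mono power_mono) auto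
      moreover have "0 \<le> 2 * \<epsilon> / \<delta> ^ 6 * (norm h)\<^sup>2" using \<epsilon> \<delta> by simp
      ultimately show "\<bar>?I h * (newton_kernel \<epsilon> d - 2 * \<epsilon> / \<delta> ^ 6 * (norm h)\<^sup>2)\<bar> \<le> 1 / \<epsilon> + 2 * \<epsilon> / \<delta> ^ 6 * \<rho>\<^sup>2"
        using bnd[of d] \<open>h \<in> cball 0 \<rho>\<close> by (auto simp del: times_divide_eq_left)
    qed (use fin in auto)
    show "integrable lborel (\<lambda>h. \<Sum>k<4. ?I h * ?p k h + ?I h * ?m k h)" using ip im by simp
    fix h :: quat
    show "8 * (?I h * (newton_kernel \<epsilon> d - 2 * \<epsilon> / \<delta> ^ 6 * (norm h)\<^sup>2)) \<le> (\<Sum>k<4. ?I h * ?p k h + ?I h * ?m k h)"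
    proof (cases "h \<in> cball 0 \<rho>")
      case True
      then have "(norm h)\<^sup>2 \<le> \<rho>\<^sup>2" by (intro power_mono) auto
      then have "(norm h)\<^sup>2 \<le> \<epsilon>" using \<rho> by linarith
      from newton_kernel_frame[OF \<epsilon> \<delta> this] show ?thesis using True by simp
    qed simp
  qed
  finally show ?thesis by simp
qed

section \<open>The smoothed Newton potential of a compact set\<close>

definition newton_potential :: "real \<Rightarrow> quat set \<Rightarrow> quat \<Rightarrow> real" where
  "newton_potential \<epsilon> K x = (\<integral>z. indicator K z * newton_kernel \<epsilon> (x - z) \<partial>lborel)"

context
  fixes \<epsilon> :: real and K :: "quat set"
  assumes \<epsilon>: "\<epsilon> > 0" and K: "compact K"
  notes [measurable] = borel_closed[OF compact_imp_closed[OF K]]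
begin

lemma emeasure_K: "emeasure lborel K < \<infinity>" "emeasure lborel K = ennreal (measure lborel K)"
proof -
  show "emeasure lborel K < \<infinity>" by (rule emeasure_bounded_finite[OF compact_imp_bounded[OF K]])
  then show "emeasure lborel K = ennreal (measure lborel K)" by (intro emeasure_eq_ennreal_measure) auto
qed

lemma newton_kernel_abs: "\<bar>newton_kernel \<epsilon> y\<bar> \<le> 1 / \<epsilon>"
  using newton_kernel_bounds(1,2)[OF \<epsilon>, of y] by simp

lemma integrable_newton_potential: "integrable lborel (\<lambda>z. indicator K z * newton_kernel \<epsilon> (x - z))"
  by (rule integrable_bounded_support[where S = K and B = "1 / \<epsilon>"]) (use emeasure_K newton_kernel_abs in auto)

lemma continuous_newton_potential: "continuous_on UNIV (newton_potential \<epsilon> K)"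
proof (subst continuous_on_eq_continuous_at[OF open_UNIV], rule ballI, subst continuous_at_sequentially, intro allI impI)
  fix x :: quat and y :: "nat \<Rightarrow> quat" assume y: "y \<longlonglongrightarrow> x"
  show "(newton_potential \<epsilon> K \<circ> y) \<longlonglongrightarrow> newton_potential \<epsilon> K x"
    unfolding newton_potential_def o_def
  proof (rule integral_dominated_convergence[where w = "\<lambda>z. indicator K z * (1 / \<epsilon>)"])
    show "integrable lborel (\<lambda>z. indicator K z * (1 / \<epsilon>))"
      using emeasure_K by (intro integrable_mult_left integrable_real_indicator) auto
    show "AE z in lborel. (\<lambda>n. indicator K z * newton_kernel \<epsilon> (y n - z)) \<longlonglongrightarrow> indicator K z * newton_kernel \<epsilon> (x - z)"
    proof (intro AE_I2 tendsto_intros)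
      fix z
      have "isCont (newton_kernel \<epsilon>) (x - z)"
        using continuous_on_newton_kernel[OF \<epsilon>, of UNIV] by (simp add: continuous_on_eq_continuous_at)
      moreover have "(\<lambda>n. y n - z) \<longlonglongrightarrow> x - z" by (intro tendsto_intros y)
      ultimately show "(\<lambda>n. newton_kernel \<epsilon> (y n - z)) \<longlonglongrightarrow> newton_kernel \<epsilon> (x - z)"
        by (rule isCont_tendsto_compose)
    qed
    show "AE z in lborel. norm (indicator K z * newton_kernel \<epsilon> (y n - z)) \<le> indicator K z * (1 / \<epsilon>)" for n
      using newton_kernel_abs by (intro AE_I2) (auto simp: indicator_def)
  qed measurable
qed

lemma newton_potential_mono:
  assumes "\<And>z. z \<in> K \<Longrightarrow> newton_kernel \<epsilon> (x - z) \<le> c"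
  shows "newton_potential \<epsilon> K x \<le> measure lborel K * c"
proof -
  have "newton_potential \<epsilon> K x \<le> (\<integral>z. indicator K z * c \<partial>lborel)"
    unfolding newton_potential_def using assms emeasure_K
    by (intro integral_mono integrable_newton_potential integrable_mult_left integrable_real_indicator)
      (auto simp: indicator_def)
  then show ?thesis by simp
qed

lemma newton_potential_ge:
  assumes "\<And>z. z \<in> K \<Longrightarrow> c \<le> newton_kernel \<epsilon> (x - z)"
  shows "measure lborel K * c \<le> newton_potential \<epsilon> K x"
proof -
  have "newton_potential \<epsilon> K x \<ge> (\<integral>z. indicator K z * c \<partial>lborel)"
    unfolding newton_potential_def using assms emeasure_K
    by (intro integral_mono integrable_newton_potential integrable_mult_left integrable_real_indicator)
      (auto simp: indicator_def)
  then show ?thesis by simp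
qed

text \<open>Splitting the integral at distance \<open>|K|\<^bsup>1/4\<^esup>\<close> from \<open>x\<close>.\<close>

lemma newton_potential_le:
  assumes m: "measure lborel K > 0"
  shows "newton_potential \<epsilon> K x \<le> (16 * unit_ball_vol 4 + 1) * sqrt (measure lborel K)"
proof -
  define \<tau> where "\<tau> = sqrt (sqrt (measure lborel K))"
  have \<tau>: "\<tau> > 0" "\<tau>\<^sup>2 = sqrt (measure lborel K)" using m by (auto simp: \<tau>_def)
  have \<tau>4: "measure lborel K = \<tau> ^ 4"
    using m \<tau>(2) by (simp add: power4_eq_xxxx power2_eq_square) (metis \<tau>(2) mult.assoc power2_eq_square real_sqrt_pow2 order_less_imp_le)
  have [measurable]: "cball (0::quat) \<tau> \<in> sets borel" by simp
  let ?B = "\<lambda>h. indicator (cball 0 \<tau>) h * newton_kernel \<epsilon> h"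
  have iB: "integrable lborel ?B"
    by (rule integrable_bounded_support[where S = "cball 0 \<tau>" and B = "1 / \<epsilon>"])
      (use emeasure_lborel_cball_finite newton_kernel_abs in auto)
  have iB': "integrable lborel (\<lambda>z. ?B (z + - x))"
    using iB by (subst integral_lborel_translate) auto
  \<comment> \<open>A recentring instead of polar coordinates: \<open>cball 0 \<tau>\<close> lies in
    \<open>cball y (2 * \<tau>)\<close>, whose centre is at distance \<tau> from the pole. The mean
    value inequality bounds the integral by the volume, proportional to
    \<open>(2 * \<tau>) ^ 4\<close>, times \<open>1 / \<tau>^2\<close>; hence the factor 16.\<close>
  obtain y :: quat where y: "norm y = \<tau>" using vector_choose_size[of \<tau>] \<tau> by auto
  have "ennreal (\<integral>h. ?B h \<partial>lborel) = (\<integral>\<^sup>+h. ennreal (?B h) \<partial>lborel)"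
    using newton_kernel_bounds(1)[OF \<epsilon>] by (intro nn_integral_eq_integral[symmetric] iB) (auto simp: less_imp_le)
  also have "\<dots> \<le> (\<integral>\<^sup>+h\<in>cball y (2 * \<tau>). ennreal (newton_kernel \<epsilon> h) \<partial>lborel)"
  proof (rule nn_integral_mono)
    fix h :: quat
    have "h \<in> cball y (2 * \<tau>)" if "h \<in> cball 0 \<tau>"
      using that y norm_triangle_ineq4[of y h] by (simp add: dist_norm)
    then show "ennreal (?B h) \<le> ennreal (newton_kernel \<epsilon> h) * indicator (cball y (2 * \<tau>)) h"
      by (auto simp: indicator_def)
  qed
  also have "\<dots> \<le> emeasure lborel (cball y (2 * \<tau>)) * ennreal (newton_kernel \<epsilon> y)"
    using \<tau> by (intro newton_kernel_mean \<epsilon>) simp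
  also have "\<dots> \<le> ennreal (unit_ball_vol 4 * (2 * \<tau>) ^ 4) * ennreal (1 / \<tau>\<^sup>2)"
    using \<tau> y newton_kernel_bounds(3)[OF \<epsilon>, of \<tau> y]
    by (intro mult_mono ennreal_leI) (auto simp: emeasure_cball)
  also have "\<dots> = ennreal (16 * unit_ball_vol 4 * \<tau>\<^sup>2)"
    using \<tau>(1) by (subst ennreal_mult[symmetric]) (auto simp: power2_eq_square power4_eq_xxxx)
  finally have B: "(\<integral>h. ?B h \<partial>lborel) \<le> 16 * unit_ball_vol 4 * \<tau>\<^sup>2" by (subst (asm) ennreal_le_iff) auto
  have sym: "newton_kernel \<epsilon> (x - z) = newton_kernel \<epsilon> (z + - x)" for z
    by (simp add: newton_kernel_def algebra_simps inner_diff_left inner_diff_right)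
  have "newton_potential \<epsilon> K x \<le> (\<integral>z. ?B (z + - x) + indicator K z * (1 / \<tau>\<^sup>2) \<partial>lborel)"
    unfolding newton_potential_def
  proof (rule integral_mono)
    show "integrable lborel (\<lambda>z. ?B (z + - x) + indicator K z * (1 / \<tau>\<^sup>2))"
      using iB' emeasure_K by (intro Bochner_Integration.integrable_add integrable_mult_left integrable_real_indicator) auto
    fix z
    show "indicator K z * newton_kernel \<epsilon> (x - z) \<le> ?B (z + - x) + indicator K z * (1 / \<tau>\<^sup>2)"
    proof (cases "z + - x \<in> cball 0 \<tau>")
      case True
      then show ?thesis unfolding sym using newton_kernel_bounds(1)[OF \<epsilon>, of "z + - x"] by (simp add: indicator_def)
    next
      case False
      then have "\<tau> \<le> norm (z + - x)" by simp
      then show ?thesis unfolding sym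
        using newton_kernel_bounds(3)[OF \<epsilon> \<tau>(1), of "z + - x"] False by (simp add: indicator_def)
    qed
  qed (rule integrable_newton_potential)
  also have "\<dots> = (\<integral>z. ?B (z + - x) \<partial>lborel) + measure lborel K * (1 / \<tau>\<^sup>2)"
    using iB' emeasure_K by (subst Bochner_Integration.integral_add) (auto intro!: integrable_mult_left integrable_real_indicator)
  also have "(\<integral>z. ?B (z + - x) \<partial>lborel) = (\<integral>h. ?B h \<partial>lborel)" by (rule integral_lborel_translate) measurable
  also have "measure lborel K * (1 / \<tau>\<^sup>2) = \<tau>\<^sup>2" using \<tau>(1) by (simp add: \<tau>4 power2_eq_square power4_eq_xxxx)
  finally show ?thesis using B by (simp add: \<tau>(2) algebra_simps)
qed

text \<open>The kernel estimate integrated over \<open>z \<in> K\<close> by Fubini; the common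
  distance \<delta> from \<open>K\<close> keeps its error uniform in \<open>z\<close>.\<close>

lemma newton_potential_local_mean:
  assumes \<delta>: "\<delta> > 0" "\<And>z. z \<in> K \<Longrightarrow> \<delta> \<le> dist x z" and \<rho>: "0 < \<rho>" "\<rho>\<^sup>2 \<le> \<epsilon>"
  shows "measure lborel (cball (0::quat) \<rho>) * newton_potential \<epsilon> K x -
      measure lborel K * (2 * \<epsilon> / \<delta> ^ 6) * (\<integral>h. indicator (cball 0 \<rho>) h * (norm (h::quat))\<^sup>2 \<partial>lborel) \<le>
    (\<integral>h. indicator (cball 0 \<rho>) h * newton_potential \<epsilon> K (x + h) \<partial>lborel)"
proof -
  have [measurable]: "cball (0::quat) \<rho> \<in> sets borel" by simp
  let ?I = "indicator (cball 0 \<rho>) :: quat \<Rightarrow> real" and ?c = "2 * \<epsilon> / \<delta> ^ 6"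
  let ?m = "measure lborel (cball (0::quat) \<rho>)" and ?m2 = "\<integral>h. ?I h * (norm h)\<^sup>2 \<partial>lborel"
  have fin: "emeasure lborel (cball (0::quat) \<rho>) < \<infinity>" by (rule emeasure_lborel_cball_finite)
  have int: "integrable (lborel \<Otimes>\<^sub>M lborel) (\<lambda>(h, z). ?I h * (indicator K z * newton_kernel \<epsilon> (x + h - z)))"
    by (rule integrable_bounded_support[where S = "cball 0 \<rho> \<times> K" and B = "1 / \<epsilon>"])
      (use fin emeasure_K(1) newton_kernel_abs in
        \<open>auto simp: lborel.emeasure_pair_measure_Times ennreal_mult_less_top indicator_def\<close>)
  have i2: "integrable lborel (\<lambda>h. ?I h * (norm h)\<^sup>2)"
    by (rule integrable_bounded_support[where S = "cball 0 \<rho>" and B = "\<rho>\<^sup>2"])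
      (use fin \<rho> in \<open>auto intro: power_mono\<close>)
  have "(\<integral>h. ?I h * newton_potential \<epsilon> K (x + h) \<partial>lborel) =
    (\<integral>h. (\<integral>z. ?I h * (indicator K z * newton_kernel \<epsilon> (x + h - z)) \<partial>lborel) \<partial>lborel)"
    by (simp add: newton_potential_def)
  also have "\<dots> = (\<integral>z. (\<integral>h. ?I h * (indicator K z * newton_kernel \<epsilon> (x + h - z)) \<partial>lborel) \<partial>lborel)"
    using lborel_pair.Fubini_integral[OF int] by simp
  also have "\<dots> \<ge> (\<integral>z. indicator K z * (?m * newton_kernel \<epsilon> (x - z) - ?c * ?m2) \<partial>lborel)"
  proof (rule integral_mono)
    show "integrable lborel (\<lambda>z. \<integral>h. ?I h * (indicator K z * newton_kernel \<epsilon> (x + h - z)) \<partial>lborel)"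
      using lborel_pair.integrable_snd[OF int] by simp
    have "integrable lborel (\<lambda>z. ?m * (indicator K z * newton_kernel \<epsilon> (x - z)) - indicator K z * (?c * ?m2))"
      using emeasure_K integrable_newton_potential[of x]
      by (intro Bochner_Integration.integrable_diff integrable_mult_right integrable_mult_left integrable_real_indicator) auto
    then show "integrable lborel (\<lambda>z. indicator K z * (?m * newton_kernel \<epsilon> (x - z) - ?c * ?m2))"
      by (simp add: algebra_simps)
    fix z
    show "indicator K z * (?m * newton_kernel \<epsilon> (x - z) - ?c * ?m2) \<le>
      (\<integral>h. ?I h * (indicator K z * newton_kernel \<epsilon> (x + h - z)) \<partial>lborel)"
    proof (cases "z \<in> K")
      case True
      have "(\<integral>h. ?I h * (newton_kernel \<epsilon> (x - z) - ?c * (norm h)\<^sup>2) \<partial>lborel) =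
        (\<integral>h. ?I h * newton_kernel \<epsilon> (x - z) - ?c * (?I h * (norm h)\<^sup>2) \<partial>lborel)"
        by (simp add: right_diff_distrib mult.left_commute)
      also have "\<dots> = ?m * newton_kernel \<epsilon> (x - z) - ?c * ?m2"
        using fin i2 by (subst Bochner_Integration.integral_diff)
          (auto intro!: integrable_mult_right integrable_mult_left integrable_real_indicator)
      finally have "?m * newton_kernel \<epsilon> (x - z) - ?c * ?m2 \<le> (\<integral>h. ?I h * newton_kernel \<epsilon> (x - z + h) \<partial>lborel)"
        using newton_kernel_local_mean[OF \<epsilon> \<delta>(1) _ \<rho>, of "x - z"] \<delta>(2)[OF True]
        by (simp add: dist_norm)
      then show ?thesis using True by (simp add: diff_add_eq)
    qed simp
  qed
  also have "(\<integral>z. indicator K z * (?m * newton_kernel \<epsilon> (x - z) - ?c * ?m2) \<partial>lborel) =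
    (\<integral>z. ?m * (indicator K z * newton_kernel \<epsilon> (x - z)) - indicator K z * (?c * ?m2) \<partial>lborel)"
    by (simp add: right_diff_distrib mult.left_commute)
  also have "\<dots> = ?m * newton_potential \<epsilon> K x - measure lborel K * ?c * ?m2"
    using emeasure_K integrable_newton_potential[of x] unfolding newton_potential_def
    by (subst Bochner_Integration.integral_diff)
      (auto intro!: integrable_mult_right integrable_mult_left integrable_real_indicator)
  finally show ?thesis .
qed

end


text \<open>
  Where a superharmonic \<open>w \<ge> 0\<close> exceeds \<open>t\<close> on a compact set \<open>K\<close>, the minimum principle compares
  it with \<open>t\<close> times the normalised potential \<open>\<psi>\<close> of \<open>K\<close>. The smoothing \<open>\<epsilon>\<close> and the quadratic
  term make \<open>\<psi>\<close> strictly subharmonic at every point where a negative minimum of \<open>w - s \<psi>\<close> can be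
  attained.
\<close>

lemma weak_type_compact:
  fixes w :: "quat \<Rightarrow> ennreal"
  assumes "open L" "cball 0 3 \<subseteq> L"
    and lsc: "\<And>c. open {x\<in>L. c < w x}"
    and sm: "\<And>x r. r > 0 \<Longrightarrow> cball x r \<subseteq> cball 0 3 \<Longrightarrow>
      (\<integral>\<^sup>+y\<in>cball x r. w y \<partial>lborel) \<le> emeasure lborel (cball x r) * w x"
    and K: "compact K" "K \<subseteq> cball 0 1" "\<And>x. x \<in> K \<Longrightarrow> ennreal t < w x" and t: "t > 0"
    and b: "w 0 \<le> ennreal b" "b \<ge> 0"
  shows "t * sqrt (measure lborel K) \<le> 2 * (16 * unit_ball_vol 4 + 1) * b"
proof (cases "measure lborel K = 0")
  case True
  then show ?thesis using b by simp
next
  case False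
  define m where "m = measure lborel K"
  define C where "C = 16 * unit_ball_vol 4 + (1::real)"
  have m: "m > 0" using False by (simp add: m_def zero_less_measure_iff)
  have C: "C > 0" by (simp add: C_def add_pos_pos)
  \<comment> \<open>By lower semicontinuity \<open>V\<close> is an open neighbourhood of
    \<open>K\<close>, so every point of the ball with \<open>w \<le> t\<close> keeps distance
    \<delta> from \<open>K\<close>, where the smoothed kernel is almost harmonic.\<close>
  define V where "V = {x\<in>L. ennreal t < w x}"
  have "open V" unfolding V_def by (rule lsc)
  moreover have "K \<subseteq> V" using K(2,3) assms(2) by (force simp: V_def subset_iff)
  ultimately obtain \<delta> where \<delta>: "\<delta> > 0" "\<And>x z. z \<in> K \<Longrightarrow> x \<notin> V \<Longrightarrow> \<delta> \<le> dist z x"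
  proof -
    assume "open V" "K \<subseteq> V"
    then have "closed (- V)" "K \<inter> - V = {}" by auto
    from separate_compact_closed[OF K(1) this] show thesis using that by blast
  qed
  \<comment> \<open>Small enough for \<open>\<psi> 0 \<ge> m / 2\<close>: there the potential is at
    least \<open>10 m / 11\<close>, from which \<open>m / 4\<close> and \<open>9 \<eta>\<close> are
    subtracted.\<close>
  define \<eta> where "\<eta> = m / 100"
  \<comment> \<open>The bound 1/10 makes the kernel at least 10/11 on the unit ball. The other bound
    keeps the error of the local mean of the potential below half of what the quadratic term
    gains.\<close>
  define \<epsilon> where "\<epsilon> = min (1/10) (\<eta> * \<delta> ^ 6 / (4 * m))"
  have \<eta>: "\<eta> > 0" using m by (simp add: \<eta>_def)
  have \<epsilon>: "\<epsilon> > 0" "\<epsilon> \<le> 1/10" using \<eta> \<delta> m by (auto simp: \<epsilon>_def)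
  have "\<epsilon> \<le> \<eta> * \<delta> ^ 6 / (4 * m)" by (simp add: \<epsilon>_def)
  then have c\<eta>: "m * (2 * \<epsilon> / \<delta> ^ 6) \<le> \<eta> / 2" using m \<delta> by (simp add: field_simps)
  let ?\<phi> = "newton_potential \<epsilon> K"
  \<comment> \<open>On the sphere of radius 3 the potential is at most \<open>m / 4\<close>, since
    \<open>K\<close> is at distance at least 2 from it, and the quadratic term vanishes. Hence
    \<open>\<psi> \<le> 0\<close> there, and a positive value of \<psi> forces an interior
    point.\<close>
  define \<psi> where "\<psi> x = ?\<phi> x - m / 4 + \<eta> * ((norm x)\<^sup>2 - 9)" for x
  have c\<phi>: "continuous_on UNIV ?\<phi>" by (rule continuous_newton_potential[OF \<epsilon>(1) K(1)])
  then have c\<psi>: "continuous_on UNIV \<psi>" unfolding \<psi>_def by (intro continuous_intros)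
  have [measurable]: "?\<phi> \<in> borel_measurable borel" "\<psi> \<in> borel_measurable borel"
    using c\<phi> c\<psi> by (auto intro: borel_measurable_continuous_onI)
  have \<psi>le: "\<psi> x \<le> C * sqrt m" if "x \<in> cball 0 3" for x
  proof -
    have "(norm x)\<^sup>2 \<le> 3\<^sup>2" using that by (intro power_mono) auto
    then have "\<eta> * ((norm x)\<^sup>2 - 9) \<le> 0" using \<eta> by (intro mult_nonneg_nonpos) auto
    then show ?thesis
      using newton_potential_le[OF \<epsilon>(1) K(1), of x] m by (simp add: \<psi>_def C_def m_def)
  qed
  have \<psi>bd: "\<psi> x \<le> 0" if "norm x = 3" for x
  proof -
    have "?\<phi> x \<le> measure lborel K * (1 / 2\<^sup>2)"
    proof (rule newton_potential_mono[OF \<epsilon>(1) K(1)], rule newton_kernel_bounds(3)[OF \<epsilon>(1)])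
      fix z assume "z \<in> K"
      then have "norm z \<le> 1" using K by auto
      then show "2 \<le> norm (x - z)" using that norm_triangle_ineq2[of x z] by simp
    qed simp
    then show ?thesis using that by (simp add: \<psi>_def m_def)
  qed
  have \<psi>0: "m / 2 \<le> \<psi> 0"
  proof -
    have "measure lborel K * (10 / 11) \<le> ?\<phi> 0"
    proof (rule newton_potential_ge[OF \<epsilon>(1) K(1)])
      fix z assume "z \<in> K"
      then have "norm z \<le> 1" using K by auto
      then have "z \<bullet> z + \<epsilon> \<le> 11/10" using \<epsilon> power_le_one[of "norm z" 2] by (simp add: power2_norm_eq_inner)
      moreover have "0 < z \<bullet> z + \<epsilon>" using \<epsilon> by (simp add: add_nonneg_pos)
      ultimately show "10 / 11 \<le> newton_kernel \<epsilon> (0 - z)"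
        by (simp add: newton_kernel_def field_simps)
    qed
    then show ?thesis using m by (simp add: \<psi>_def m_def[symmetric] \<eta>_def)
  qed
  \<comment> \<open>Scaled by the bound on the potential, so that \<open>s * \<psi>\<close> never
    exceeds \<open>t\<close> on the ball.\<close>
  define s where "s = t / (C * sqrt m)"
  have s: "s > 0" using t C m by (simp add: s_def)
  have s\<psi>: "s * \<psi> x \<le> t" if "x \<in> cball 0 3" for x
    using mult_left_mono[OF \<psi>le[OF that], of s] s C m by (simp add: s_def)
  have claim: "ennreal (s * \<psi> x) \<le> w x" if x: "x \<in> cball 0 3" for x
  proof (rule ccontr)
    assume neg: "\<not> ennreal (s * \<psi> x) \<le> w x"
    \<comment> \<open>The set where the claim fails. On it \<open>w\<close> is finite, so the excess
      \<open>F\<close> of \<open>s \<psi>\<close> over \<open>w\<close> is an honest real number in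
      the interval from 0 to \<open>t\<close>.\<close>
    define T where "T = {x\<in>cball 0 3. w x < ennreal (s * \<psi> x)}"
    define F where "F x = s * \<psi> x - enn2real (w x)" for x
    have "x \<in> T" using x neg by (simp add: T_def)
    have TF: "w y = ennreal (s * \<psi> y - F y)" "0 \<le> s * \<psi> y - F y" "0 < F y" "F y \<le> t" if "y \<in> T" for y
    proof -
      have wy: "w y < ennreal (s * \<psi> y)" using that by (simp add: T_def)
      then obtain a where a: "w y = ennreal a" "a \<ge> 0" by (cases "w y") auto
      then show "w y = ennreal (s * \<psi> y - F y)" "0 \<le> s * \<psi> y - F y" "0 < F y"
        using wy by (auto simp: F_def ennreal_less_iff)
      show "F y \<le> t" using s\<psi>[of y] that by (simp add: T_def F_def a) (use a in linarith)
    qed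
    define S where "S = Sup (F ` T)"
    have bdd: "bdd_above (F ` T)" using TF(4) by (auto simp: bdd_above_def)
    have S: "F y \<le> S" if "y \<in> T" for y unfolding S_def using that bdd by (intro cSUP_upper)
    have S0: "S > 0" using S[OF \<open>x \<in> T\<close>] TF(3)[OF \<open>x \<in> T\<close>] by simp
    have "\<exists>y\<in>T. S - inverse (real (Suc n)) < F y" for n
      unfolding S_def using less_cSUP_iff[of T F] \<open>x \<in> T\<close> bdd
      by (metis diff_less_eq empty_iff inverse_positive_iff_positive less_add_same_cancel1 of_nat_0_less_iff zero_less_Suc)
    then obtain y where y: "\<And>n. y n \<in> T" "\<And>n. S - inverse (real (Suc n)) < F (y n)" by metis
    have Fy: "(\<lambda>n. F (y n)) \<longlonglongrightarrow> S"
    proof (rule tendsto_sandwich[OF _ _ _ tendsto_const])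
      show "(\<lambda>n. S - inverse (real (Suc n))) \<longlonglongrightarrow> S"
        using tendsto_diff[OF tendsto_const[of S] LIMSEQ_inverse_real_of_nat] by simp
    qed (use y S in \<open>auto intro!: always_eventually less_imp_le\<close>)
    obtain x0 r where r: "x0 \<in> cball 0 3" "strict_mono r" "(y \<circ> r) \<longlonglongrightarrow> x0"
      using compact_cball[of "0::quat" 3] y(1) unfolding compact_def T_def by blast
    have lim: "(\<lambda>n. s * \<psi> (y (r n)) - F (y (r n))) \<longlonglongrightarrow> s * \<psi> x0 - S"
    proof (intro tendsto_intros)
      have "isCont \<psi> x0" using c\<psi> by (simp add: continuous_on_eq_continuous_at)
      from isCont_tendsto_compose[OF this r(3)] show "(\<lambda>n. \<psi> (y (r n))) \<longlonglongrightarrow> \<psi> x0" by (simp add: o_def)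
      show "(\<lambda>n. F (y (r n))) \<longlonglongrightarrow> S" using LIMSEQ_subseq_LIMSEQ[OF Fy r(2)] by (simp add: o_def)
    qed
    have a0: "0 \<le> s * \<psi> x0 - S"
      by (rule LIMSEQ_le_const[OF lim]) (use TF(2)[OF y(1)] in blast)
    \<comment> \<open>Lower semicontinuity of \<open>w\<close> makes the limit of a maximising
      sequence of the excess a maximiser.\<close>
    have wx0: "w x0 \<le> ennreal (s * \<psi> x0 - S)"
    proof (rule ccontr)
      assume "\<not> ?thesis"
      then obtain c where c: "ennreal (s * \<psi> x0 - S) < c" "c < w x0" using dense by (auto simp: not_le)
      have "x0 \<in> {x\<in>L. c < w x}" using c r assms(2) by auto
      then have "\<forall>\<^sub>F n in sequentially. (y \<circ> r) n \<in> {x\<in>L. c < w x}"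
        using r(3) lsc topological_tendstoD by blast
      moreover have "(\<lambda>n. w (y (r n))) \<longlonglongrightarrow> ennreal (s * \<psi> x0 - S)"
        using tendsto_ennrealI[OF lim] TF(1)[OF y(1)] by simp
      then have "\<forall>\<^sub>F n in sequentially. w (y (r n)) < c" using c(1) by (intro order_tendstoD)
      ultimately have "\<forall>\<^sub>F n in sequentially. False" by eventually_elim auto
      then show False by simp
    qed
    have pos: "0 < s * \<psi> x0" using a0 S0 by simp
    have x0T: "x0 \<in> T"
      unfolding T_def using r(1) wx0 S0 pos by (auto simp: ennreal_lessI intro!: le_less_trans[OF wx0])
    have "norm x0 \<noteq> 3" using pos \<psi>bd[of x0] s by (auto simp: zero_less_mult_iff)
    then have n0: "norm x0 < 3" using r(1) by simp
    \<comment> \<open>Together with \<open>wx0\<close>, the function \<open>s \<psi> - S\<close>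
      lies below \<open>w\<close> on the whole ball and touches it at \<open>x0\<close>.\<close>
    have lower: "ennreal (s * \<psi> y - S) \<le> w y" if "y \<in> cball 0 3" for y
    proof (cases "y \<in> T")
      case True
      then show ?thesis using TF(1)[OF True] S[OF True] by (simp add: ennreal_leI)
    next
      case False
      then have "ennreal (s * \<psi> y) \<le> w y" using that by (auto simp: T_def)
      moreover have "ennreal (s * \<psi> y - S) \<le> ennreal (s * \<psi> y)" using S0 by (intro ennreal_leI) simp
      ultimately show ?thesis by simp
    qed
    \<comment> \<open>The touching value \<open>s \<psi> - S\<close> is smaller than
      \<open>t\<close>, whereas \<open>w\<close> exceeds \<open>t\<close> on \<open>V\<close>. So
      the local mean estimate of the potential is available at \<open>x0\<close>.\<close>
    have "x0 \<notin> V"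
    proof
      assume "x0 \<in> V"
      then have "ennreal t < ennreal (s * \<psi> x0 - S)" using wx0 by (auto simp: V_def intro: less_le_trans)
      then show False using s\<psi>[OF r(1)] S0 t by (simp add: ennreal_less_iff)
    qed
    then have dz: "\<delta> \<le> dist x0 z" if "z \<in> K" for z using \<delta>(2)[OF that] by (simp add: dist_commute)
    \<comment> \<open>The first bound is required by the local mean estimate, the second keeps the
      ball around \<open>x0\<close> inside \<open>cball 0 3\<close>.\<close>
    define \<rho> where "\<rho> = min (sqrt \<epsilon>) (3 - norm x0)"
    have \<rho>: "\<rho> > 0" "\<rho> \<le> 3 - norm x0" using \<epsilon> n0 by (auto simp: \<rho>_def)
    have "\<rho>\<^sup>2 \<le> (sqrt \<epsilon>)\<^sup>2" using \<rho> by (intro power_mono) (auto simp: \<rho>_def)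
    then have \<rho>2: "\<rho>\<^sup>2 \<le> \<epsilon>" using \<epsilon> by simp
    have [measurable]: "cball (0::quat) \<rho> \<in> sets borel" "cball x0 \<rho> \<in> sets borel" by simp_all
    let ?I = "indicator (cball 0 \<rho>) :: quat \<Rightarrow> real"
    let ?M = "measure lborel (cball (0::quat) \<rho>)" and ?m2 = "\<integral>h. ?I h * (norm h)\<^sup>2 \<partial>lborel"
    have fin: "emeasure lborel (cball (0::quat) \<rho>) < \<infinity>" by (rule emeasure_lborel_cball_finite)
    have bI: "integrable lborel (\<lambda>h. ?I h * f h)" if "continuous_on UNIV f" for f :: "quat \<Rightarrow> real"
    proof -
      have "compact (f ` cball 0 \<rho>)"
        using that by (intro compact_continuous_image) (auto intro: continuous_on_subset)
      then obtain B where "\<And>h. h \<in> cball 0 \<rho> \<Longrightarrow> norm (f h) \<le> B"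
        using compact_imp_bounded by (metis bounded_iff image_eqI)
      then show ?thesis
        using fin borel_measurable_continuous_onI[OF that]
        by (intro integrable_bounded_support[where S = "cball 0 \<rho>" and B = B]) auto
    qed
    have iI: "integrable lborel ?I" using bI[of "\<lambda>_. 1"] by simp
    have c2: "continuous_on UNIV (\<lambda>h::quat. (norm h)\<^sup>2)" by (intro continuous_intros)
    have m2: "?m2 > 0"
    proof -
      have "?m2 \<noteq> 0"
      proof
        assume "?m2 = 0"
        then have "AE h in lborel. ?I h * (norm h)\<^sup>2 = 0"
          using integral_nonneg_eq_0_iff_AE[OF bI[OF c2]] by simp
        then have "AE h::quat in lborel. h \<notin> cball 0 \<rho>"
          using AE_lborel_singleton[of "0::quat"] by eventually_elim (auto simp: indicator_def)
        then have "emeasure lborel (cball (0::quat) \<rho>) = 0"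
          using AE_iff_null_sets[of "cball (0::quat) \<rho>" lborel] null_setsD1 by auto
        then show False using emeasure_lborel_cball_pos[OF \<rho>(1), of "0::quat"] by simp
      qed
      moreover have "?m2 \<ge> 0" by (intro Bochner_Integration.integral_nonneg) auto
      ultimately show ?thesis by linarith
    qed
    have I1: "?M * ?\<phi> x0 - m * (2 * \<epsilon> / \<delta> ^ 6) * ?m2 \<le> (\<integral>h. ?I h * ?\<phi> (x0 + h) \<partial>lborel)"
      unfolding m_def by (rule newton_potential_local_mean[OF \<epsilon>(1) K(1) \<delta>(1) dz \<rho>(1) \<rho>2])
    \<comment> \<open>The linear term of \<open>|x0 + h|^2\<close> averages to 0 under the
      reflection of \<open>h\<close>.\<close>
    have odd: "(\<integral>h. ?I h * (x0 \<bullet> h) \<partial>lborel) = 0"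
      using integral_cball_isometry[of "\<lambda>h. x0 \<bullet> h" uminus \<rho>] by (simp add: linear_uminus)
    have cin: "continuous_on UNIV (\<lambda>h. x0 \<bullet> h)" by (intro continuous_intros)
    have "(\<integral>h. ?I h * (norm (x0 + h))\<^sup>2 \<partial>lborel) =
      (\<integral>h. ?I h * (norm x0)\<^sup>2 + (2 * (?I h * (x0 \<bullet> h)) + ?I h * (norm h)\<^sup>2) \<partial>lborel)"
      by (intro Bochner_Integration.integral_cong)
        (auto simp: power2_norm_eq_inner inner_add_left inner_add_right inner_commute algebra_simps)
    also have "\<dots> = ?M * (norm x0)\<^sup>2 + ?m2"
      using iI bI[OF cin] bI[OF c2] odd by simp
    finally have I2: "(\<integral>h. ?I h * (norm (x0 + h))\<^sup>2 \<partial>lborel) = ?M * (norm x0)\<^sup>2 + ?m2" .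
    have cs\<phi>: "continuous_on UNIV (\<lambda>h. ?\<phi> (x0 + h))"
      by (rule continuous_on_compose2[OF c\<phi>]) (auto intro!: continuous_intros)
    have cs2: "continuous_on UNIV (\<lambda>h. (norm (x0 + h))\<^sup>2)" by (intro continuous_intros)
    have cs\<psi>: "continuous_on UNIV (\<lambda>h. s * \<psi> (x0 + h) - S)"
      by (intro continuous_intros continuous_on_compose2[OF c\<psi>]) auto
    have "(\<integral>h. ?I h * (s * \<psi> (x0 + h) - S) \<partial>lborel) =
      (\<integral>h. s * (?I h * ?\<phi> (x0 + h)) + (s * \<eta> * (?I h * (norm (x0 + h))\<^sup>2) - ?I h * (s * (m / 4 + 9 * \<eta>) + S)) \<partial>lborel)"
      by (intro Bochner_Integration.integral_cong) (auto simp: \<psi>_def algebra_simps)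
    also have "\<dots> = s * (\<integral>h. ?I h * ?\<phi> (x0 + h) \<partial>lborel) + (s * \<eta> * (?M * (norm x0)\<^sup>2 + ?m2) - ?M * (s * (m / 4 + 9 * \<eta>) + S))"
      using iI bI[OF cs\<phi>] bI[OF cs2] I2 by simp
    \<comment> \<open>The quadratic term gains \<open>s * \<eta> * ?m2\<close>, of which the loss of
      the potential consumes at most half. The strict excess that remains contradicts the mean value
      inequality of \<open>w\<close> at the touching point.\<close>
    also have "\<dots> \<ge> s * (?M * ?\<phi> x0 - \<eta> / 2 * ?m2) + (s * \<eta> * (?M * (norm x0)\<^sup>2 + ?m2) - ?M * (s * (m / 4 + 9 * \<eta>) + S))"
      using I1 mult_right_mono[OF c\<eta>, of ?m2] m2 s by (intro add_right_mono mult_left_mono) auto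
    also have "s * (?M * ?\<phi> x0 - \<eta> / 2 * ?m2) + (s * \<eta> * (?M * (norm x0)\<^sup>2 + ?m2) - ?M * (s * (m / 4 + 9 * \<eta>) + S)) =
      ?M * (s * \<psi> x0 - S) + s * \<eta> / 2 * ?m2"
      by (simp add: \<psi>_def algebra_simps)
    finally have strict: "?M * (s * \<psi> x0 - S) < (\<integral>h. ?I h * (s * \<psi> (x0 + h) - S) \<partial>lborel)"
      using s \<eta> m2 by (smt (verit) divide_pos_pos mult_pos_pos)
    have sub: "cball x0 \<rho> \<subseteq> cball 0 3"
    proof
      fix z assume "z \<in> cball x0 \<rho>"
      then show "z \<in> cball 0 3" using norm_triangle_ineq2[of z x0] \<rho>(2) by (simp add: dist_norm norm_minus_commute)
    qed
    have "ennreal (\<integral>h. ?I h * (s * \<psi> (x0 + h) - S) \<partial>lborel) \<le> (\<integral>\<^sup>+h. ennreal (?I h * (s * \<psi> (x0 + h) - S)) \<partial>lborel)"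
      by (rule integral_le_nn_integral[OF bI[OF cs\<psi>]]) 
    also have "\<dots> = (\<integral>\<^sup>+h. ennreal (?I (h - x0) * (s * \<psi> (x0 + (h - x0)) - S)) \<partial>lborel)"
      using nn_integral_lborel_translate[of "\<lambda>y. ennreal (?I (y - x0) * (s * \<psi> (x0 + (y - x0)) - S))" x0]
      by (simp add: add.commute)
    also have "\<dots> \<le> (\<integral>\<^sup>+y\<in>cball x0 \<rho>. w y \<partial>lborel)"
    proof (rule nn_integral_mono)
      fix y
      show "ennreal (?I (y - x0) * (s * \<psi> (x0 + (y - x0)) - S)) \<le> w y * indicator (cball x0 \<rho>) y"
        using lower[of y] sub by (cases "y \<in> cball x0 \<rho>") (auto simp: dist_norm norm_minus_commute)
    qed
    also have "\<dots> \<le> emeasure lborel (cball x0 \<rho>) * w x0" by (rule sm[OF \<rho>(1) sub])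
    also have "\<dots> \<le> ennreal ?M * ennreal (s * \<psi> x0 - S)"
    proof (intro mult_mono wx0)
      show "emeasure lborel (cball x0 \<rho>) \<le> ennreal ?M"
        using \<rho> by (simp add: emeasure_cball content_cball)
    qed auto
    also have "\<dots> = ennreal (?M * (s * \<psi> x0 - S))" using a0 by (simp add: ennreal_mult)
    finally have "(\<integral>h. ?I h * (s * \<psi> (x0 + h) - S) \<partial>lborel) \<le> ?M * (s * \<psi> x0 - S)"
      using a0 by (subst (asm) ennreal_le_iff) auto
    then show False using strict by simp
  qed
  \<comment> \<open>At the centre, \<open>s * m / 2 \<le> s * \<psi> 0 \<le> w 0 \<le> b\<close>,
    and \<open>s * m\<close> equals \<open>t * sqrt m / C\<close>; this is the source of the factor
    2.\<close>
  have "ennreal (s * (m / 2)) \<le> ennreal (s * \<psi> 0)" using \<psi>0 s by (intro ennreal_leI mult_left_mono) auto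
  also have "\<dots> \<le> ennreal b" using claim[of 0] b(1) by (simp add: order_trans del: ennreal_le_iff)
  finally have "s * (m / 2) \<le> b" using b by (simp add: ennreal_le_iff)
  moreover have "s * m = t * sqrt m / C"
    using m C by (simp add: s_def field_simps)
  ultimately have "t * sqrt m / C \<le> 2 * b" by linarith
  then have "t * sqrt m \<le> 2 * C * b" using C by (simp add: pos_divide_le_eq mult_ac)
  then show ?thesis unfolding m_def C_def .
qed


text \<open>Inner regularity passes from compact subsets to the whole superlevel set. Compactness
  was required before for a continuous potential and for the positive distance \<delta>.\<close>

lemma weak_type_superharmonic:
  fixes w :: "quat \<Rightarrow> ennreal"
  assumes L: "open L" "cball 0 3 \<subseteq> L"
    and lsc: "\<And>c. open {x\<in>L. c < w x}"
    and sm: "\<And>x r. r > 0 \<Longrightarrow> cball x r \<subseteq> cball 0 3 \<Longrightarrow>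
      (\<integral>\<^sup>+y\<in>cball x r. w y \<partial>lborel) \<le> emeasure lborel (cball x r) * w x"
    and t: "t > 0" and b: "w 0 \<le> ennreal b" "b \<ge> 0"
  shows "emeasure lborel {x\<in>cball 0 1. ennreal t < w x} \<le>
    ennreal ((2 * (16 * unit_ball_vol 4 + 1))\<^sup>2 * (b / t)\<^sup>2)" (is "?E \<le> ennreal ?B")
proof (rule ennreal_le_epsilon)
  fix e :: real assume e: "0 < e"
  define S where "S = {x\<in>cball 0 1. ennreal t < w x}"
  have S: "S = cball 0 1 \<inter> {x\<in>L. ennreal t < w x}" using L subset_cball[of 1 3 "0::quat"] by (auto simp: S_def)
  have [measurable]: "S \<in> sets borel" unfolding S using lsc by (intro sets.Int) auto
  then have "S \<in> sets lebesgue" by simp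
  from sets_lebesgue_inner_closed[OF this e] obtain K where K: "closed K" "K \<subseteq> S"
    "S - K \<in> lmeasurable" "emeasure lebesgue (S - K) < ennreal e" by blast
  have [measurable]: "K \<in> sets borel" using K(1) by (rule borel_closed)
  have "K \<subseteq> cball 0 1" using K(2) by (auto simp: S_def)
  then have cK: "compact K"
    using K(1) bounded_subset[OF bounded_cball] by (simp add: compact_eq_bounded_closed)
  have "t * sqrt (measure lborel K) \<le> 2 * (16 * unit_ball_vol 4 + 1) * b"
    by (rule weak_type_compact[OF L lsc sm cK _ _ t b]) (use K(2) in \<open>auto simp: S_def\<close>)
  then have "sqrt (measure lborel K) \<le> 2 * (16 * unit_ball_vol 4 + 1) * (b / t)" using t by (simp add: field_simps)
  then have "(sqrt (measure lborel K))\<^sup>2 \<le> (2 * (16 * unit_ball_vol 4 + 1) * (b / t))\<^sup>2" by (intro power_mono) auto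
  then have "measure lborel K \<le> ?B" by (simp only: power_mult_distrib real_sqrt_pow2 measure_nonneg)
  moreover have "emeasure lborel K = ennreal (measure lborel K)"
    by (rule emeasure_K[OF zero_less_one cK])
  ultimately have KB: "emeasure lborel K \<le> ennreal ?B" by (simp add: ennreal_leI)
  have "?E = emeasure lborel S" by (simp add: S_def)
  also have "\<dots> \<le> emeasure lborel (K \<union> (S - K))" using K(2) by (intro emeasure_mono) auto
  also have "\<dots> \<le> emeasure lborel K + emeasure lborel (S - K)"
    by (rule emeasure_subadditive) auto
  also have "emeasure lborel (S - K) = emeasure lebesgue (S - K)" by simp
  also have "emeasure lborel K + \<dots> \<le> ennreal ?B + ennreal e" using KB K(4) by (intro add_mono) auto
  finally show "?E \<le> ennreal ?B + ennreal e" .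
qed

section \<open>Local integrability of plurisubharmonic functions\<close>

lemma QPSH_D:
  assumes "u \<in> QPSH \<Omega>"
  shows "\<And>x. x \<in> \<Omega> \<Longrightarrow> u x < \<infinity>" "usc_on \<Omega> u"
    "\<And>a b. b \<noteq> 0 \<Longrightarrow> subharmonic_on {q. a + qscale_right b q \<in> \<Omega>} (\<lambda>q. u (a + qscale_right b q))"
  using assms by (auto simp: QPSH_def)

lemma open_qline:
  assumes "open \<Omega>"
  shows "open {q. a + qscale_right b q \<in> \<Omega>}"
  using open_vimage[OF assms continuous_on_add[OF continuous_on_const[of UNIV a] continuous_qscale_right[of UNIV b]]]
  by (simp add: vimage_def)

text \<open>For \<open>b = 0\<close> the line degenerates to a point and equality holds. This case
  is included so that the line means of the limit function need no case distinction.\<close>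

lemma qpsh_line_mean:
  assumes u: "u \<in> QPSH \<Omega>" and r: "r > 0"
    and sub: "\<And>q. q \<in> cball p r \<Longrightarrow> a + qscale_right b q \<in> \<Omega>"
    and M: "\<And>q. q \<in> cball p r \<Longrightarrow> u (a + qscale_right b q) \<le> ereal M"
  shows "(\<integral>\<^sup>+q\<in>cball p r. e2ennreal (ereal M - u (a + qscale_right b q)) \<partial>lborel) \<le>
    emeasure lborel (cball p r) * e2ennreal (ereal M - u (a + qscale_right b p))"
proof (cases "b = 0")
  case True
  have "(\<integral>\<^sup>+q\<in>cball p r. e2ennreal (ereal M - u a) \<partial>lborel) = e2ennreal (ereal M - u a) * emeasure lborel (cball p r)"
    by (rule nn_integral_cmult_indicator) simp
  then show ?thesis using True by (simp add: mult.commute)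
next
  case False
  let ?L = "{q. a + qscale_right b q \<in> \<Omega>}" and ?v = "\<lambda>q. u (a + qscale_right b q)"
  have sh: "subharmonic_on ?L ?v" by (rule QPSH_D(3)[OF u]) fact
  then have L: "open ?L" "usc_on ?L ?v" by (auto simp: subharmonic_on_def)
  have p: "p \<in> cball p r" using r by simp
  have "?v p \<le> ereal_integral (uniform_measure lborel (cball p r)) ?v"
    using sh r sub unfolding subharmonic_on_def by blast
  moreover have m: "(\<lambda>x. if x \<in> cball p r then ?v x else 0) \<in> borel_measurable borel"
    using sub by (intro usc_on_borel_measurable_subset[OF L]) auto
  ultimately show ?thesis
    using emeasure_lborel_cball_pos[OF r, of p] emeasure_lborel_cball_finite[of p r] M M[OF p]
    by (subst (asm) le_ereal_integral_iff[OF _ _ _ m, of M]) auto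
qed

lemma less_e2ennreal_diff_iff:
  assumes "c \<ge> 0"
  shows "ennreal c < e2ennreal (ereal M - v) \<longleftrightarrow> v < ereal (M - c)"
proof (cases v)
  case (real r)
  then show ?thesis using assms by (auto simp: ennreal_less_iff)
qed (auto simp: e2ennreal_neg)

lemma usc_on_open_diff_superlevel:
  assumes "open U" "usc_on U u"
  shows "open {x\<in>U. c < e2ennreal (ereal M - u x)}"
proof (cases c)
  case (real r)
  then have "{x\<in>U. c < e2ennreal (ereal M - u x)} = {x\<in>U. u x < ereal (M - r)}"
    by (auto simp: less_e2ennreal_diff_iff)
  then show ?thesis using assms usc_on_open_iff by metis
qed simp

lemma borel_measurable_qscale_right [measurable]:
  "(\<lambda>x. qscale_right (fst x) (snd x)) \<in> borel_measurable (borel \<Otimes>\<^sub>M borel)"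
  unfolding borel_prod
  by (intro borel_measurable_continuous_onI continuous_on_qscale_right continuous_intros)

definition weak_const :: real where
  "weak_const = (2 * (16 * unit_ball_vol 4 + 1))\<^sup>2"

lemma weak_const_pos: "weak_const > 0"
  unfolding weak_const_def by (intro zero_less_power mult_pos_pos add_pos_pos) auto

text \<open>
  The weak-type bound on each line through \<open>a\<close> is integrated over the directions \<open>b\<close>. Exchanging
  the integrals and using that \<open>b \<mapsto> b \<lambda>\<close> is a similarity of ratio \<open>|\<lambda>|\<close> recovers Lebesgue measure.
\<close>

lemma qpsh_weak_type:
  fixes u :: "quat ^ 'n \<Rightarrow> ereal"
  assumes u: "u \<in> QPSH \<Omega>" and \<Omega>: "open \<Omega>" and R: "R > 0" "cball a (3 * R) \<subseteq> \<Omega>"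
    and M: "\<And>x. x \<in> cball a (3 * R) \<Longrightarrow> u x \<le> ereal M"
    and \<beta>: "ereal M - u a \<le> ereal \<beta>" "\<beta> \<ge> 0" and t: "t > 0"
  shows "ennreal (unit_ball_vol 4 / 256) * emeasure lborel {x\<in>cball a (R / 2). u x < ereal (M - t)} \<le>
    emeasure lborel (cball (0::quat ^ 'n) R) * ennreal (weak_const * (\<beta> / t)\<^sup>2)"
proof -
  define O' where "O' = {x\<in>\<Omega>. u x < ereal (M - t)}"
  define E where "E = {y\<in>cball 0 (R / 2). a + y \<in> O'}"
  have "open O'" using QPSH_D(2)[OF u] \<Omega> usc_on_open_iff unfolding O'_def by blast
  then have [measurable]: "O' \<in> sets borel" by simp
  have [measurable]: "cball (0::quat ^ 'n) s \<in> sets borel" "cball (x::quat) s \<in> sets borel" for s x by simp_all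
  have "E = cball 0 (R / 2) \<inter> (\<lambda>y. a + y) -` O'" by (auto simp: E_def)
  moreover have "(\<lambda>y. a + y) -` O' \<in> sets borel"
    using measurable_sets[of "\<lambda>y. a + y" borel borel O'] by simp
  ultimately have [measurable]: "E \<in> sets borel" by auto
  define g where "g = (\<lambda>(b, q). indicator (cball 0 R) b * (indicator (cball 0 1) q * indicator O' (a + qscale_right b q)) :: ennreal)"
  have [measurable]: "g \<in> borel_measurable (borel \<Otimes>\<^sub>M borel)"
  proof -
    have "g = (\<lambda>z. indicator (cball 0 R) (fst z) * (indicator (cball 0 1) (snd z) * indicator O' (a + qscale_right (fst z) (snd z))))"
      by (auto simp: g_def)
    then show ?thesis by simp
  qed
  have ineq1: "(\<integral>\<^sup>+q. g (b, q) \<partial>lborel) \<le> ennreal (weak_const * (\<beta> / t)\<^sup>2) * indicator (cball 0 R) b" if b: "b \<noteq> 0" for b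
  proof (cases "b \<in> cball 0 R")
    case True
    let ?L = "{q. a + qscale_right b q \<in> \<Omega>}" and ?w = "\<lambda>q. e2ennreal (ereal M - u (a + qscale_right b q))"
    \<comment> \<open>The one-line estimate works in the ball of radius 3 in the parameter
      \<open>q\<close>; with directions of norm at most \<open>R\<close> this explains the radius
      \<open>3 * R\<close>.\<close>
    have in3: "a + qscale_right b q \<in> cball a (3 * R)" if "q \<in> cball 0 3" for q
      using that True mult_mono[of "norm b" R "norm q" 3] R by (simp add: norm_qscale_right dist_norm mult.commute)
    have "subharmonic_on ?L (\<lambda>q. u (a + qscale_right b q))" by (rule QPSH_D(3)[OF u b])
    then have L: "open ?L" "usc_on ?L (\<lambda>q. u (a + qscale_right b q))" by (auto simp: subharmonic_on_def)
    have "emeasure lborel {q\<in>cball 0 1. ennreal t < ?w q} \<le> ennreal ((2 * (16 * unit_ball_vol 4 + 1))\<^sup>2 * (\<beta> / t)\<^sup>2)"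
    proof (rule weak_type_superharmonic[OF L(1)])
      show "cball 0 3 \<subseteq> ?L" using in3 R by blast
      show "open {q \<in> ?L. c < ?w q}" for c by (rule usc_on_open_diff_superlevel[OF L])
      show "(\<integral>\<^sup>+y\<in>cball x r. ?w y \<partial>lborel) \<le> emeasure lborel (cball x r) * ?w x"
        if "r > 0" "cball x r \<subseteq> cball 0 3" for x r
        using that in3 R M by (intro qpsh_line_mean[OF u]) blast+
      show "?w 0 \<le> ennreal \<beta>" using e2ennreal_mono[OF \<beta>(1)] \<beta>(2) by simp
    qed (use t \<beta> in auto)
    also have "{q\<in>cball 0 1. ennreal t < ?w q} = {q\<in>cball 0 1. a + qscale_right b q \<in> O'}"
      using t in3 R by (auto simp: less_e2ennreal_diff_iff O'_def subset_iff)
    finally have le: "emeasure lborel {q\<in>cball 0 1. a + qscale_right b q \<in> O'} \<le> ennreal (weak_const * (\<beta> / t)\<^sup>2)"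
      unfolding weak_const_def .
    have "(\<integral>\<^sup>+q. g (b, q) \<partial>lborel) = (\<integral>\<^sup>+q. indicator {q\<in>cball 0 1. a + qscale_right b q \<in> O'} q \<partial>lborel)"
      using True by (intro nn_integral_cong) (auto simp: g_def indicator_def)
    also have "\<dots> = emeasure lborel {q\<in>cball 0 1. a + qscale_right b q \<in> O'}"
    proof (rule nn_integral_indicator)
      have "{q\<in>cball 0 1. a + qscale_right b q \<in> O'} = cball 0 1 \<inter> {q. a + qscale_right b q \<in> O'}" by auto
      also have "\<dots> \<in> sets lborel" using open_qline[OF \<open>open O'\<close>] by (intro sets.Int) auto
      finally show "{q\<in>cball 0 1. a + qscale_right b q \<in> O'} \<in> sets lborel" .
    qed
    finally show ?thesis using le True by simp
  qed (simp add: g_def)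
  \<comment> \<open>The ball of radius 1/4 about \<open>y0\<close> lies in the shell
    \<open>1/2 \<le> |q| \<le> 1\<close> and has volume \<open>unit_ball_vol 4 / 256\<close>. For
    \<open>q\<close> in the shell the scaling factor of \<open>b \<mapsto> b q\<close> is at most 1,
    and \<open>|b q| \<le> R / 2\<close> implies \<open>|b| \<le> R\<close>.\<close>
  obtain y0 :: quat where y0: "norm y0 = 3/4" using vector_choose_size[of "3/4"] by auto
  have ineq2: "emeasure lborel E * indicator (cball y0 (1/4)) q \<le> (\<integral>\<^sup>+b. g (b, q) \<partial>lborel)" for q
  proof (cases "q \<in> cball y0 (1/4)")
    case True
    have q: "1/2 \<le> norm q" "norm q \<le> 1"
      using True y0 norm_triangle_ineq2[of y0 q] norm_triangle_ineq2[of q y0]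
      by (auto simp: dist_norm norm_minus_commute)
    let ?T = "\<lambda>b. qscale_right b q :: quat ^ 'n"
    have "emeasure lborel E = ennreal (norm q ^ DIM(quat ^ 'n)) * emeasure lborel (?T -` E)"
      by (rule emeasure_lborel_similarity[OF linear_qscale_left])
        (use q in \<open>auto simp: norm_qscale_right mult.commute\<close>)
    also have "\<dots> \<le> 1 * emeasure lborel (?T -` E)"
      using q by (intro mult_right_mono) (auto simp: power_le_one)
    also have "\<dots> = (\<integral>\<^sup>+b. indicator (?T -` E) b \<partial>lborel)"
    proof -
      have "?T \<in> borel_measurable borel"
        by (intro borel_measurable_continuous_onI linear_continuous_on)
          (simp add: linear_conv_bounded_linear[symmetric] linear_qscale_left)
      then have "?T -` E \<in> sets lborel"
        using measurable_sets[of ?T borel borel E] by simp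
      then show ?thesis by simp
    qed
    also have "\<dots> \<le> (\<integral>\<^sup>+b. g (b, q) \<partial>lborel)"
    proof (rule nn_integral_mono)
      fix b :: "quat ^ 'n"
      have "b \<in> cball 0 R" if "?T b \<in> E"
      proof -
        have "norm b * norm q \<le> R / 2" using that by (auto simp: E_def norm_qscale_right)
        moreover have "norm b * (1/2) \<le> norm b * norm q" using q by (intro mult_left_mono) auto
        ultimately show ?thesis by simp
      qed
      then show "indicator (?T -` E) b \<le> g (b, q)" using q by (auto simp: g_def indicator_def E_def)
    qed
    finally show ?thesis using True by simp
  qed simp
  have "ennreal (unit_ball_vol 4 / 256) = emeasure lborel (cball y0 (1/4))"
    by (simp add: emeasure_cball power4_eq_xxxx)
  then have "ennreal (unit_ball_vol 4 / 256) * emeasure lborel E = (\<integral>\<^sup>+q. emeasure lborel E * indicator (cball y0 (1/4)) q \<partial>lborel)"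
    by (subst nn_integral_cmult_indicator) (simp_all add: mult.commute)
  also have "\<dots> \<le> (\<integral>\<^sup>+q. (\<integral>\<^sup>+b. g (b, q) \<partial>lborel) \<partial>lborel)"
    by (rule nn_integral_mono) (rule ineq2)
  also have "\<dots> = (\<integral>\<^sup>+b. (\<integral>\<^sup>+q. g (b, q) \<partial>lborel) \<partial>lborel)"
    by (rule lborel_pair.Fubini') simp
  also have "\<dots> \<le> (\<integral>\<^sup>+b. ennreal (weak_const * (\<beta> / t)\<^sup>2) * indicator (cball (0::quat ^ 'n) R) b \<partial>lborel)"
    using AE_lborel_singleton[of "0::quat ^ 'n"]
    by (intro nn_integral_mono_AE) (auto elim!: eventually_mono intro: ineq1)
  also have "\<dots> = emeasure lborel (cball (0::quat ^ 'n) R) * ennreal (weak_const * (\<beta> / t)\<^sup>2)"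
    by (subst nn_integral_cmult_indicator) (simp_all add: mult.commute)
  also have "emeasure lborel E = emeasure lborel {x\<in>cball a (R / 2). u x < ereal (M - t)}"
  proof -
    have "emeasure lborel E = emeasure lborel ((\<lambda>x. x + - a) -` E)"
      by (rule emeasure_lborel_translate[symmetric]) simp
    also have "(\<lambda>x. x + - a) -` E = {x\<in>cball a (R / 2). u x < ereal (M - t)}"
      using R by (auto simp: E_def O'_def dist_norm norm_minus_commute subset_iff)
    finally show ?thesis .
  qed
  finally show ?thesis .
qed

lemma ennreal_le_suminf: "(f k :: ennreal) \<le> (\<Sum>k. f k)"
  using sum_le_suminf[of f "{k}"] by (simp add: summableI)

text \<open>A dyadic layer-cake bound. If \<open>M - v\<close> lies between \<open>2 ^ k\<close> and
  \<open>2 ^ (k + 1)\<close>, the \<open>k\<close>-th summand alone suffices, because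
  \<open>M + 2 ^ (k + 1) \<le> (M + 1) * 2 ^ (k + 1)\<close>.\<close>

lemma abs_powr_dyadic:
  assumes "v \<le> ereal M" "M \<ge> 0" "q > 0"
  shows "abs_powr v q \<le> ennreal ((M + 1) powr q) +
    (\<Sum>k. ennreal (((M + 1) * 2 ^ (k + 1)) powr q) * indicator {v. v < ereal (M - 2 ^ k)} v)"
    (is "_ \<le> _ + (\<Sum>k. ?f k)")
proof (cases v)
  case (real r)
  then have rM: "r \<le> M" using assms by simp
  show ?thesis
  proof (cases "M - r \<le> 1")
    case True
    then have "\<bar>r\<bar> \<le> M + 1" using rM assms by simp
    then have "abs_powr v q \<le> ennreal ((M + 1) powr q)"
      using assms real by (auto simp: abs_powr_def intro!: ennreal_leI powr_mono2)
    then show ?thesis by (simp add: add_increasing2)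
  next
    case False
    define P where "P k \<longleftrightarrow> M - r \<le> 2 ^ (k + 1)" for k :: nat
    have "\<exists>k. P k"
    proof -
      obtain n :: nat where "M - r < 2 ^ n" using real_arch_pow[of 2 "M - r"] by auto
      moreover have "(2::real) ^ n \<le> 2 ^ (n + 1)" by simp
      ultimately have "M - r \<le> 2 ^ (n + 1)" by linarith
      then show ?thesis by (auto simp: P_def)
    qed
    \<comment> \<open>Minimality of \<open>k\<close> gives the lower bound
      \<open>2 ^ k < M - r\<close>; for \<open>k = 0\<close> it is the case assumption.\<close>
    define k where "k = (LEAST k. P k)"
    have Pk: "P k" unfolding k_def by (rule LeastI_ex) fact
    have "2 ^ k < M - r"
    proof (cases k)
      case 0
      then show ?thesis using False by simp
    next
      case (Suc k')
      then have "\<not> P k'" using not_less_Least[of k' P] by (simp add: k_def)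
      then show ?thesis using Suc by (simp add: P_def not_le)
    qed
    then have ind: "v < ereal (M - 2 ^ k)" using real by simp
    have "\<bar>r\<bar> \<le> M + 2 ^ (k + 1)" using Pk rM assms by (auto simp: P_def abs_le_iff)
    also have "\<dots> \<le> M * 2 ^ (k + 1) + 2 ^ (k + 1)"
    proof -
      have "M * 1 \<le> M * 2 ^ (k + 1)" using assms by (intro mult_left_mono) (auto intro: one_le_power simp del: power_Suc)
      then show ?thesis by simp
    qed
    also have "\<dots> = (M + 1) * 2 ^ (k + 1)" by (simp add: algebra_simps)
    finally have "abs_powr v q \<le> ?f k"
      using assms real ind by (auto simp: abs_powr_def intro!: ennreal_leI powr_mono2)
    also have "\<dots> \<le> (\<Sum>k. ?f k)" by (rule ennreal_le_suminf)
    finally show ?thesis by (simp add: add_increasing)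
  qed
next
  \<comment> \<open>Here \<open>v\<close> lies in every sublevel set and every summand is at least
    1, so the series is infinite.\<close>
  case MInf
  have f1: "1 \<le> ?f k" for k
  proof -
    have "1 \<le> (M + 1) * 2 ^ (k + 1)"
      using assms mult_mono[of 1 "M + 1" 1 "2 ^ (k + 1)"] by (auto intro: one_le_power simp del: power_Suc)
    then have "1 \<le> ((M + 1) * 2 ^ (k + 1)) powr q" using assms by (intro ge_one_powr_ge_zero) auto
    then show ?thesis using MInf ennreal_leI by fastforce
  qed
  have "(\<Sum>k. ?f k) = top"
  proof (rule ccontr)
    assume "(\<Sum>k. ?f k) \<noteq> top"
    then obtain n where n: "(\<Sum>k. ?f k) < of_nat n" using ennreal_Ex_less_of_nat by (auto simp: less_top)
    have "of_nat n = (\<Sum>k<n. (1::ennreal))" by simp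
    also have "\<dots> \<le> (\<Sum>k<n. ?f k)" by (intro sum_mono f1)
    also have "\<dots> \<le> (\<Sum>k. ?f k)" by (intro sum_le_suminf summableI) auto
    finally show False using n by simp
  qed
  then show ?thesis by simp
qed (use assms in simp)

text \<open>On the level \<open>2 ^ k\<close> the \<open>q\<close>-th power grows like
  \<open>2 ^ k\<close> to the power \<open>q\<close>, while the weak-type bound decays like
  \<open>4 ^ -k\<close>. The products form a geometric series of ratio
  \<open>2 powr (q - 2)\<close>, which converges because \<open>q < 2\<close>. The constant is
  obtained before \<open>\<Omega>\<close>, \<open>u\<close> and \<open>a\<close>, so that it can
  serve a whole sequence of functions with varying centres.\<close>

lemma qpsh_Lq_bound:
  assumes R: "R > 0" and M: "M \<ge> 0" and \<beta>: "\<beta> \<ge> 0" and q: "0 < q" "q < 2"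
  obtains C :: real where
    "\<And>\<Omega> (u :: quat ^ 'n \<Rightarrow> ereal) a. open \<Omega> \<Longrightarrow> u \<in> QPSH \<Omega> \<Longrightarrow> cball a (3 * R) \<subseteq> \<Omega> \<Longrightarrow>
      (\<And>x. x \<in> cball a (3 * R) \<Longrightarrow> u x \<le> ereal M) \<Longrightarrow> ereal M - u a \<le> ereal \<beta> \<Longrightarrow>
      (\<integral>\<^sup>+x\<in>cball a (R / 2). abs_powr (u x) q \<partial>lebesgue) \<le> ennreal C"
proof -
  define V where "V = unit_ball_vol 4 / 256"
  have V: "V > 0" by (simp add: V_def)
  define B where "B = unit_ball_vol (real DIM(quat ^ 'n)) * R ^ DIM(quat ^ 'n)"
  have B: "emeasure lborel (cball (a::quat ^ 'n) R) = ennreal B" "B \<ge> 0" for a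
    using R by (simp_all add: emeasure_cball B_def)
  define K where "K = B * (weak_const * \<beta>\<^sup>2) / V"
  have K: "K \<ge> 0" using B V weak_const_pos by (simp add: K_def)
  define c where "c k = ((M + 1) * 2 ^ (k + 1)) powr q" for k :: nat
  define s where "s = 2 powr (q - 2)"
  have s: "0 < s" "s < 1" using q by (auto simp: s_def powr_less_one)
  define d where "d k = (2 * (M + 1)) powr q * K * s ^ k" for k :: nat
  have d: "d k = c k * (K / (2 ^ k)\<^sup>2)" for k
  proof -
    have "c k = (2 * (M + 1)) powr q * (2 ^ k) powr q"
      using M by (simp add: c_def powr_mult[symmetric] algebra_simps)
    also have "(2 ^ k) powr q = (2 powr q) ^ k"
      by (subst (1 2) powr_realpow[symmetric]) (simp_all add: powr_powr mult.commute)
    also have "2 powr q = s * 4" by (simp add: s_def powr_diff)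
    finally have "c k = (2 * (M + 1)) powr q * (s ^ k * 4 ^ k)" by (simp add: power_mult_distrib)
    moreover have "(2 ^ k)\<^sup>2 = (4::real) ^ k" by (simp add: power_mult[symmetric] mult.commute[of k] power_mult)
    ultimately show ?thesis by (simp add: d_def)
  qed
  have d0: "d k \<ge> 0" for k using s K by (simp add: d_def)
  have sd: "summable d" unfolding d_def using s by (intro summable_mult summable_geometric) simp
  show thesis
  proof
    fix \<Omega> and u :: "quat ^ 'n \<Rightarrow> ereal" and a
    assume \<Omega>: "open \<Omega>" and u: "u \<in> QPSH \<Omega>" and ball: "cball a (3 * R) \<subseteq> \<Omega>"
      and uM: "\<And>x. x \<in> cball a (3 * R) \<Longrightarrow> u x \<le> ereal M" and ua: "ereal M - u a \<le> ereal \<beta>"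
    have sub: "cball a (R / 2) \<subseteq> cball a (3 * R)" using R by auto
    define S where "S k = {x\<in>cball a (R / 2). u x < ereal (M - 2 ^ k)}" for k :: nat
    have Sb: "S k \<in> sets borel" for k
    proof -
      have "S k = cball a (R / 2) \<inter> {x\<in>\<Omega>. u x < ereal (M - 2 ^ k)}" using sub ball by (auto simp: S_def)
      moreover have "open {x\<in>\<Omega>. u x < ereal (M - 2 ^ k)}"
        using QPSH_D(2)[OF u] \<Omega> usc_on_open_iff by blast
      ultimately show ?thesis by auto
    qed
    have Sm: "emeasure lborel (S k) \<le> ennreal (K / (2 ^ k)\<^sup>2)" for k
    proof -
      have "ennreal V * emeasure lborel (S k) \<le> ennreal B * ennreal (weak_const * (\<beta> / 2 ^ k)\<^sup>2)"
        using qpsh_weak_type[OF u \<Omega> R ball uM ua \<beta>, of "2 ^ k"] by (simp add: V_def S_def B)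
      also have "\<dots> = ennreal V * ennreal (K / (2 ^ k)\<^sup>2)"
        using B V K weak_const_pos by (simp add: K_def power_divide flip: ennreal_mult)
      finally show ?thesis using V by (simp add: ennreal_mult_le_mult_iff)
    qed
    have "(\<integral>\<^sup>+x\<in>cball a (R / 2). abs_powr (u x) q \<partial>lebesgue) =
      (\<integral>\<^sup>+x\<in>cball a (R / 2). abs_powr (u x) q \<partial>lborel)" by (simp add: nn_integral_completion)
    also have "\<dots> \<le> (\<integral>\<^sup>+x. ennreal ((M + 1) powr q) * indicator (cball a (R / 2)) x + (\<Sum>k. ennreal (c k) * indicator (S k) x) \<partial>lborel)"
    proof (rule nn_integral_mono)
      fix x
      show "abs_powr (u x) q * indicator (cball a (R / 2)) x \<le>
        ennreal ((M + 1) powr q) * indicator (cball a (R / 2)) x + (\<Sum>k. ennreal (c k) * indicator (S k) x)"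
      proof (cases "x \<in> cball a (R / 2)")
        case True
        have "indicator {v. v < ereal (M - 2 ^ k)} (u x) = (indicator (S k) x :: ennreal)" for k
          using True by (simp add: S_def indicator_def)
        then show ?thesis
          using abs_powr_dyadic[OF uM M q(1), of x] True sub by (auto simp: c_def)
      qed simp
    qed
    also have "\<dots> = ennreal ((M + 1) powr q) * emeasure lborel (cball a (R / 2)) + (\<Sum>k. ennreal (c k) * emeasure lborel (S k))"
    proof -
      have [measurable]: "S k \<in> sets borel" "cball a (R / 2) \<in> sets borel" for k using Sb by simp_all
      have 1: "(\<integral>\<^sup>+x. (\<Sum>k. ennreal (c k) * indicator (S k) x) \<partial>lborel) = (\<Sum>k. \<integral>\<^sup>+x. ennreal (c k) * indicator (S k) x \<partial>lborel)"
        by (rule nn_integral_suminf) measurable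
      have 2: "(\<integral>\<^sup>+x. ennreal (c k) * indicator (S k) x \<partial>lborel) = ennreal (c k) * emeasure lborel (S k)" for k
        by (rule nn_integral_cmult_indicator) measurable
      have 3: "(\<integral>\<^sup>+x. ennreal ((M + 1) powr q) * indicator (cball a (R / 2)) x \<partial>lborel) =
          ennreal ((M + 1) powr q) * emeasure lborel (cball a (R / 2))"
        by (rule nn_integral_cmult_indicator) measurable
      have "(\<integral>\<^sup>+x. ennreal ((M + 1) powr q) * indicator (cball a (R / 2)) x + (\<Sum>k. ennreal (c k) * indicator (S k) x) \<partial>lborel) =
        (\<integral>\<^sup>+x. ennreal ((M + 1) powr q) * indicator (cball a (R / 2)) x \<partial>lborel) + (\<integral>\<^sup>+x. (\<Sum>k. ennreal (c k) * indicator (S k) x) \<partial>lborel)"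
        by (rule nn_integral_add) measurable
      then show ?thesis unfolding 1 2 3 .
    qed
    also have "\<dots> \<le> ennreal ((M + 1) powr q) * ennreal B + (\<Sum>k. ennreal (d k))"
    proof (intro add_mono mult_left_mono suminf_le summableI)
      show "emeasure lborel (cball a (R / 2)) \<le> ennreal B"
        using R B(1)[of a, symmetric] by (auto intro!: emeasure_mono)
      show "ennreal (c k) * emeasure lborel (S k) \<le> ennreal (d k)" for k
      proof -
        have "ennreal (d k) = ennreal (c k) * ennreal (K / (2 ^ k)\<^sup>2)"
          unfolding d using K by (intro ennreal_mult) (simp_all add: c_def)
        then show ?thesis using mult_left_mono[OF Sm[of k], of "ennreal (c k)"] by simp
      qed
    qed auto
    also have "\<dots> = ennreal ((M + 1) powr q * B + suminf d)"
      using d0 sd B(2) by (simp add: suminf_ennreal2 ennreal_mult suminf_nonneg)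
    finally show "(\<integral>\<^sup>+x\<in>cball a (R / 2). abs_powr (u x) q \<partial>lebesgue) \<le> ennreal ((M + 1) powr q * B + suminf d)" .
  qed
qed

text \<open>The finite subcover depends on \<open>K\<close> and \<delta> only, hence one
  \<open>C\<close> serves all \<open>f\<close> with the same local bounds; this is what keeps the
  later bounds uniform along a sequence.\<close>

lemma nn_integral_compact_bound:
  fixes K :: "'a::euclidean_space set" and c \<delta> :: "'a \<Rightarrow> real"
  assumes K: "compact K" and \<delta>: "\<And>x. x \<in> K \<Longrightarrow> \<delta> x > 0"
  obtains C :: real where "\<And>f. f \<in> borel_measurable borel \<Longrightarrow>
      (\<And>x. x \<in> K \<Longrightarrow> (\<integral>\<^sup>+y\<in>ball x (\<delta> x). f y \<partial>lborel) \<le> ennreal (c x)) \<Longrightarrow>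
      (\<integral>\<^sup>+y\<in>K. f y \<partial>lborel) \<le> ennreal C"
proof -
  have "K \<subseteq> (\<Union>x\<in>K. ball x (\<delta> x))" using \<delta> by force
  then obtain D where D: "D \<subseteq> K" "finite D" "K \<subseteq> (\<Union>x\<in>D. ball x (\<delta> x))"
    using compactE_image[OF K, of K "\<lambda>x. ball x (\<delta> x)"] by auto
  show thesis
  proof
    fix f :: "'a \<Rightarrow> ennreal"
    assume [measurable]: "f \<in> borel_measurable borel"
      and f: "\<And>x. x \<in> K \<Longrightarrow> (\<integral>\<^sup>+y\<in>ball x (\<delta> x). f y \<partial>lborel) \<le> ennreal (c x)"
    have [measurable]: "ball x (\<delta> x) \<in> sets borel" for x by simp
    have "(\<integral>\<^sup>+y\<in>K. f y \<partial>lborel) \<le> (\<integral>\<^sup>+y. (\<Sum>x\<in>D. f y * indicator (ball x (\<delta> x)) y) \<partial>lborel)"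
    proof (rule nn_integral_mono)
      fix y
      show "f y * indicator K y \<le> (\<Sum>x\<in>D. f y * indicator (ball x (\<delta> x)) y)"
      proof (cases "y \<in> K")
        case True
        then obtain x where x: "x \<in> D" "y \<in> ball x (\<delta> x)" using D by blast
        have "f y * indicator (ball x (\<delta> x)) y \<le> (\<Sum>x\<in>D. f y * indicator (ball x (\<delta> x)) y)"
          using x D by (intro sum_nonneg_leq_bound[of D, OF _ _ refl]) auto
        then show ?thesis using x True by simp
      qed simp
    qed
    also have "\<dots> = (\<Sum>x\<in>D. \<integral>\<^sup>+y\<in>ball x (\<delta> x). f y \<partial>lborel)" by (rule nn_integral_sum) measurable
    also have "\<dots> \<le> (\<Sum>x\<in>D. ennreal (max 0 (c x)))"
      using f D by (intro sum_mono) (auto simp: ennreal_max_0)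
    also have "\<dots> = ennreal (\<Sum>x\<in>D. max 0 (c x))" by (rule sum_ennreal) simp
    finally show "(\<integral>\<^sup>+y\<in>K. f y \<partial>lborel) \<le> ennreal (\<Sum>x\<in>D. max 0 (c x))" .
  qed
qed

lemma emeasure_lborel_ball_neq_0:
  assumes "r > 0"
  shows "emeasure lborel (ball (x::'a::euclidean_space) r) \<noteq> 0"
proof -
  have "0 < unit_ball_vol (real DIM('a)) * r ^ DIM('a)" using assms by simp
  then show ?thesis using assms by (simp only: emeasure_ball less_imp_le) (metis ennreal_eq_0_iff not_less)
qed

lemma borel_measurable_vec_component [measurable]:
  "(\<lambda>x :: 'a::euclidean_space ^ 'n. x $ i) \<in> borel_measurable borel"
  by (intro borel_measurable_continuous_onI continuous_intros)

lemma borel_measurable_abs_powr [measurable]: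
  assumes [measurable]: "f \<in> borel_measurable M"
  shows "(\<lambda>x. abs_powr (f x) p) \<in> borel_measurable M"
proof -
  have "\<bar>y\<bar> = \<infinity> \<longleftrightarrow> y = \<infinity> \<or> y = -\<infinity>" for y :: ereal by (cases y) auto
  then show ?thesis unfolding abs_powr_def by simp
qed

lemma usc_on_measurable_lebesgue_on:
  fixes u :: "'a::euclidean_space \<Rightarrow> ereal"
  assumes "open \<Omega>" "usc_on \<Omega> u"
  shows "u \<in> borel_measurable (lebesgue_on \<Omega>)"
proof -
  have "(\<lambda>x. if x \<in> \<Omega> then u x else 0) \<in> borel_measurable lborel"
    using usc_on_borel_measurable[OF assms] by simp
  then have "(\<lambda>x. if x \<in> \<Omega> then u x else 0) \<in> borel_measurable lebesgue" by (rule measurable_completion)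
  then have "(\<lambda>x. if x \<in> \<Omega> then u x else 0) \<in> borel_measurable (lebesgue_on \<Omega>)"
    by (rule measurable_restrict_space1)
  then show ?thesis by (rule measurable_cong[THEN iffD1, rotated]) simp
qed

text \<open>\<open>u y\<close> may be \<open>-\<infinity>\<close>: a point \<open>a\<close> with
  finite value within \<open>R / 4\<close> of \<open>y\<close> serves as centre. The ball of radius
  \<open>3 * R\<close> about \<open>a\<close> stays in \<open>cball y \<rho>\<close> since
  \<open>\<rho> = 4 * R\<close>, and the ball of radius \<open>R / 2\<close> about \<open>a\<close>
  still covers a neighbourhood of \<open>y\<close>.\<close>

lemma qpsh_local_Lq:
  fixes u :: "quat ^ 'n \<Rightarrow> ereal"
  assumes \<Omega>: "open \<Omega>" and u: "u \<in> QPSH \<Omega>" and q: "0 < q" "q < 2"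
    and y: "y \<in> \<Omega>" "y \<in> closure {x\<in>\<Omega>. u x \<noteq> -\<infinity>}"
  obtains \<delta> where "\<delta> > 0" "ball y \<delta> \<subseteq> \<Omega>" "(\<integral>\<^sup>+x\<in>ball y \<delta>. abs_powr (u x) q \<partial>lebesgue) < \<infinity>"
proof -
  obtain \<rho> where \<rho>: "\<rho> > 0" "cball y \<rho> \<subseteq> \<Omega>" using \<Omega> y open_contains_cball by blast
  define R where "R = \<rho> / 4"
  have R: "R > 0" using \<rho> by (simp add: R_def)
  obtain M where M: "M \<ge> 0" "\<And>x. x \<in> cball y \<rho> \<Longrightarrow> u x \<le> ereal M"
    using usc_on_locally_bounded_above[OF \<Omega> QPSH_D(2)[OF u] QPSH_D(1)[OF u] _ \<rho>(2)] by auto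
  obtain a where a: "a \<in> \<Omega>" "u a \<noteq> -\<infinity>" "dist a y < R / 4"
    using y(2) R unfolding closure_approachable by (metis (mono_tags, lifting) mem_Collect_eq divide_pos_pos zero_less_numeral)
  have sub: "cball a (3 * R) \<subseteq> cball y \<rho>"
  proof
    fix x assume "x \<in> cball a (3 * R)"
    then show "x \<in> cball y \<rho>" using dist_triangle[of y x a] a(3) \<rho>(1) by (simp add: R_def dist_commute)
  qed
  have sub2: "ball y (R / 4) \<subseteq> cball a (R / 2)"
  proof
    fix x assume "x \<in> ball y (R / 4)"
    then show "x \<in> cball a (R / 2)" using dist_triangle[of a x y] a(3) by simp
  qed
  obtain r where r: "u a = ereal r" using a QPSH_D(1)[OF u, of a] by (cases "u a") auto
  obtain C :: real where C0: "\<And>\<Omega> (u :: quat ^ 'n \<Rightarrow> ereal) a. open \<Omega> \<Longrightarrow> u \<in> QPSH \<Omega> \<Longrightarrow> cball a (3 * R) \<subseteq> \<Omega> \<Longrightarrow>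
      (\<And>x. x \<in> cball a (3 * R) \<Longrightarrow> u x \<le> ereal M) \<Longrightarrow> ereal M - u a \<le> ereal (max 0 (M - r)) \<Longrightarrow>
      (\<integral>\<^sup>+x\<in>cball a (R / 2). abs_powr (u x) q \<partial>lebesgue) \<le> ennreal C"
    by (rule qpsh_Lq_bound[OF R M(1) _ q, of "max 0 (M - r)"]) auto
  have C: "(\<integral>\<^sup>+x\<in>cball a (R / 2). abs_powr (u x) q \<partial>lebesgue) \<le> ennreal C"
    by (rule C0[OF \<Omega> u]) (use sub \<rho>(2) M(2) r in auto)
  have "(\<integral>\<^sup>+x\<in>ball y (R / 4). abs_powr (u x) q \<partial>lebesgue) \<le> (\<integral>\<^sup>+x\<in>cball a (R / 2). abs_powr (u x) q \<partial>lebesgue)"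
    using sub2 by (intro nn_integral_mono) (auto simp: indicator_def)
  also note C
  finally have "(\<integral>\<^sup>+x\<in>ball y (R / 4). abs_powr (u x) q \<partial>lebesgue) < \<infinity>" by (rule le_less_trans) simp
  moreover have "ball y (R / 4) \<subseteq> \<Omega>"
  proof -
    have "ball y (R / 4) \<subseteq> cball y \<rho>" using R by (auto simp: R_def)
    then show ?thesis using \<rho> by blast
  qed
  ultimately show thesis using that[of "R / 4"] R by simp
qed

text \<open>Near a point of the closure \<open>u\<close> is integrable, so it cannot be
  \<open>-\<infinity>\<close> on any smaller ball. The closure is therefore relatively open as well
  as closed, and connectedness of \<Omega> finishes the argument.\<close>

lemma qpsh_finite_dense:
  fixes u :: "quat ^ 'n \<Rightarrow> ereal"
  assumes \<Omega>: "domain \<Omega>" and u: "u \<in> QPSH \<Omega>" and ne: "\<exists>x\<in>\<Omega>. u x \<noteq> -\<infinity>"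
  shows "\<Omega> \<subseteq> closure {x\<in>\<Omega>. u x \<noteq> -\<infinity>}"
proof -
  let ?N = "{x\<in>\<Omega>. u x \<noteq> -\<infinity>}"
  define A where "A = \<Omega> \<inter> closure ?N"
  have o: "open \<Omega>" "connected \<Omega>" using \<Omega> by (auto simp: domain_def)
  have "openin (top_of_set \<Omega>) A"
  proof (subst openin_open_eq[OF o(1)], intro conjI)
    show "A \<subseteq> \<Omega>" by (simp add: A_def)
    show "open A"
    proof (subst open_contains_ball, rule ballI)
      fix y assume "y \<in> A"
      then obtain \<delta> where \<delta>: "\<delta> > 0" "ball y \<delta> \<subseteq> \<Omega>" "(\<integral>\<^sup>+x\<in>ball y \<delta>. abs_powr (u x) 1 \<partial>lebesgue) < \<infinity>"
        using qpsh_local_Lq[OF o(1) u, of 1 y] unfolding A_def by auto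
      have "z \<in> closure ?N" if z: "z \<in> ball y \<delta>" for z
      proof (rule ccontr)
        assume "z \<notin> closure ?N"
        then have "z \<in> - closure ?N" "open (- closure ?N)" by auto
        then obtain s where s: "s > 0" "ball z s \<subseteq> - closure ?N" using open_contains_ball by meson
        obtain s' where s': "s' > 0" "ball z s' \<subseteq> ball y \<delta>" using z open_ball open_contains_ball by meson
        define t where "t = min s s'"
        have t: "t > 0" using s s' by (simp add: t_def)
        have inf: "u x = -\<infinity>" if "x \<in> ball z t" for x
        proof -
          have "x \<notin> ?N" using that s(2) closure_subset[of ?N] by (auto simp: t_def)
          moreover have "x \<in> \<Omega>" using that s' \<delta> by (auto simp: t_def subset_iff)
          ultimately show ?thesis by simp
        qed
        have sub: "ball z t \<subseteq> ball y \<delta>" using s'(2) by (auto simp: t_def subset_iff)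
        have "top = top * emeasure lebesgue (ball z t)"
          using emeasure_lborel_ball_neq_0[OF t, of z] by (simp add: ennreal_top_mult)
        also have "\<dots> = (\<integral>\<^sup>+x\<in>ball z t. top \<partial>lebesgue)" by (rule nn_integral_cmult_indicator[symmetric]) simp
        also have "\<dots> \<le> (\<integral>\<^sup>+x\<in>ball y \<delta>. abs_powr (u x) 1 \<partial>lebesgue)"
          using inf sub by (intro nn_integral_mono) (auto simp: indicator_def abs_powr_def)
        finally show False using \<delta>(3) by (simp add: top_unique)
      qed
      then show "\<exists>e>0. ball y e \<subseteq> A" using \<delta> by (intro exI[of _ \<delta>]) (auto simp: A_def)
    qed
  qed
  moreover have "closedin (top_of_set \<Omega>) A" unfolding A_def by (intro closedin_closed_Int closed_closure)
  moreover have "A \<noteq> {}" using ne closure_subset[of ?N] by (auto simp: A_def)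
  ultimately have "A = \<Omega>" using o(2) connected_clopen by blast
  then show ?thesis by (auto simp: A_def)
qed

lemma qpsh_Lp_loc:
  fixes u :: "quat ^ 'n \<Rightarrow> ereal"
  assumes \<Omega>: "domain \<Omega>" and u: "u \<in> QPSH \<Omega>" and ne: "\<exists>x\<in>\<Omega>. u x \<noteq> -\<infinity>" and q: "0 < q" "q < 2"
  shows "Lp_loc q \<Omega> u"
  unfolding Lp_loc_def
proof (intro conjI allI impI)
  have o: "open \<Omega>" using \<Omega> by (auto simp: domain_def)
  show "u \<in> borel_measurable (lebesgue_on \<Omega>)" by (rule usc_on_measurable_lebesgue_on[OF o QPSH_D(2)[OF u]])
  fix K assume K: "compact K \<and> K \<subseteq> \<Omega>"
  define u' where "u' x = (if x \<in> \<Omega> then u x else 0)" for x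
  have [measurable]: "u' \<in> borel_measurable borel"
    using usc_on_borel_measurable[OF o QPSH_D(2)[OF u]] by (simp add: u'_def[abs_def])
  have "\<exists>\<delta> c. \<delta> > 0 \<and> (\<integral>\<^sup>+x\<in>ball y \<delta>. abs_powr (u' x) q \<partial>lborel) \<le> ennreal c" if "y \<in> K" for y
  proof -
    have y: "y \<in> \<Omega>" "y \<in> closure {x\<in>\<Omega>. u x \<noteq> -\<infinity>}" using that K qpsh_finite_dense[OF \<Omega> u ne] by auto
    from qpsh_local_Lq[OF o u q y] obtain \<delta> where \<delta>: "\<delta> > 0" "ball y \<delta> \<subseteq> \<Omega>" "(\<integral>\<^sup>+x\<in>ball y \<delta>. abs_powr (u x) q \<partial>lebesgue) < \<infinity>" .
    have "(\<integral>\<^sup>+x\<in>ball y \<delta>. abs_powr (u' x) q \<partial>lborel) = (\<integral>\<^sup>+x\<in>ball y \<delta>. abs_powr (u x) q \<partial>lebesgue)"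
      unfolding nn_integral_completion using \<delta>(2) by (intro nn_integral_cong) (auto simp: indicator_def u'_def subset_iff)
    moreover define X where "X = (\<integral>\<^sup>+x\<in>ball y \<delta>. abs_powr (u x) q \<partial>lebesgue)"
    moreover obtain c where "X = ennreal c" using \<delta>(3) by (cases X) (auto simp: X_def)
    ultimately show ?thesis using \<delta>(1) by (intro exI[of _ \<delta>] exI[of _ c]) simp
  qed
  then have "\<forall>y\<in>K. \<exists>\<delta> c. \<delta> > 0 \<and> (\<integral>\<^sup>+x\<in>ball y \<delta>. abs_powr (u' x) q \<partial>lborel) \<le> ennreal c" by blast
  from bchoice[OF this] obtain \<delta> where "\<forall>y\<in>K. \<exists>c. \<delta> y > 0 \<and> (\<integral>\<^sup>+x\<in>ball y (\<delta> y). abs_powr (u' x) q \<partial>lborel) \<le> ennreal c" ..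
  from bchoice[OF this] obtain c where \<delta>: "\<forall>y\<in>K. \<delta> y > 0 \<and> (\<integral>\<^sup>+x\<in>ball y (\<delta> y). abs_powr (u' x) q \<partial>lborel) \<le> ennreal (c y)" ..
  obtain C :: real where C: "\<And>f. f \<in> borel_measurable borel \<Longrightarrow>
      (\<And>x. x \<in> K \<Longrightarrow> (\<integral>\<^sup>+y\<in>ball x (\<delta> x). f y \<partial>lborel) \<le> ennreal (c x)) \<Longrightarrow>
      (\<integral>\<^sup>+y\<in>K. f y \<partial>lborel) \<le> ennreal C"
    by (rule nn_integral_compact_bound[of K \<delta> c]) (use K \<delta> in auto)
  have "(\<integral>\<^sup>+x\<in>K. abs_powr (u x) q \<partial>lebesgue) = (\<integral>\<^sup>+x\<in>K. abs_powr (u' x) q \<partial>lborel)"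
    unfolding nn_integral_completion using K by (intro nn_integral_cong) (auto simp: indicator_def u'_def subset_iff)
  also have "\<dots> \<le> ennreal C" by (rule C) (use \<delta> in auto)
  finally show "(\<integral>\<^sup>+x\<in>K. abs_powr (u x) q \<partial>lebesgue) < \<infinity>" by (rule le_less_trans) simp
qed

section \<open>Optimality of the exponent\<close>

text \<open>The closed polydisc about 0. As a product of balls in the coordinate lines it suits
  iterated one-line mean values, unlike a Euclidean ball.\<close>

definition polyball :: "real \<Rightarrow> (quat ^ 'n) set" where
  "polyball r = {y. \<forall>i. norm (y $ i) \<le> r}"

lemma norm_le_sum_components: "norm (x :: quat ^ 'n) \<le> (\<Sum>i\<in>UNIV. norm (x $ i))"
  by (simp add: norm_vec_def L2_set_le_sum)

lemma compact_polyball [simp]: "compact (polyball r :: (quat ^ 'n) set)"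
proof -
  have "closed (polyball r :: (quat ^ 'n) set)"
    unfolding polyball_def by (intro closed_Collect_all closed_Collect_le continuous_intros)
  moreover have "bounded (polyball r :: (quat ^ 'n) set)"
  proof (rule boundedI)
    fix x :: "quat ^ 'n" assume "x \<in> polyball r"
    then have "(\<Sum>i\<in>UNIV. norm (x $ i)) \<le> (\<Sum>i\<in>(UNIV::'n set). r)" by (intro sum_mono) (auto simp: polyball_def)
    then show "norm x \<le> (\<Sum>i\<in>(UNIV::'n set). r)" using norm_le_sum_components order_trans by blast
  qed
  ultimately show ?thesis by (simp add: compact_eq_bounded_closed)
qed

text \<open>Since \<open>inverse 0 = \<infinity>\<close> on \<open>ennreal\<close>, the value is \<open>-\<infinity>\<close> where \<open>x $ i = 0\<close>.\<close>

definition newton_fun :: "'n \<Rightarrow> quat ^ 'n \<Rightarrow> ereal" where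
  "newton_fun i x = - enn2ereal (inverse (ennreal ((norm (x $ i))\<^sup>2)))"

lemma e2ennreal_newton_fun:
  "e2ennreal (- newton_fun i x) = inverse (ennreal ((norm (x $ i))\<^sup>2))"
  "e2ennreal (ereal 0 - newton_fun i x) = inverse (ennreal ((norm (x $ i))\<^sup>2))"
  by (simp_all add: newton_fun_def flip: zero_ereal_def)

lemma newton_fun_continuous: "continuous_on UNIV (newton_fun i)"
  unfolding newton_fun_def
  by (intro continuous_on_compose2[OF continuous_uminus_ereal[of UNIV]] continuous_on_compose2[OF continuous_on_enn2ereal] continuous_intros continuous_on_ennreal) auto

lemma newton_fun_usc: "usc_on UNIV (newton_fun i)"
proof (subst usc_on_open_iff, simp, rule allI)
  fix c
  show "open {x \<in> UNIV. newton_fun i x < c}"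
    using open_vimage[OF open_lessThan[of c] newton_fun_continuous[of i]] by (simp add: vimage_def)
qed

text \<open>For \<open>b \<noteq> 0\<close> one has \<open>a + b q = b (q + c)\<close> with
  \<open>c\<close> the left quotient of \<open>a\<close> by \<open>b\<close>. Multiplicativity of
  the norm and a translation then reduce the claim to the kernel with pole at 0.\<close>

lemma inverse_norm_square_affine_mean:
  fixes a b x :: quat
  assumes r: "r > 0"
  shows "(\<integral>\<^sup>+q\<in>cball x r. inverse (ennreal ((norm (a + b \<otimes>\<^sub>q q))\<^sup>2)) \<partial>lborel) \<le>
    emeasure lborel (cball x r) * inverse (ennreal ((norm (a + b \<otimes>\<^sub>q x))\<^sup>2))"
proof (cases "b = 0")
  case True
  have "0 \<otimes>\<^sub>q q = 0" for q using norm_qmult[of 0 q] by simp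
  then have "(\<integral>\<^sup>+q\<in>cball x r. inverse (ennreal ((norm (a + b \<otimes>\<^sub>q q))\<^sup>2)) \<partial>lborel) =
    (\<integral>\<^sup>+q\<in>cball x r. inverse (ennreal ((norm a)\<^sup>2)) \<partial>lborel)" "0 \<otimes>\<^sub>q x = 0" by (simp_all add: True)
  then show ?thesis by (subst (asm) nn_integral_cmult_indicator) (simp_all add: True mult.commute)
next
  case False
  then obtain y where y: "b \<otimes>\<^sub>q y = axis 1 1" by (rule qmult_right_inverse)
  define c where "c = y \<otimes>\<^sub>q a"
  have bc: "b \<otimes>\<^sub>q c = a" by (simp add: c_def qmult_assoc[symmetric] y one_qmult)
  define s where "s = inverse (ennreal ((norm b)\<^sup>2))"
  let ?k = "\<lambda>y::quat. inverse (ennreal ((norm y)\<^sup>2))"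
  have k: "?k (a + b \<otimes>\<^sub>q q) = s * ?k (q + c)" for q
  proof -
    have "a + b \<otimes>\<^sub>q q = b \<otimes>\<^sub>q (q + c)" using linear_add[OF linear_qmult_right, of b q c] by (simp add: bc)
    then have "ennreal ((norm (a + b \<otimes>\<^sub>q q))\<^sup>2) = ennreal ((norm b)\<^sup>2) * ennreal ((norm (q + c))\<^sup>2)"
      by (simp add: norm_qmult power_mult_distrib ennreal_mult)
    then show ?thesis using ennreal_inverse_mult[of "ennreal ((norm b)\<^sup>2)" "ennreal ((norm (q + c))\<^sup>2)"]
      by (simp add: s_def)
  qed
  have [measurable]: "cball z r \<in> sets borel" for z :: quat by simp
  have "(\<integral>\<^sup>+q\<in>cball x r. ?k (a + b \<otimes>\<^sub>q q) \<partial>lborel) = s * (\<integral>\<^sup>+q\<in>cball x r. ?k (q + c) \<partial>lborel)"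
    unfolding k mult.assoc by (rule nn_integral_cmult) measurable
  also have "(\<integral>\<^sup>+q\<in>cball x r. ?k (q + c) \<partial>lborel) = (\<integral>\<^sup>+q. ?k (q + c) * indicator (cball (x + c) r) (q + c) \<partial>lborel)"
    by (intro nn_integral_cong) (auto simp: indicator_def dist_norm)
  also have "\<dots> = (\<integral>\<^sup>+y\<in>cball (x + c) r. ?k y \<partial>lborel)"
    by (rule nn_integral_lborel_translate) measurable
  also have "s * \<dots> \<le> s * (emeasure lborel (cball (x + c) r) * ?k (x + c))"
    by (intro mult_left_mono inverse_norm_square_mean r) simp
  also have "emeasure lborel (cball (x + c) r) = emeasure lborel (cball x r)"
    using r by (simp add: emeasure_cball)
  also have "s * (emeasure lborel (cball x r) * ?k (x + c)) = emeasure lborel (cball x r) * ?k (a + b \<otimes>\<^sub>q x)"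
    unfolding k by (simp add: mult_ac)
  finally show ?thesis .
qed

text \<open>On a line the \<open>i\<close>-th coordinate is
  \<open>a $ i + b $ i \<otimes>\<^sub>q q\<close>, where \<open>b $ i\<close> may vanish although
  \<open>b\<close> does not; the restriction is then constant, possibly
  \<open>-\<infinity>\<close>.\<close>

lemma newton_fun_QPSH: "newton_fun i \<in> QPSH UNIV"
proof -
  have fin: "newton_fun i x < \<infinity>" for x
    using enn2ereal_nonneg[of "inverse (ennreal ((norm (x $ i))\<^sup>2))"]
    by (cases "enn2ereal (inverse (ennreal ((norm (x $ i))\<^sup>2)))") (auto simp: newton_fun_def)
  have "subharmonic_on UNIV (\<lambda>q. newton_fun i (a + qscale_right b q))" for a b
    unfolding subharmonic_on_def
  proof (intro conjI allI impI ballI fin)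
    let ?v = "\<lambda>q. newton_fun i (a + qscale_right b q)"
    show usc: "usc_on UNIV ?v"
    proof (subst usc_on_open_iff, simp, rule allI)
      fix c
      have "open {x\<in>UNIV. newton_fun i x < c}"
        using newton_fun_usc usc_on_open_iff[OF open_UNIV] by blast
      from open_qline[OF this, of a b] show "open {q \<in> UNIV. ?v q < c}" by simp
    qed
    fix x :: quat and r :: real assume r: "0 < r \<and> cball x r \<subseteq> UNIV"
    have m: "(\<lambda>q. if q \<in> cball x r then ?v q else 0) \<in> borel_measurable borel"
      by (rule usc_on_borel_measurable_subset[OF open_UNIV usc]) auto
    have le0: "?v q \<le> ereal 0" for q
      using enn2ereal_nonneg by (simp add: newton_fun_def flip: zero_ereal_def)
    show "?v x \<le> ereal_integral (uniform_measure lborel (cball x r)) ?v"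
      using r emeasure_lborel_cball_pos[of r x] emeasure_lborel_cball_finite[of x r] le0
        inverse_norm_square_affine_mean[of r "a $ i" "b $ i" x]
      by (subst le_ereal_integral_iff[OF _ _ _ m, of 0]) (auto simp: e2ennreal_newton_fun qscale_right_def)
  qed simp
  then show ?thesis using newton_fun_usc fin by (auto simp: QPSH_def)
qed


text \<open>
  Halving the \<open>i\<close>-th coordinate leaves the integral of \<open>|x\<^sub>i|\<^sup>-\<^sup>4\<close> invariant, so it is 0 or \<open>\<infinity>\<close>
  on the difference of a polydisc and its half.
\<close>

lemma nn_integral_halve_coordinate:
  fixes f :: "quat ^ 'n \<Rightarrow> ennreal"
  assumes [measurable]: "f \<in> borel_measurable borel"
  shows "16 * (\<integral>\<^sup>+x. f x \<partial>lborel) = (\<integral>\<^sup>+x. f (\<chi> k. (if k = i then 1/2 else 1) *\<^sub>R x $ k) \<partial>lborel)"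
proof -
  \<comment> \<open>A diagonal scaling by 1/2 in the four real directions of the \<open>i\<close>-th
    quaternionic coordinate; its determinant is 1/16.\<close>
  define c where "c j = (if j \<in> axis i ` (Basis::quat set) then 1/2 else (1::real))" for j :: "quat ^ 'n"
  have c0: "c j \<noteq> 0" for j by (simp add: c_def)
  define T where "T x = (\<Sum>j\<in>Basis. (c j * (x \<bullet> j)) *\<^sub>R j)" for x :: "quat ^ 'n"
  have T: "T x = (\<chi> k. (if k = i then 1/2 else 1) *\<^sub>R x $ k)" for x
  proof (rule euclidean_eqI)
    fix j :: "quat ^ 'n" assume j: "j \<in> Basis"
    then obtain k b where kb: "j = axis k b" "b \<in> Basis" by (auto simp: Basis_vec_def)
    have "T x \<bullet> j = c j * (x \<bullet> j)" using j unfolding T_def by (simp add: inner_sum_left_Basis)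
    moreover have "c j = (if k = i then 1/2 else 1)"
      using kb nonzero_Basis[OF kb(2)] by (auto simp: c_def axis_eq_axis)
    ultimately show "T x \<bullet> j = (\<chi> k. (if k = i then 1/2 else 1) *\<^sub>R x $ k) \<bullet> j"
      using kb by (simp add: inner_axis)
  qed
  have "(\<Prod>j\<in>(Basis::(quat ^ 'n) set). \<bar>c j\<bar>) = (\<Prod>j\<in>axis i ` (Basis::quat set). 1/2)"
  proof (rule prod.mono_neutral_cong_right)
    show "axis i ` (Basis::quat set) \<subseteq> Basis" by (auto simp: Basis_vec_def)
  qed (auto simp: c_def)
  also have "\<dots> = (1/2) ^ card (axis i ` (Basis::quat set) :: (quat ^ 'n) set)" by simp
  also have "card (axis i ` (Basis::quat set) :: (quat ^ 'n) set) = 4"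
    by (subst card_image) (auto simp: inj_on_def axis_eq_axis)
  finally have p: "(\<Prod>j\<in>(Basis::(quat ^ 'n) set). \<bar>c j\<bar>) = 1/16" by (simp add: power4_eq_xxxx)
  have [measurable]: "T \<in> borel_measurable borel" unfolding T_def by measurable
  have "lborel = density (distr lborel borel T) (\<lambda>_. ennreal (\<Prod>j\<in>(Basis::(quat ^ 'n) set). \<bar>c j\<bar>))"
    using lborel_affine_euclidean[where c = c and t = 0] c0 by (simp add: T_def[abs_def])
  then have "(\<integral>\<^sup>+x. f x \<partial>lborel) = (\<integral>\<^sup>+x. f x \<partial>density (distr lborel borel T) (\<lambda>_. ennreal (1/16)))"
    unfolding p by simp
  also have "\<dots> = ennreal (1/16) * (\<integral>\<^sup>+x. f (T x) \<partial>lborel)"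
    by (subst nn_integral_density, simp, simp, subst nn_integral_distr) (simp_all add: nn_integral_cmult)
  finally have "16 * (\<integral>\<^sup>+x. f x \<partial>lborel) = (ennreal 16 * ennreal (1/16)) * (\<integral>\<^sup>+x. f (T x) \<partial>lborel)"
    by (simp add: mult.assoc)
  also have "ennreal 16 * ennreal (1/16) = 1" by (subst ennreal_mult[symmetric]) auto
  finally show ?thesis by (simp add: T)
qed

lemma newton_fun_not_Lp_loc:
  assumes p: "p \<ge> 2"
  shows "\<not> Lp_loc p UNIV (newton_fun (i :: 'n::finite))"
proof
  assume "Lp_loc p UNIV (newton_fun i)"
  then have fin: "(\<integral>\<^sup>+x\<in>polyball 1. abs_powr (newton_fun i x) p \<partial>lebesgue) < \<infinity>"
    by (simp add: Lp_loc_def)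
  define h :: "quat ^ 'n \<Rightarrow> ennreal" where "h x = inverse (ennreal ((norm (x $ i)) ^ 4))" for x
  define H where "H x = (\<chi> k. (if k = i then 1/2 else 1) *\<^sub>R x $ k)" for x :: "quat ^ 'n"
  define Q where "Q = {x :: quat ^ 'n. norm (x $ i) \<le> 1/2 \<and> (\<forall>k. k \<noteq> i \<longrightarrow> norm (x $ k) \<le> 1)}"
  have [measurable]: "polyball 1 \<in> sets (borel :: (quat ^ 'n) measure)"
    by (simp add: borel_closed compact_imp_closed)
  have Q: "Q = {x. norm (x $ i) \<le> 1/2} \<inter> (\<Inter>k\<in>UNIV - {i}. {x. norm (x $ k) \<le> 1})"
    by (auto simp: Q_def)
  have "closed Q"
    unfolding Q by (intro closed_Int closed_INT ballI closed_Collect_le continuous_intros)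
  then have [measurable]: "Q \<in> sets borel" by simp
  have [measurable]: "h \<in> borel_measurable borel" unfolding h_def by measurable
  have QP: "Q \<subseteq> polyball 1"
  proof
    fix x assume "x \<in> Q"
    then have "norm (x $ k) \<le> 1" for k by (cases "k = i") (auto simp: Q_def)
    then show "x \<in> polyball 1" by (simp add: polyball_def)
  qed
  \<comment> \<open>On the unit polydisc \<open>|x $ i| \<le> 1\<close>, so a larger
    \<open>p\<close> only increases the integrand and the exponent 2, that is
    \<open>|x $ i|^-4\<close>, is the decisive case.\<close>
  have le: "h x \<le> abs_powr (newton_fun i x) p" if "x \<in> polyball 1" for x
  proof (cases "x $ i = 0")
    case False
    have n: "0 < norm (x $ i)" "norm (x $ i) \<le> 1" using that False by (auto simp: polyball_def)
    define s where "s = inverse ((norm (x $ i))\<^sup>2)"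
    have s: "s \<ge> 1" using n power_le_one[of "norm (x $ i)" 2] by (simp add: s_def one_le_inverse)
    have "inverse (ennreal ((norm (x $ i))\<^sup>2)) = ennreal s" using n by (simp add: inverse_ennreal s_def)
    then have "newton_fun i x = ereal (- s)" using s by (simp add: newton_fun_def)
    then have "abs_powr (newton_fun i x) p = ennreal (s powr p)" using s by (simp add: abs_powr_def)
    moreover have "h x = ennreal (s powr 2)"
      using n s by (simp add: h_def inverse_ennreal s_def power_inverse[symmetric] power_mult[symmetric])
    moreover have "s powr 2 \<le> s powr p" using s p by (intro powr_mono) auto
    ultimately show ?thesis by (simp add: ennreal_leI)
  qed (simp add: newton_fun_def abs_powr_def)
  define J where "J = (\<integral>\<^sup>+x\<in>polyball 1. h x \<partial>lborel)"
  have "J \<le> (\<integral>\<^sup>+x\<in>polyball 1. abs_powr (newton_fun i x) p \<partial>lebesgue)"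
    unfolding J_def nn_integral_completion using le by (intro nn_integral_mono) (auto simp: indicator_def)
  then have Jfin: "J < \<infinity>" using fin by (rule le_less_trans)
  have "16 * (\<integral>\<^sup>+x\<in>Q. h x \<partial>lborel) = (\<integral>\<^sup>+x. h (H x) * indicator Q (H x) \<partial>lborel)"
    unfolding H_def by (rule nn_integral_halve_coordinate) measurable
  also have "\<dots> = (\<integral>\<^sup>+x. 16 * (h x * indicator (polyball 1) x) \<partial>lborel)"
  proof (rule nn_integral_cong)
    fix x :: "quat ^ 'n"
    have "h (H x) = 16 * h x"
    proof (cases "x $ i = 0")
      case False
      then have n: "0 < (norm (x $ i)) ^ 4" by simp
      have "h (H x) = inverse (ennreal ((norm (x $ i) / 2) ^ 4))" by (simp add: h_def H_def)
      also have "\<dots> = ennreal (16 * inverse ((norm (x $ i)) ^ 4))"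
      proof -
        have p: "0 < (norm (x $ i) / 2) ^ 4" using False by simp
        have e: "inverse ((norm (x $ i) / 2) ^ 4) = 16 * inverse ((norm (x $ i)) ^ 4)"
          by (simp add: power_divide inverse_eq_divide)
        show ?thesis unfolding inverse_ennreal[OF p] e ..
      qed
      also have "\<dots> = 16 * h x" using n by (simp add: h_def inverse_ennreal ennreal_mult)
      finally show ?thesis .
    qed (simp add: h_def H_def ennreal_mult_top)
    moreover have "H x \<in> Q \<longleftrightarrow> x \<in> polyball 1"
    proof
      assume "H x \<in> Q"
      then have "norm (x $ i) \<le> 1" "\<And>k. k \<noteq> i \<Longrightarrow> norm (x $ k) \<le> 1" by (auto simp: Q H_def)
      then have "norm (x $ k) \<le> 1" for k by (cases "k = i") auto
      then show "x \<in> polyball 1" by (simp add: polyball_def)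
    qed (auto simp: Q H_def polyball_def)
    ultimately show "h (H x) * indicator Q (H x) = 16 * (h x * indicator (polyball 1) x)"
      by (simp add: indicator_def)
  qed
  also have "\<dots> = 16 * J" unfolding J_def by (rule nn_integral_cmult) measurable
  \<comment> \<open>The factor 16 from the change of variables cancels the factor
    \<open>2 ^ 4\<close> of the integrand. Since \<open>J\<close> is assumed finite, nothing is left
    for the difference of the polydisc and its half.\<close>
  finally have JQ: "(\<integral>\<^sup>+x\<in>Q. h x \<partial>lborel) = J"
    by (subst (asm) ennreal_mult_cancel_left) auto
  have "J = (\<integral>\<^sup>+x. h x * indicator Q x + h x * indicator (polyball 1 - Q) x \<partial>lborel)"
    unfolding J_def using QP by (intro nn_integral_cong) (auto simp: indicator_def)
  also have "\<dots> = (\<integral>\<^sup>+x\<in>Q. h x \<partial>lborel) + (\<integral>\<^sup>+x\<in>polyball 1 - Q. h x \<partial>lborel)"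
    by (rule nn_integral_add) measurable
  finally have "J + (\<integral>\<^sup>+x\<in>polyball 1 - Q. h x \<partial>lborel) = J + 0" unfolding JQ by simp
  then have z: "(\<integral>\<^sup>+x\<in>polyball 1 - Q. h x \<partial>lborel) = 0"
    using Jfin by (subst (asm) ennreal_add_left_cancel) auto
  \<comment> \<open>A nonempty open subset of that difference. There the integrand is at least 1, so
    the integral cannot vanish.\<close>
  define W where "W = {x :: quat ^ 'n. 1/2 < norm (x $ i)} \<inter> (\<Inter>k. {x. norm (x $ k) < 1})"
  have "open W" unfolding W_def by (intro open_Int open_INT ballI open_Collect_less continuous_intros) auto
  obtain y0 :: quat where y0: "norm y0 = 3/4" using vector_choose_size[of "3/4"] by auto
  define z0 :: "quat ^ 'n" where "z0 = (\<chi> k. y0)"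
  have "z0 \<in> W" using y0 by (simp add: W_def z0_def)
  then obtain e where e: "e > 0" "ball z0 e \<subseteq> W" using \<open>open W\<close> open_contains_ball by blast
  have "emeasure lborel (ball z0 e) = (\<integral>\<^sup>+x. indicator (ball z0 e) x \<partial>lborel)" by simp
  also have "\<dots> \<le> (\<integral>\<^sup>+x\<in>polyball 1 - Q. h x \<partial>lborel)"
  proof (rule nn_integral_mono)
    fix x :: "quat ^ 'n"
    have "1 \<le> h x \<and> x \<in> polyball 1 - Q" if "x \<in> ball z0 e"
    proof -
      have x: "1/2 < norm (x $ i)" "\<And>k. norm (x $ k) < 1" using that e(2) by (auto simp: W_def)
      then have "0 < (norm (x $ i)) ^ 4" "(norm (x $ i)) ^ 4 \<le> 1"
        using x(1) less_imp_le[OF x(2)[of i]] by (auto intro!: power_le_one)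
      then have "1 \<le> inverse ((norm (x $ i)) ^ 4)" by (simp add: one_le_inverse)
      then have "1 \<le> h x" using \<open>0 < (norm (x $ i)) ^ 4\<close> unfolding h_def by (subst inverse_ennreal) (auto simp: ennreal_leI simp flip: ennreal_1)
      then show ?thesis using x by (auto simp: Q polyball_def less_imp_le)
    qed
    then show "indicator (ball z0 e) x \<le> h x * indicator (polyball 1 - Q) x"
      by (auto simp: indicator_def)
  qed
  finally show False using z emeasure_lborel_ball_neq_0[OF e(1), of z0] by simp
qed

section \<open>Polydisc means\<close>

lemma borel_measurable_vec_lambda:
  fixes f :: "'n::finite \<Rightarrow> 'b \<Rightarrow> 'a::euclidean_space"
  assumes [measurable]: "\<And>i. f i \<in> borel_measurable M"
  shows "(\<lambda>x. \<chi> i. f i x) \<in> borel_measurable M"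
proof (subst borel_measurable_euclidean_space, rule ballI)
  fix j :: "'a ^ 'n" assume "j \<in> Basis"
  then obtain k b where "j = axis k b" by (auto simp: Basis_vec_def)
  then show "(\<lambda>x. (\<chi> i. f i x) \<bullet> j) \<in> borel_measurable M" by (simp add: inner_axis)
qed

lemma prod_Basis_vec:
  fixes f :: "'a::euclidean_space ^ 'n \<Rightarrow> real"
  shows "(\<Prod>j\<in>Basis. f j) = (\<Prod>i\<in>UNIV. \<Prod>b\<in>Basis. f (axis i b))"
proof -
  have "(\<Prod>j\<in>Basis. f j) = (\<Prod>j\<in>(\<lambda>(i, b). axis i b) ` (UNIV \<times> Basis). f j)"
    by (rule prod.cong) (auto simp: Basis_vec_def)
  also have "\<dots> = (\<Prod>(i, b)\<in>UNIV \<times> Basis. f (axis i b))"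
    by (subst prod.reindex) (auto simp: inj_on_def axis_eq_axis case_prod_unfold)
  finally show ?thesis by (simp add: prod.cartesian_product)
qed

interpretation lborel_product: product_sigma_finite "\<lambda>i. lborel" ..

text \<open>Both measures agree on boxes. The product form permits integration over one quaternionic
  coordinate at a time.\<close>

lemma lborel_vec_eq:
  "(lborel :: ('a::euclidean_space ^ 'n) measure) = distr (\<Pi>\<^sub>M i\<in>UNIV. lborel) borel (\<lambda>\<omega>. \<chi> i. \<omega> i)"
proof (rule lborel_eqI)
  fix l u :: "'a ^ 'n"
  assume lu: "\<And>b. b \<in> Basis \<Longrightarrow> l \<bullet> b \<le> u \<bullet> b"
  have [measurable]: "(\<lambda>\<omega>. \<chi> i. \<omega> i) \<in> borel_measurable (\<Pi>\<^sub>M i\<in>(UNIV::'n set). (lborel :: 'a measure))"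
    by (rule borel_measurable_vec_lambda) measurable
  have le: "l $ i \<bullet> b \<le> u $ i \<bullet> b" if "b \<in> Basis" for i b
    using lu[of "axis i b"] that by (auto simp: Basis_vec_def inner_axis)
  have "emeasure (distr (\<Pi>\<^sub>M i\<in>UNIV. lborel) borel (\<lambda>\<omega>. \<chi> i. \<omega> i)) (box l u) =
      emeasure (\<Pi>\<^sub>M i\<in>UNIV. lborel) (Pi\<^sub>E UNIV (\<lambda>i. box (l $ i) (u $ i)))"
    by (subst emeasure_distr)
      (auto intro!: arg_cong[where f = "emeasure _"] simp: space_PiM mem_box Basis_vec_def inner_axis PiE_iff)
  also have "\<dots> = (\<Prod>i\<in>UNIV. emeasure lborel (box (l $ i) (u $ i)))"
    by (rule lborel_product.emeasure_PiM) auto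
  also have "\<dots> = (\<Prod>i\<in>UNIV. ennreal (\<Prod>b\<in>Basis. (u $ i - l $ i) \<bullet> b))"
    by (intro prod.cong) (auto simp: emeasure_lborel_box_eq le)
  also have "\<dots> = ennreal (\<Prod>i\<in>UNIV. \<Prod>b\<in>Basis. (u $ i - l $ i) \<bullet> b)"
    by (intro prod_ennreal prod_nonneg) (auto simp: inner_diff_left le)
  also have "(\<Prod>i\<in>UNIV. \<Prod>b\<in>Basis. (u $ i - l $ i) \<bullet> b) = (\<Prod>b\<in>Basis. (u - l) \<bullet> b)"
    by (subst prod_Basis_vec) (simp add: inner_axis)
  finally show "emeasure (distr (\<Pi>\<^sub>M i\<in>UNIV. lborel) borel (\<lambda>\<omega>. \<chi> i. \<omega> i)) (box l u) = (\<Prod>b\<in>Basis. (u - l) \<bullet> b)" .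
qed simp

lemma borel_polyball [measurable, simp]: "polyball r \<in> sets borel"
  by (simp add: borel_closed compact_imp_closed)

lemma polyball_iff: "(\<chi> i. \<omega> i) \<in> polyball r \<longleftrightarrow> (\<forall>i. \<omega> i \<in> cball 0 r)"
  by (simp add: polyball_def)

lemma indicator_polyball:
  "indicator (polyball r) (\<chi> i. \<omega> i) = (\<Prod>i\<in>(UNIV::'n::finite set). indicator (cball 0 r) (\<omega> i) :: ennreal)"
proof (cases "\<forall>i. \<omega> i \<in> cball 0 r")
  case False
  then obtain i where "\<omega> i \<notin> cball 0 r" by blast
  then have "(\<Prod>i\<in>(UNIV::'n set). indicator (cball 0 r) (\<omega> i) :: ennreal) = 0"
    by (intro prod_zero bexI[of _ i]) auto
  moreover have "(\<chi> i. \<omega> i) \<notin> polyball r" using False by (simp add: polyball_iff)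
  ultimately show ?thesis by simp
next
  case True
  then show ?thesis by (simp add: indicator_def polyball_iff)
qed

lemma nn_integral_polyball:
  fixes F :: "quat ^ 'n \<Rightarrow> ennreal"
  assumes [measurable]: "F \<in> borel_measurable borel"
  shows "(\<integral>\<^sup>+y\<in>polyball r. F y \<partial>lborel) =
    (\<integral>\<^sup>+\<omega>. F (\<chi> i. \<omega> i) * (\<Prod>i\<in>UNIV. indicator (cball 0 r) (\<omega> i)) \<partial>(\<Pi>\<^sub>M i\<in>UNIV. lborel))"
proof -
  have "(\<lambda>\<omega>. \<chi> i. \<omega> i) \<in> borel_measurable (\<Pi>\<^sub>M i\<in>(UNIV::'n set). (lborel :: quat measure))"
    by (rule borel_measurable_vec_lambda) measurable
  then show ?thesis by (subst lborel_vec_eq, subst nn_integral_distr) (auto simp: indicator_polyball)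
qed

lemma emeasure_polyball:
  "emeasure lborel (polyball r :: (quat ^ 'n) set) = (emeasure lborel (cball (0::quat) r)) ^ CARD('n)"
proof -
  have "emeasure lborel (polyball r :: (quat ^ 'n) set) = (\<integral>\<^sup>+y\<in>(polyball r :: (quat ^ 'n) set). 1 \<partial>lborel)" by simp
  also have "\<dots> = (\<integral>\<^sup>+\<omega>. (\<Prod>i\<in>(UNIV::'n set). indicator (cball (0::quat) r) (\<omega> i)) \<partial>(\<Pi>\<^sub>M i\<in>UNIV. lborel))"
    by (subst nn_integral_polyball) simp_all
  also have "\<dots> = (\<Prod>i\<in>(UNIV::'n set). \<integral>\<^sup>+q. indicator (cball (0::quat) r) q \<partial>lborel)"
    by (rule lborel_product.product_nn_integral_prod) (auto intro: borel_measurable_indicator)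
  finally show ?thesis by simp
qed

lemma qscale_right_axis: "qscale_right (axis i (axis 1 1)) q = axis i q"
proof -
  have "0 \<otimes>\<^sub>q q = 0" using norm_qmult[of 0 q] by simp
  then have "(if k = i then axis 1 1 else 0) \<otimes>\<^sub>q q = (if k = i then q else 0)" for k
    by (simp add: one_qmult)
  then show ?thesis unfolding qscale_right_def axis_def[of i] by simp
qed

text \<open>Applying the mean value inequality in one coordinate line after the other.\<close>

lemma polydisc_mean:
  fixes w :: "quat ^ 'n \<Rightarrow> ennreal"
  assumes [measurable]: "w \<in> borel_measurable borel" and r: "r \<ge> 0"
    and line: "\<And>i y. y \<in> polyball r \<Longrightarrow> y $ i = 0 \<Longrightarrow>
      (\<integral>\<^sup>+q\<in>cball 0 r. w (x + (y + axis i q)) \<partial>lborel) \<le> emeasure lborel (cball (0::quat) r) * w (x + y)"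
  shows "(\<integral>\<^sup>+y\<in>polyball r. w (x + y) \<partial>lborel) \<le> emeasure lborel (polyball r :: (quat ^ 'n) set) * w x"
proof -
  \<comment> \<open>Coordinates outside \<open>S\<close> are set to 0. The induction over
    \<open>S\<close> thus starts from the value at \<open>x\<close> and averages one further
    coordinate in each step.\<close>
  define e where "e S \<omega> = (\<chi> i. if i \<in> S then \<omega> i else 0)" for S and \<omega> :: "'n \<Rightarrow> quat"
  define B where "B = emeasure lborel (cball (0::quat) r)"
  have [measurable]: "cball (0::quat) r \<in> sets borel" by simp
  have e_meas: "e S \<in> borel_measurable (\<Pi>\<^sub>M i\<in>S. lborel)" for S
    unfolding e_def
  proof (rule borel_measurable_vec_lambda)
    fix i show "(\<lambda>\<omega>. if i \<in> S then \<omega> i else 0) \<in> borel_measurable (\<Pi>\<^sub>M i\<in>S. (lborel :: quat measure))"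
      by (cases "i \<in> S") auto
  qed
  have [measurable]: "(\<lambda>\<omega>. \<Prod>i\<in>S. indicator (cball 0 r) (\<omega> i) :: ennreal) \<in> borel_measurable (\<Pi>\<^sub>M i\<in>S. (lborel :: quat measure))" for S :: "'n set"
    by (intro borel_measurable_prod_ennreal borel_measurable_indicator') auto
  have "(\<integral>\<^sup>+\<omega>. w (x + e S \<omega>) * (\<Prod>i\<in>S. indicator (cball 0 r) (\<omega> i)) \<partial>(\<Pi>\<^sub>M i\<in>S. lborel)) \<le> B ^ card S * w x"
    if "finite S" for S
    using that
  proof induction
    case empty
    have "e {} \<omega> = 0" for \<omega> by (simp add: e_def vec_eq_iff)
    then show ?case by (simp add: PiM_empty)
  next
    case (insert i S)
    note [measurable] = e_meas[of "insert i S"] e_meas[of S]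
    have up: "(\<Prod>j\<in>S. indicator (cball 0 r) ((fun_upd \<omega> i q) j) :: ennreal) = (\<Prod>j\<in>S. indicator (cball 0 r) (\<omega> j))" for \<omega> q
      using insert(2) by (intro prod.cong) auto
    have eu: "e (insert i S) (fun_upd \<omega> i q) = e S \<omega> + axis i q" for \<omega> q
      using insert(2) by (auto simp: e_def vec_eq_iff axis_def)
    have "(\<integral>\<^sup>+\<omega>. w (x + e (insert i S) \<omega>) * (\<Prod>i\<in>insert i S. indicator (cball 0 r) (\<omega> i)) \<partial>(\<Pi>\<^sub>M i\<in>insert i S. lborel)) =
      (\<integral>\<^sup>+\<omega>. (\<integral>\<^sup>+q. w (x + e (insert i S) (fun_upd \<omega> i q)) * (\<Prod>j\<in>insert i S. indicator (cball 0 r) ((fun_upd \<omega> i q) j)) \<partial>lborel) \<partial>(\<Pi>\<^sub>M i\<in>S. lborel))"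
      using insert by (intro lborel_product.product_nn_integral_insert) measurable
    also have "\<dots> \<le> (\<integral>\<^sup>+\<omega>. B * (w (x + e S \<omega>) * (\<Prod>j\<in>S. indicator (cball 0 r) (\<omega> j))) \<partial>(\<Pi>\<^sub>M i\<in>S. lborel))"
    proof (rule nn_integral_mono)
      fix \<omega> :: "'n \<Rightarrow> quat"
      let ?P = "\<Prod>j\<in>S. indicator (cball 0 r) (\<omega> j) :: ennreal"
      have "(\<integral>\<^sup>+q. w (x + e (insert i S) (fun_upd \<omega> i q)) * (\<Prod>j\<in>insert i S. indicator (cball 0 r) ((fun_upd \<omega> i q) j)) \<partial>lborel) =
        (\<integral>\<^sup>+q. ?P * (w (x + (e S \<omega> + axis i q)) * indicator (cball 0 r) q) \<partial>lborel)"
        using insert(1,2) by (intro nn_integral_cong) (simp add: up eu mult_ac del: fun_upd_apply, simp add: mult_ac)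
      also have "\<dots> = ?P * (\<integral>\<^sup>+q\<in>cball 0 r. w (x + (e S \<omega> + axis i q)) \<partial>lborel)"
      proof (rule nn_integral_cmult)
        have eq: "(axis i :: quat \<Rightarrow> quat ^ 'n) = (\<lambda>q. \<chi> k. if k = i then q else 0)"
          by (auto simp: axis_def fun_eq_iff)
        have [measurable]: "(axis i :: quat \<Rightarrow> quat ^ 'n) \<in> borel_measurable borel"
          unfolding eq by (rule borel_measurable_vec_lambda) auto
        show "(\<lambda>q. w (x + (e S \<omega> + axis i q)) * indicator (cball 0 r) q) \<in> borel_measurable lborel"
          by measurable
      qed
      also have "\<dots> \<le> ?P * (B * w (x + e S \<omega>))"
      \<comment> \<open>The hypothesis on lines is available only at points of the polydisc;
        elsewhere the product of indicators is 0.\<close>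
      proof (cases "\<forall>j\<in>S. \<omega> j \<in> cball 0 r")
        case True
        then have "e S \<omega> \<in> polyball r" "e S \<omega> $ i = 0" using r insert(2) by (auto simp: e_def polyball_def)
        from line[OF this] show ?thesis unfolding B_def by (rule mult_left_mono) simp
      next
        case False
        then obtain j where "j \<in> S" "\<omega> j \<notin> cball 0 r" by blast
        then have "?P = 0" using insert(1) by (intro prod_zero bexI[of _ j]) auto
        then show ?thesis by (simp only: mult_zero_left order_refl)
      qed
      finally show "(\<integral>\<^sup>+q. w (x + e (insert i S) (fun_upd \<omega> i q)) * (\<Prod>j\<in>insert i S. indicator (cball 0 r) ((fun_upd \<omega> i q) j)) \<partial>lborel) \<le>
        B * (w (x + e S \<omega>) * ?P)" by (simp add: mult_ac)
    qed
    also have "\<dots> = B * (\<integral>\<^sup>+\<omega>. w (x + e S \<omega>) * (\<Prod>j\<in>S. indicator (cball 0 r) (\<omega> j)) \<partial>(\<Pi>\<^sub>M i\<in>S. lborel))"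
      by (rule nn_integral_cmult) measurable
    also have "\<dots> \<le> B * (B ^ card S * w x)" by (rule mult_left_mono[OF insert(3)]) simp
    finally show ?case using insert(1,2) by (simp add: mult.assoc)
  qed
  from this[of UNIV] show ?thesis
    by (subst nn_integral_polyball) (simp_all add: e_def emeasure_polyball B_def)
qed

lemma qpsh_polydisc_mean:
  fixes u :: "quat ^ 'n \<Rightarrow> ereal"
  assumes \<Omega>: "open \<Omega>" and u: "u \<in> QPSH \<Omega>" and r: "r > 0"
    and sub: "\<And>y. y \<in> polyball r \<Longrightarrow> x + y \<in> \<Omega>" and M: "\<And>y. y \<in> polyball r \<Longrightarrow> u (x + y) \<le> ereal M"
  shows "(\<integral>\<^sup>+y\<in>polyball r. e2ennreal (ereal M - u (x + y)) \<partial>lborel) \<le>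
    emeasure lborel (polyball r :: (quat ^ 'n) set) * e2ennreal (ereal M - u x)"
proof -
  define u' where "u' z = (if z \<in> \<Omega> then u z else 0)" for z
  have [measurable]: "u' \<in> borel_measurable borel"
    using usc_on_borel_measurable[OF \<Omega> QPSH_D(2)[OF u]] by (simp add: u'_def[abs_def])
  define w where "w z = e2ennreal (ereal M - u' z)" for z
  have [measurable]: "w \<in> borel_measurable borel" unfolding w_def by measurable
  have w: "w (x + y) = e2ennreal (ereal M - u (x + y))" if "y \<in> polyball r" for y
    using sub[OF that] by (simp add: w_def u'_def)
  have 0: "0 \<in> polyball r" using r by (simp add: polyball_def)
  have "(\<integral>\<^sup>+y\<in>polyball r. w (x + y) \<partial>lborel) \<le> emeasure lborel (polyball r :: (quat ^ 'n) set) * w x"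
  proof (rule polydisc_mean)
    fix i :: 'n and y :: "quat ^ 'n" assume y: "y \<in> polyball r" "y $ i = 0"
    have in_P: "y + axis i q \<in> polyball r" if "q \<in> cball 0 r" for q
      using y that by (auto simp: polyball_def axis_def)
    have "(\<integral>\<^sup>+q\<in>cball 0 r. w (x + (y + axis i q)) \<partial>lborel) =
      (\<integral>\<^sup>+q\<in>cball 0 r. e2ennreal (ereal M - u ((x + y) + qscale_right (axis i (axis 1 1)) q)) \<partial>lborel)"
      using w in_P by (intro nn_integral_cong) (auto simp: indicator_def qscale_right_axis add.assoc)
    also have "\<dots> \<le> emeasure lborel (cball (0::quat) r) * e2ennreal (ereal M - u ((x + y) + qscale_right (axis i (axis 1 1)) 0))"
      using sub M in_P by (intro qpsh_line_mean[OF u r]) (auto simp: qscale_right_axis add.assoc)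
    finally show "(\<integral>\<^sup>+q\<in>cball 0 r. w (x + (y + axis i q)) \<partial>lborel) \<le> emeasure lborel (cball (0::quat) r) * w (x + y)"
      using w[OF y(1)] by simp
  qed (use r in auto)
  moreover have "(\<integral>\<^sup>+y\<in>polyball r. w (x + y) \<partial>lborel) = (\<integral>\<^sup>+y\<in>polyball r. e2ennreal (ereal M - u (x + y)) \<partial>lborel)"
    using w by (intro nn_integral_cong) (auto simp: indicator_def)
  ultimately show ?thesis using w[OF 0] by simp
qed

section \<open>Thickened compact sets and averages of locally integrable functions\<close>

lemma convex_polyball: "convex (polyball r :: (quat ^ 'n) set)"
proof -
  have "(polyball r :: (quat ^ 'n) set) = (\<Inter>i. (\<lambda>y. y $ i) -` cball 0 r)" by (auto simp: polyball_def)
  moreover have "convex ((\<lambda>y :: quat ^ 'n. y $ i) -` cball 0 r)" for i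
    by (rule convex_linear_vimage) (auto intro: linearI)
  ultimately show ?thesis by (auto intro: convex_INT)
qed

lemma polyball_mono: "r \<le> s \<Longrightarrow> polyball r \<subseteq> polyball s"
  by (auto simp: polyball_def intro: order_trans)

lemma polyball_subset_cball: "r \<ge> 0 \<Longrightarrow> (polyball r :: (quat ^ 'n) set) \<subseteq> cball 0 (real CARD('n) * r)"
proof
  fix y :: "quat ^ 'n" assume "y \<in> polyball r"
  then have "(\<Sum>i\<in>UNIV. norm (y $ i)) \<le> (\<Sum>i\<in>(UNIV::'n set). r)" by (intro sum_mono) (auto simp: polyball_def)
  then show "y \<in> cball 0 (real CARD('n) * r)" using norm_le_sum_components[of y] by simp
qed

lemma measure_polyball:
  assumes "r > 0"
  shows "measure lborel (polyball r :: (quat ^ 'n) set) > 0"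
    "emeasure lborel (polyball r :: (quat ^ 'n) set) = ennreal (measure lborel (polyball r :: (quat ^ 'n) set))"
proof -
  have fin: "emeasure lborel (polyball r :: (quat ^ 'n) set) < \<infinity>"
    by (rule emeasure_bounded_finite[OF compact_imp_bounded[OF compact_polyball]])
  then show e: "emeasure lborel (polyball r :: (quat ^ 'n) set) = ennreal (measure lborel (polyball r :: (quat ^ 'n) set))"
    by (intro emeasure_eq_ennreal_measure) auto
  have "emeasure lborel (polyball r :: (quat ^ 'n) set) \<noteq> 0"
    unfolding emeasure_polyball using emeasure_lborel_cball_pos[OF assms, of "0::quat"] by simp
  then show "measure lborel (polyball r :: (quat ^ 'n) set) > 0"
    using e by (metis ennreal_0 measure_nonneg order_less_le)
qed

text \<open>Minkowski sum with a polydisc: the points that enter the means of radius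
  \<open>r\<close> at points of \<open>Z\<close>.\<close>

definition thicken :: "(quat ^ 'n) set \<Rightarrow> real \<Rightarrow> (quat ^ 'n) set" where
  "thicken Z r = {z + y |z y. z \<in> Z \<and> y \<in> polyball r}"

lemma compact_thicken: "compact Z \<Longrightarrow> compact (thicken Z r)"
  unfolding thicken_def by (rule compact_sums) simp_all

lemma thickenI: "z \<in> Z \<Longrightarrow> y \<in> polyball r \<Longrightarrow> z + y \<in> thicken Z r"
  by (auto simp: thicken_def)

lemma thicken_subset:
  fixes Z :: "(quat ^ 'n) set"
  assumes "compact Z" "open \<Omega>" "Z \<subseteq> \<Omega>"
  obtains r where "r > 0" "thicken Z r \<subseteq> \<Omega>"
proof -
  obtain d where d: "d > 0" "\<And>x y. x \<in> Z \<Longrightarrow> y \<in> - \<Omega> \<Longrightarrow> d \<le> dist x y"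
  proof -
    have "closed (- \<Omega>)" "Z \<inter> - \<Omega> = {}" using assms by auto
    from separate_compact_closed[OF assms(1) this] show thesis using that by blast
  qed
  define r where "r = d / (2 * real CARD('n))"
  have r: "r > 0" using d by (simp add: r_def)
  have "thicken Z r \<subseteq> \<Omega>"
  proof (rule ccontr)
    assume "\<not> thicken Z r \<subseteq> \<Omega>"
    then obtain z y where zy: "z \<in> Z" "y \<in> polyball r" "z + y \<notin> \<Omega>" by (auto simp: thicken_def)
    then have "d \<le> norm y" using d(2)[of z "z + y"] by (simp add: dist_norm)
    moreover have "norm y \<le> d / 2" using polyball_subset_cball[of r] zy(2) r by (auto simp: r_def)
    ultimately show False using d(1) by simp
  qed
  then show thesis using that r by blast
qed

lemma AE_lborel_translate:
  fixes x :: "'a::euclidean_space"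
  assumes "AE z in lborel. P z"
  shows "AE y in lborel. P (x + y)"
proof -
  obtain N where N: "N \<in> null_sets lborel" "{z. \<not> P z} \<subseteq> N"
    using assms by (auto elim!: AE_E simp: null_sets_def)
  have Nb: "N \<in> sets borel" "emeasure lborel N = 0" using N(1) by (auto simp: null_sets_def)
  have "(\<lambda>y. y + x) -` N \<in> sets borel"
    using measurable_sets[of "\<lambda>y. y + x" borel borel N] Nb(1) by simp
  then have "(\<lambda>y. y + x) -` N \<in> null_sets lborel"
    using emeasure_lborel_translate[OF Nb(1), of x] Nb(2) by (simp add: null_sets_def)
  then show ?thesis by (rule AE_I') (use N(2) in \<open>auto simp: add.commute\<close>)
qed

lemma window_integrable:
  fixes f :: "'a::euclidean_space \<Rightarrow> real"
  assumes [measurable]: "f \<in> borel_measurable borel" "C \<in> sets borel" "K \<in> sets borel"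
    and int: "integrable lborel (\<lambda>z. indicator K z * f z)" and sub: "\<And>y. y \<in> C \<Longrightarrow> x + y \<in> K"
  shows "integrable lborel (\<lambda>y. indicator C y * f (x + y))"
    "\<bar>\<integral>y. indicator C y * f (x + y) \<partial>lborel\<bar> \<le> (\<integral>z. indicator K z * \<bar>f z\<bar> \<partial>lborel)"
    "(\<integral>y. indicator C y * \<bar>f (x + y)\<bar> \<partial>lborel) \<le> (\<integral>z. indicator K z * \<bar>f z\<bar> \<partial>lborel)"
proof -
  let ?h = "\<lambda>z. indicator K z * \<bar>f z\<bar> :: real"
  have "integrable lborel (\<lambda>z. \<bar>indicator K z * f z\<bar>)" using int by (rule integrable_abs)
  then have i: "integrable lborel ?h" by (simp add: abs_mult)
  then have i': "integrable lborel (\<lambda>y. ?h (y + x))" by (subst integral_lborel_translate(2)) auto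
  have le: "indicator C y * \<bar>f (x + y)\<bar> \<le> ?h (y + x)" for y
    using sub[of y] by (auto simp: indicator_def add.commute[of y x])
  show 1: "integrable lborel (\<lambda>y. indicator C y * f (x + y))"
    by (rule Bochner_Integration.integrable_bound[OF i']) (use le in \<open>auto simp: abs_mult\<close>)
  have i2: "integrable lborel (\<lambda>y. indicator C y * \<bar>f (x + y)\<bar>)"
    by (rule Bochner_Integration.integrable_bound[OF i']) (use le in auto)
  have "(\<integral>y. indicator C y * \<bar>f (x + y)\<bar> \<partial>lborel) \<le> (\<integral>y. ?h (y + x) \<partial>lborel)"
    by (rule integral_mono[OF i2 i']) (rule le)
  also have "\<dots> = (\<integral>z. ?h z \<partial>lborel)" by (rule integral_lborel_translate(1)) measurable
  finally show 2: "(\<integral>y. indicator C y * \<bar>f (x + y)\<bar> \<partial>lborel) \<le> (\<integral>z. ?h z \<partial>lborel)" .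
  have "\<bar>\<integral>y. indicator C y * f (x + y) \<partial>lborel\<bar> \<le> (\<integral>y. \<bar>indicator C y * f (x + y)\<bar> \<partial>lborel)"
    by (rule integral_abs_bound)
  also have "\<dots> = (\<integral>y. indicator C y * \<bar>f (x + y)\<bar> \<partial>lborel)" by (simp add: abs_mult)
  finally show "\<bar>\<integral>y. indicator C y * f (x + y) \<partial>lborel\<bar> \<le> (\<integral>z. ?h z \<partial>lborel)" using 2 by simp
qed

text \<open>After a translation \<open>x\<close> occurs only in the indicator of the window.
  Indicators of moving windows converge off the frontier of the limit window, and the frontier of a
  convex set is a null set. So integrability of \<open>f\<close> near the window is enough for
  continuity.\<close>

lemma isCont_window_integral:
  fixes f :: "'a::euclidean_space \<Rightarrow> real"
  assumes [measurable]: "f \<in> borel_measurable borel" and C: "compact C" "convex C" and \<delta>: "\<delta> > 0"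
    and K[measurable]: "K \<in> sets borel" and int: "integrable lborel (\<lambda>z. indicator K z * f z)"
    and sub: "\<And>z y. z \<in> cball x \<delta> \<Longrightarrow> y \<in> C \<Longrightarrow> z + y \<in> K"
  shows "isCont (\<lambda>x. \<integral>y. indicator C y * f (x + y) \<partial>lborel) x"
proof (subst continuous_at_sequentially, intro allI impI)
  fix s :: "nat \<Rightarrow> 'a" assume s: "s \<longlonglongrightarrow> x"
  have closed: "closed C" using C by (simp add: compact_imp_closed)
  then have [measurable]: "C \<in> sets borel" by simp
  define G where "G x = (\<integral>y. indicator C y * f (x + y) \<partial>lborel)" for x
  have G: "G x = (\<integral>z. indicator C (z - x) * f z \<partial>lborel)" for x
    unfolding G_def using integral_lborel_translate(1)[of "\<lambda>z. indicator C (z - x) * f z" x]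
    by (simp add: add.commute)
  \<comment> \<open>Terms far from \<open>x\<close> are replaced by \<open>x\<close>, so that one
    dominating function on \<open>K\<close> serves every index.\<close>
  define s' where "s' n = (if s n \<in> cball x \<delta> then s n else x)" for n
  have ev: "\<forall>\<^sub>F n in sequentially. s' n = s n"
    using s \<delta> by (auto simp: s'_def dist_commute tendsto_iff elim!: allE[of _ \<delta>] eventually_mono)
  then have s'x: "s' \<longlonglongrightarrow> x" using s by (simp add: tendsto_cong)
  have s'ball: "s' n \<in> cball x \<delta>" for n using \<delta> by (simp add: s'_def)
  have "(\<lambda>n. G (s' n)) \<longlonglongrightarrow> G x"
    unfolding G
  proof (rule integral_dominated_convergence[where w = "\<lambda>z. \<bar>indicator K z * f z\<bar>"])
    have "negligible (frontier C)" by (rule negligible_convex_frontier[OF C(2)])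
    then have "AE z in lborel. z \<notin> frontier C"
      by (intro AE_not_in) (simp add: negligible_iff_null_sets null_sets_completion_iff frontier_closed)
    from AE_lborel_translate[OF this, of "- x"]
    show "AE z in lborel. (\<lambda>n. indicator C (z - s' n) * f z) \<longlonglongrightarrow> indicator C (z - x) * f z"
    proof eventually_elim
      case (elim z)
      have lim: "(\<lambda>n. z - s' n) \<longlonglongrightarrow> z - x" by (intro tendsto_intros s'x)
      have "z - x \<in> interior C \<or> z - x \<in> - C" using elim closed by (auto simp: frontier_def closure_closed)
      then have "\<forall>\<^sub>F n in sequentially. indicator C (z - s' n) = (indicator C (z - x) :: real)"
      proof
        assume i: "z - x \<in> interior C"
        then have "\<forall>\<^sub>F n in sequentially. z - s' n \<in> interior C"
          using lim topological_tendstoD open_interior by blast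
        then show ?thesis using i interior_subset[of C] by (auto elim!: eventually_mono simp: indicator_def)
      next
        assume i: "z - x \<in> - C"
        then have "\<forall>\<^sub>F n in sequentially. z - s' n \<in> - C"
          using lim closed topological_tendstoD[of "\<lambda>n. z - s' n" "z - x" sequentially "- C"] by auto
        then show ?thesis using i by (auto elim!: eventually_mono simp: indicator_def)
      qed
      then have "\<forall>\<^sub>F n in sequentially. indicator C (z - x) * f z = indicator C (z - s' n) * f z"
        by eventually_elim simp
      then show ?case by (rule Lim_transform_eventually[OF tendsto_const])
    qed
    show "AE z in lborel. norm (indicator C (z - s' n) * f z) \<le> \<bar>indicator K z * f z\<bar>" for n
    proof (intro AE_I2)
      fix z
      show "norm (indicator C (z - s' n) * f z) \<le> \<bar>indicator K z * f z\<bar>"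
        using sub[OF s'ball, of "z - s' n" n] by (auto simp: indicator_def)
    qed
    show "integrable lborel (\<lambda>z. \<bar>indicator K z * f z\<bar>)" using int by (rule integrable_abs)
  qed measurable
  then have "(\<lambda>n. G (s n)) \<longlonglongrightarrow> G x"
    by (rule Lim_transform_eventually) (use ev in \<open>auto elim!: eventually_mono\<close>)
  then show "((\<lambda>x. \<integral>y. indicator C y * f (x + y) \<partial>lborel) \<circ> s) \<longlonglongrightarrow> (\<integral>y. indicator C y * f (x + y) \<partial>lborel)"
    by (simp add: G_def o_def)
qed

text \<open>Transfer from an extended-valued function to its real representative. The second claim
  gives the sign that keeps \<open>ennreal\<close> from truncating the difference in the
  first.\<close>

lemma nn_integral_ereal_diff_eq:
  fixes g :: "'a \<Rightarrow> ereal" and h :: "'a \<Rightarrow> real"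
  assumes S: "S \<in> sets N" "emeasure N S < \<infinity>" and M: "\<And>y. y \<in> S \<Longrightarrow> g y \<le> ereal M"
    and AE: "AE y in N. y \<in> S \<longrightarrow> g y = ereal (h y)" and int: "integrable N (\<lambda>y. indicator S y * h y)"
  shows "(\<integral>\<^sup>+y\<in>S. e2ennreal (ereal M - g y) \<partial>N) = ennreal (M * measure N S - (\<integral>y. indicator S y * h y \<partial>N))"
    "(\<integral>y. indicator S y * h y \<partial>N) \<le> M * measure N S"
proof -
  have iS: "integrable N (\<lambda>y. indicator S y * M)" using S by (intro integrable_mult_left integrable_real_indicator) auto
  have "integrable N (\<lambda>y. indicator S y * M - indicator S y * h y)"
    using iS int by (rule Bochner_Integration.integrable_diff)
  then have i: "integrable N (\<lambda>y. indicator S y * (M - h y))" by (simp add: right_diff_distrib)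
  have nn: "AE y in N. 0 \<le> indicator S y * (M - h y)"
    using AE
  proof eventually_elim
    case (elim y)
    then show ?case using M[of y] by (auto simp: indicator_def)
  qed
  have I: "(\<integral>y. indicator S y * (M - h y) \<partial>N) = M * measure N S - (\<integral>y. indicator S y * h y \<partial>N)"
  proof -
    have "(\<integral>y. indicator S y * (M - h y) \<partial>N) = (\<integral>y. indicator S y * M - indicator S y * h y \<partial>N)"
      by (simp add: right_diff_distrib)
    also have "\<dots> = (\<integral>y. indicator S y * M \<partial>N) - (\<integral>y. indicator S y * h y \<partial>N)"
      by (rule Bochner_Integration.integral_diff[OF iS int])
    finally show ?thesis using S sets.sets_into_space[OF S(1)] by (simp add: Int_absorb2 mult.commute)
  qed
  have "(\<integral>\<^sup>+y\<in>S. e2ennreal (ereal M - g y) \<partial>N) = (\<integral>\<^sup>+y. ennreal (indicator S y * (M - h y)) \<partial>N)"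
    by (rule nn_integral_cong_AE) (use AE in \<open>auto elim!: eventually_mono simp: indicator_def\<close>)
  also have "\<dots> = ennreal (\<integral>y. indicator S y * (M - h y) \<partial>N)" by (rule nn_integral_eq_integral[OF i nn])
  finally show "(\<integral>\<^sup>+y\<in>S. e2ennreal (ereal M - g y) \<partial>N) = ennreal (M * measure N S - (\<integral>y. indicator S y * h y \<partial>N))"
    by (simp add: I)
  show "(\<integral>y. indicator S y * h y \<partial>N) \<le> M * measure N S"
    using integral_nonneg_AE[OF nn] I by simp
qed

text \<open>The polydisc average of the overview, taken of a real-valued representative so that
  signed integrals are available.\<close>

definition pavg :: "real \<Rightarrow> (quat ^ 'n \<Rightarrow> real) \<Rightarrow> quat ^ 'n \<Rightarrow> real" where
  "pavg r f x = (\<integral>y. indicator (polyball r) y * f (x + y) \<partial>lborel) / measure lborel (polyball r :: (quat ^ 'n) set)"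

lemma borel_measurable_pavg [measurable]:
  assumes [measurable]: "f \<in> borel_measurable borel"
  shows "pavg r f \<in> borel_measurable borel"
proof -
  have "(\<lambda>x. \<integral>y. indicator (polyball r) y * f (x + y) \<partial>lborel) \<in> borel_measurable borel"
    by (rule lborel.borel_measurable_lebesgue_integral) measurable
  then show ?thesis unfolding pavg_def by measurable
qed

definition loc_integrable :: "(quat ^ 'n) set \<Rightarrow> (quat ^ 'n \<Rightarrow> real) \<Rightarrow> bool" where
  "loc_integrable \<Omega> f \<longleftrightarrow> f \<in> borel_measurable borel \<and>
    (\<forall>K. compact K \<and> K \<subseteq> \<Omega> \<longrightarrow> integrable lborel (\<lambda>z. indicator K z * f z))"

definition polyball_in :: "(quat ^ 'n) set \<Rightarrow> real \<Rightarrow> quat ^ 'n \<Rightarrow> bool" where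
  "polyball_in \<Omega> r x \<longleftrightarrow> (\<forall>y\<in>polyball r. x + y \<in> \<Omega>)"

lemma polyball_in_thicken: "thicken Z r \<subseteq> \<Omega> \<Longrightarrow> z \<in> Z \<Longrightarrow> polyball_in \<Omega> r z"
  by (auto simp: polyball_in_def thicken_def)

lemma polyball_in_mono: "polyball_in \<Omega> r x \<Longrightarrow> s \<le> r \<Longrightarrow> polyball_in \<Omega> s x"
  using polyball_mono by (fastforce simp: polyball_in_def)

lemma cball_subset_polyball: "cball 0 r \<subseteq> polyball r"
proof
  fix y :: "quat ^ 'n" assume "y \<in> cball 0 r"
  then show "y \<in> polyball r" using Finite_Cartesian_Product.norm_nth_le[of y] by (auto simp: polyball_def intro: order_trans)
qed

lemma polyball_in_neighbourhood:
  assumes \<Omega>: "open \<Omega>" and x: "polyball_in \<Omega> r x"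
  obtains \<delta> K where "\<delta> > 0" "compact K" "K \<subseteq> \<Omega>" "\<And>z y. z \<in> cball x \<delta> \<Longrightarrow> y \<in> polyball r \<Longrightarrow> z + y \<in> K"
proof -
  have "thicken {x} r \<subseteq> \<Omega>" using x by (auto simp: thicken_def polyball_in_def)
  moreover have c: "compact (thicken {x} r)" by (rule compact_thicken) simp
  ultimately obtain s where s: "s > 0" "thicken (thicken {x} r) s \<subseteq> \<Omega>"
    using \<Omega> thicken_subset by blast
  have "z + y \<in> thicken (thicken {x} r) s" if "z \<in> cball x s" "y \<in> polyball r" for z y
  proof -
    have "z - x \<in> polyball s" using that(1) cball_subset_polyball[of s] by (auto simp: dist_norm norm_minus_commute)
    moreover have "x + y \<in> thicken {x} r" using that(2) by (auto simp: thicken_def)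
    ultimately have "(x + y) + (z - x) \<in> thicken (thicken {x} r) s" by (rule thickenI[rotated])
    then show ?thesis by (simp add: add.commute)
  qed
  then show thesis using that s compact_thicken[OF c] by blast
qed

lemma isCont_pavg:
  assumes "open \<Omega>" "loc_integrable \<Omega> f" "polyball_in \<Omega> r x"
  shows "isCont (pavg r f) x"
proof -
  obtain \<delta> K where K: "\<delta> > 0" "compact K" "K \<subseteq> \<Omega>" "\<And>z y. z \<in> cball x \<delta> \<Longrightarrow> y \<in> polyball r \<Longrightarrow> z + y \<in> K"
    by (rule polyball_in_neighbourhood[OF assms(1,3)]) blast
  have "isCont (\<lambda>x. \<integral>y. indicator (polyball r) y * f (x + y) \<partial>lborel) x"
    by (rule isCont_window_integral[of _ _ \<delta> K])
      (use assms(2) K in \<open>auto simp: loc_integrable_def convex_polyball compact_imp_closed\<close>)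
  then show ?thesis unfolding pavg_def[abs_def] divide_inverse by (intro continuous_intros)
qed

text \<open>The functions \<open>U j\<close> carry the pointwise mean value inequalities and may be
  \<open>-\<infinity>\<close> at points; the Borel functions \<open>F j\<close> represent them in
  integrals. Of \<open>f\<close> only the convergence in L^1 on compact sets is known, and its
  relation to a plurisubharmonic function is to be proved.\<close>

locale qpsh_limit =
  fixes \<Omega> :: "(quat ^ 'n) set" and U :: "nat \<Rightarrow> quat ^ 'n \<Rightarrow> ereal"
    and F :: "nat \<Rightarrow> quat ^ 'n \<Rightarrow> real" and f :: "quat ^ 'n \<Rightarrow> real"
  assumes \<Omega>: "open \<Omega>" and U: "\<And>j. U j \<in> QPSH \<Omega>"
    and UF: "\<And>j. AE x in lborel. x \<in> \<Omega> \<longrightarrow> U j x = ereal (F j x)"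
    and F: "\<And>j. loc_integrable \<Omega> (F j)" and f: "loc_integrable \<Omega> f"
    and lim: "\<And>K. compact K \<Longrightarrow> K \<subseteq> \<Omega> \<Longrightarrow> (\<lambda>j. \<integral>z. indicator K z * \<bar>F j z - f z\<bar> \<partial>lborel) \<longlonglongrightarrow> 0"
begin

lemma F_meas [measurable]: "F j \<in> borel_measurable borel" and f_meas [measurable]: "f \<in> borel_measurable borel"
  using F f by (auto simp: loc_integrable_def)

lemma integrable_K:
  assumes "compact K" "K \<subseteq> \<Omega>"
  shows "integrable lborel (\<lambda>z. indicator K z * F j z)" "integrable lborel (\<lambda>z. indicator K z * f z)"
    "integrable lborel (\<lambda>z. indicator K z * (F j z - f z))"
proof -
  show 1: "integrable lborel (\<lambda>z. indicator K z * F j z)" "integrable lborel (\<lambda>z. indicator K z * f z)"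
    using F f assms by (auto simp: loc_integrable_def)
  from Bochner_Integration.integrable_diff[OF this]
  show "integrable lborel (\<lambda>z. indicator K z * (F j z - f z))" by (simp add: right_diff_distrib)
qed

lemma polyball_in_compact:
  assumes "polyball_in \<Omega> r x"
  shows "compact (thicken {x} r)" "thicken {x} r \<subseteq> \<Omega>" "\<And>y. y \<in> polyball r \<Longrightarrow> x + y \<in> thicken {x} r"
  using assms compact_thicken[of "{x}" r] by (auto simp: thicken_def polyball_in_def)

lemma AE_translate: "AE y in lborel. y \<in> polyball r \<longrightarrow> polyball_in \<Omega> r x \<longrightarrow> U j (x + y) = ereal (F j (x + y))"
  using AE_lborel_translate[OF UF, of x j] by eventually_elim (auto simp: polyball_in_def)

lemma window_F:
  assumes "polyball_in \<Omega> r x"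
  shows "integrable lborel (\<lambda>y. indicator (polyball r) y * F j (x + y))"
    "integrable lborel (\<lambda>y. indicator (polyball r) y * f (x + y))"
  using polyball_in_compact[OF assms]
  by (auto intro!: window_integrable(1)[where K = "thicken {x} r"] integrable_K borel_closed compact_imp_closed)

lemma nn_integral_window:
  assumes r: "r > 0" and x: "polyball_in \<Omega> r x" and M: "\<And>y. y \<in> polyball r \<Longrightarrow> U j (x + y) \<le> ereal M"
  shows "(\<integral>\<^sup>+y\<in>polyball r. e2ennreal (ereal M - U j (x + y)) \<partial>lborel) =
      ennreal (measure lborel (polyball r :: (quat ^ 'n) set)) * ennreal (M - pavg r (F j) x)"
    "pavg r (F j) x \<le> M"
proof -
  let ?V = "measure lborel (polyball r :: (quat ^ 'n) set)"
  note V = measure_polyball[OF r, where 'n = 'n]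
  have fin: "emeasure lborel (polyball r :: (quat ^ 'n) set) < \<infinity>" unfolding V(2) by simp
  have AE: "AE y in lborel. y \<in> polyball r \<longrightarrow> U j (x + y) = ereal (F j (x + y))"
    using AE_translate[where r = r and x = x and j = j] x by (auto elim!: eventually_mono)
  have I: "(\<integral>y. indicator (polyball r) y * F j (x + y) \<partial>lborel) = ?V * pavg r (F j) x"
    using V(1) by (simp add: pavg_def)
  note * = nn_integral_ereal_diff_eq[of "polyball r" lborel "\<lambda>y. U j (x + y)" M "\<lambda>y. F j (x + y)", OF _ fin M AE window_F(1)[OF x]]
  show 1: "pavg r (F j) x \<le> M" using *(2) V(1) unfolding I by (simp add: mult.commute)
  show "(\<integral>\<^sup>+y\<in>polyball r. e2ennreal (ereal M - U j (x + y)) \<partial>lborel) = ennreal ?V * ennreal (M - pavg r (F j) x)"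
    using *(1) V(1) 1 unfolding I by (simp add: ennreal_mult[symmetric] right_diff_distrib mult.commute)
qed

lemma bounded_above_compact:
  assumes "compact K" "K \<subseteq> \<Omega>"
  obtains M where "M \<ge> 0" "\<And>z. z \<in> K \<Longrightarrow> U j z \<le> ereal M"
  using usc_on_locally_bounded_above[OF \<Omega> QPSH_D(2)[OF U] QPSH_D(1)[OF U] assms] by blast

lemma U_le_pavg:
  assumes r: "r > 0" and x: "polyball_in \<Omega> r x"
  shows "U j x \<le> ereal (pavg r (F j) x)"
proof -
  obtain M where M: "\<And>z. z \<in> thicken {x} r \<Longrightarrow> U j z \<le> ereal M"
    by (rule bounded_above_compact[OF polyball_in_compact(1,2)[OF x]]) blast
  then have M': "\<And>y. y \<in> polyball r \<Longrightarrow> U j (x + y) \<le> ereal M" using polyball_in_compact(3)[OF x] by blast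
  note V = measure_polyball[OF r, where 'n = 'n]
  have "ennreal (measure lborel (polyball r :: (quat ^ 'n) set)) * ennreal (M - pavg r (F j) x) \<le>
    ennreal (measure lborel (polyball r :: (quat ^ 'n) set)) * e2ennreal (ereal M - U j x)"
    using qpsh_polydisc_mean[OF \<Omega> U r _ M'] x nn_integral_window(1)[OF r x M']
    by (simp add: polyball_in_def V(2)[symmetric])
  then have le: "ennreal (M - pavg r (F j) x) \<le> e2ennreal (ereal M - U j x)"
    using V(1) by (simp add: ennreal_mult_le_mult_iff)
  show ?thesis
  proof (cases "U j x")
    case (real u)
    have "u \<le> M" using M'[of 0] real r by (simp add: polyball_def)
    then show ?thesis using le real by (simp add: ennreal_le_iff)
  next
    case PInf
    then show ?thesis using M'[of 0] r by (simp add: polyball_def)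
  qed simp
qed

text \<open>The bounds depend on \<open>x\<close> only through \<open>K\<close>, so they hold
  uniformly for all \<open>x\<close> whose window lies in \<open>K\<close>.\<close>

lemma pavg_diff_le:
  assumes r: "r > 0" and K: "compact K" "K \<subseteq> \<Omega>" "\<And>y. y \<in> polyball r \<Longrightarrow> x + y \<in> K"
  shows "\<bar>pavg r (F j) x - pavg r f x\<bar> \<le>
    (\<integral>z. indicator K z * \<bar>F j z - f z\<bar> \<partial>lborel) / measure lborel (polyball r :: (quat ^ 'n) set)"
    "\<bar>pavg r (F j) x\<bar> \<le> (\<integral>z. indicator K z * \<bar>F j z\<bar> \<partial>lborel) / measure lborel (polyball r :: (quat ^ 'n) set)"
proof -
  let ?V = "measure lborel (polyball r :: (quat ^ 'n) set)"
  have V: "?V > 0" by (rule measure_polyball(1)[OF r])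
  have [measurable]: "K \<in> sets borel" using K(1) by (simp add: compact_imp_closed)
  have x: "polyball_in \<Omega> r x" using K by (auto simp: polyball_in_def)
  have "pavg r (F j) x - pavg r f x = (\<integral>y. indicator (polyball r) y * (F j (x + y) - f (x + y)) \<partial>lborel) / ?V"
    using window_F(1)[OF x, of j] window_F(2)[OF x] by (simp add: pavg_def diff_divide_distrib right_diff_distrib)
  moreover have "\<bar>\<integral>y. indicator (polyball r) y * (F j (x + y) - f (x + y)) \<partial>lborel\<bar> \<le> (\<integral>z. indicator K z * \<bar>F j z - f z\<bar> \<partial>lborel)"
    by (rule window_integrable(2)[OF _ _ _ integrable_K(3)[OF K(1,2)] K(3)]) measurable
  ultimately show "\<bar>pavg r (F j) x - pavg r f x\<bar> \<le> (\<integral>z. indicator K z * \<bar>F j z - f z\<bar> \<partial>lborel) / ?V"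
    using V by (simp add: divide_right_mono)
  have "\<bar>\<integral>y. indicator (polyball r) y * F j (x + y) \<partial>lborel\<bar> \<le> (\<integral>z. indicator K z * \<bar>F j z\<bar> \<partial>lborel)"
    by (rule window_integrable(2)[OF _ _ _ integrable_K(1)[OF K(1,2)] K(3)]) measurable
  then show "\<bar>pavg r (F j) x\<bar> \<le> (\<integral>z. indicator K z * \<bar>F j z\<bar> \<partial>lborel) / ?V"
    using V by (simp add: pavg_def divide_right_mono)
qed

lemma pavg_tendsto:
  assumes r: "r > 0" and x: "polyball_in \<Omega> r x"
  shows "(\<lambda>j. pavg r (F j) x) \<longlonglongrightarrow> pavg r f x"
proof (rule LIM_zero_cancel, rule tendsto_rabs_zero_cancel, rule tendsto_sandwich[OF _ _ tendsto_const])
  let ?V = "measure lborel (polyball r :: (quat ^ 'n) set)" and ?K = "thicken {x} r"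
  show "(\<lambda>j. (\<integral>z. indicator ?K z * \<bar>F j z - f z\<bar> \<partial>lborel) / ?V) \<longlonglongrightarrow> 0"
    using tendsto_divide[OF lim[OF polyball_in_compact(1,2)[OF x]] tendsto_const[of ?V]] measure_polyball(1)[OF r, where 'n = 'n] by simp
  show "\<forall>\<^sub>F j in sequentially. \<bar>pavg r (F j) x - pavg r f x\<bar> \<le> (\<integral>z. indicator ?K z * \<bar>F j z - f z\<bar> \<partial>lborel) / ?V"
    using pavg_diff_le(1)[OF r polyball_in_compact[OF x]] by simp
qed simp

lemma bounded_L1:
  assumes K: "compact K" "K \<subseteq> \<Omega>"
  obtains B where "B \<ge> 0" "\<And>j. (\<integral>z. indicator K z * \<bar>F j z\<bar> \<partial>lborel) \<le> B"
proof -
  have "Bseq (\<lambda>j. \<integral>z. indicator K z * \<bar>F j z - f z\<bar> \<partial>lborel)"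
    using lim[OF K] by (intro convergent_imp_Bseq convergentI)
  then obtain D where D: "D > 0" "\<And>j. norm (\<integral>z. indicator K z * \<bar>F j z - f z\<bar> \<partial>lborel) \<le> D"
    by (auto simp: Bseq_def)
  have i: "integrable lborel (\<lambda>z. indicator K z * \<bar>F j z - f z\<bar>)" "integrable lborel (\<lambda>z. indicator K z * \<bar>f z\<bar>)"
    "integrable lborel (\<lambda>z. indicator K z * \<bar>F j z\<bar>)" for j
    using integrable_abs[OF integrable_K(3)[OF K, of j]] integrable_abs[OF integrable_K(2)[OF K]] integrable_abs[OF integrable_K(1)[OF K, of j]]
    by (simp_all add: abs_mult)
  have "(\<integral>z. indicator K z * \<bar>F j z\<bar> \<partial>lborel) \<le> D + (\<integral>z. indicator K z * \<bar>f z\<bar> \<partial>lborel)" for j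
  proof -
    have "(\<integral>z. indicator K z * \<bar>F j z\<bar> \<partial>lborel) \<le> (\<integral>z. indicator K z * \<bar>F j z - f z\<bar> + indicator K z * \<bar>f z\<bar> \<partial>lborel)"
      using i by (intro integral_mono Bochner_Integration.integrable_add) (auto simp: indicator_def)
    also have "\<dots> = (\<integral>z. indicator K z * \<bar>F j z - f z\<bar> \<partial>lborel) + (\<integral>z. indicator K z * \<bar>f z\<bar> \<partial>lborel)"
      using i by simp
    finally show ?thesis using D(2)[of j] by simp
  qed
  moreover have "0 \<le> (\<integral>z. indicator K z * \<bar>f z\<bar> \<partial>lborel)" by (intro Bochner_Integration.integral_nonneg) auto
  ultimately show thesis using D(1)
    by (intro that[of "D + (\<integral>z. indicator K z * \<bar>f z\<bar> \<partial>lborel)"]) (linarith, blast)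
qed

text \<open>\<open>U j\<close> is dominated by its means, these by L^1 norms on a thickened compact
  set, and those norms are bounded because they belong to a convergent sequence.\<close>

lemma uniformly_bounded_above:
  assumes K: "compact K" "K \<subseteq> \<Omega>"
  obtains M where "M \<ge> 0" "\<And>j z. z \<in> K \<Longrightarrow> U j z \<le> ereal M"
proof -
  obtain r where r: "r > 0" "thicken K r \<subseteq> \<Omega>" by (rule thicken_subset[OF K(1) \<Omega> K(2)])
  let ?V = "measure lborel (polyball r :: (quat ^ 'n) set)"
  have V: "?V > 0" by (rule measure_polyball(1)[OF r(1)])
  obtain B where B: "B \<ge> 0" "\<And>j. (\<integral>z. indicator (thicken K r) z * \<bar>F j z\<bar> \<partial>lborel) \<le> B"
    using bounded_L1[OF compact_thicken[OF K(1)] r(2)] by blast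
  show thesis
  proof
    show "0 \<le> B / ?V" using B V by simp
    fix j z assume z: "z \<in> K"
    have "U j z \<le> ereal (pavg r (F j) z)" by (rule U_le_pavg[OF r(1) polyball_in_thicken[OF r(2) z]])
    also have "pavg r (F j) z \<le> (\<integral>z. indicator (thicken K r) z * \<bar>F j z\<bar> \<partial>lborel) / ?V"
      using pavg_diff_le(2)[OF r(1) compact_thicken[OF K(1)] r(2) thickenI[OF z], of j] by simp
    also have "\<dots> \<le> B / ?V" using B V by (intro divide_right_mono) auto
    finally show "U j z \<le> ereal (B / ?V)" by simp
  qed
qed

end

section \<open>The limit function\<close>

definition radius :: "nat \<Rightarrow> real" where "radius k = inverse (real (Suc k))"

lemma radius_pos: "radius k > 0" by (simp add: radius_def)

lemma radius_tendsto: "radius \<longlonglongrightarrow> 0"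
  unfolding radius_def by (rule LIMSEQ_inverse_real_of_nat)

lemma radius_less: "r > 0 \<Longrightarrow> \<forall>\<^sub>F k in sequentially. radius k < r"
  using radius_tendsto by (rule order_tendstoD)

lemma polyball_in_radius:
  assumes "open \<Omega>" "x \<in> \<Omega>"
  obtains r where "r > 0" "polyball_in \<Omega> r x" "\<forall>\<^sub>F k in sequentially. polyball_in \<Omega> (radius k) x"
proof -
  have "compact {x}" "{x} \<subseteq> \<Omega>" using assms by auto
  then obtain r where r: "r > 0" "thicken {x} r \<subseteq> \<Omega>" using thicken_subset[OF _ assms(1)] by blast
  then have p: "polyball_in \<Omega> r x" by (simp add: polyball_in_thicken)
  have "\<forall>\<^sub>F k in sequentially. polyball_in \<Omega> (radius k) x"
    using radius_less[OF r(1)] by (rule eventually_mono) (auto intro: polyball_in_mono[OF p] less_imp_le)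
  then show thesis using that r p by blast
qed

context qpsh_limit
begin

text \<open>Takes the place of monotonicity of the means in the radius. By continuity the mean of
  radius \<open>r\<close> is below \<open>c\<close> on a small polydisc around \<open>x\<close>.
  There \<open>U j\<close> is at most its own mean of radius \<open>r\<close>, hence at most
  \<open>c + \<eta> j\<close> with \<open>\<eta> j\<close> tending to 0. Averaging over the small
  polydisc and letting \<open>j\<close> grow gives the bound for \<open>f\<close>.\<close>

lemma pavg_small_le:
  assumes r: "r > 0" and x: "polyball_in \<Omega> r x" and c: "pavg r f x < c"
  shows "\<forall>\<^sub>F k in sequentially. pavg (radius k) f x \<le> c"
proof -
  let ?V = "measure lborel (polyball r :: (quat ^ 'n) set)"
  have V: "?V > 0" by (rule measure_polyball(1)[OF r])
  obtain \<delta> K where K: "\<delta> > 0" "compact K" "K \<subseteq> \<Omega>" "\<And>z y. z \<in> cball x \<delta> \<Longrightarrow> y \<in> polyball r \<Longrightarrow> z + y \<in> K"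
    by (rule polyball_in_neighbourhood[OF \<Omega> x]) blast
  have "isCont (pavg r f) x" by (rule isCont_pavg[OF \<Omega> f x])
  then have "\<forall>\<^sub>F z in at x. pavg r f z < c" using c by (intro order_tendstoD) (auto simp: isCont_def)
  then obtain \<delta>' where \<delta>': "\<delta>' > 0" "\<And>z. z \<noteq> x \<Longrightarrow> dist z x < \<delta>' \<Longrightarrow> pavg r f z < c"
    by (auto simp: eventually_at)
  \<comment> \<open>A point of the polydisc of radius \<open>s\<close> has norm at most
    \<open>CARD('n) * s\<close>; the additional 1 makes the inequality strict.\<close>
  define s0 where "s0 = min \<delta> \<delta>' / real (CARD('n) + 1)"
  have s0: "s0 > 0" using K(1) \<delta>'(1) by (simp add: s0_def)
  show ?thesis using radius_less[OF s0]
  proof eventually_elim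
    case (elim k)
    define s where "s = radius k"
    have s: "s > 0" "s < s0" using elim radius_pos by (auto simp: s_def)
    have ny: "norm y < min \<delta> \<delta>'" if "y \<in> polyball s" for y :: "quat ^ 'n"
    proof -
      have "norm y \<le> real CARD('n) * s" using polyball_subset_cball[of s] s(1) that by auto
      also have "\<dots> < real (CARD('n) + 1) * s0" using s by (intro mult_strict_mono) auto
      finally show ?thesis by (simp add: s0_def)
    qed
    have z: "x + y \<in> cball x \<delta>" "pavg r f (x + y) < c" if "y \<in> polyball s" for y
    proof -
      show "x + y \<in> cball x \<delta>" using ny[OF that] by (simp add: dist_norm)
      show "pavg r f (x + y) < c" using ny[OF that] \<delta>'(2)[of "x + y"] c by (cases "y = 0") (auto simp: dist_norm)
    qed
    have pin: "polyball_in \<Omega> r (x + y)" if "y \<in> polyball s" for y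
      using K(3,4) z(1)[OF that] by (auto simp: polyball_in_def)
    have xs: "polyball_in \<Omega> s x"
      unfolding polyball_in_def
    proof
      fix y :: "quat ^ 'n" assume "y \<in> polyball s"
      then have "polyball_in \<Omega> r (x + y)" by (rule pin)
      moreover have "0 \<in> polyball r" using r by (simp add: polyball_def)
      ultimately show "x + y \<in> \<Omega>" by (force simp: polyball_in_def)
    qed
    define \<eta> where "\<eta> j = (\<integral>z. indicator K z * \<bar>F j z - f z\<bar> \<partial>lborel) / ?V" for j
    have \<eta>: "\<eta> \<longlonglongrightarrow> 0"
      unfolding \<eta>_def using tendsto_divide[OF lim[OF K(2,3)] tendsto_const[of ?V]] V by simp
    have "pavg s (F j) x \<le> c + \<eta> j" for j
    proof (rule nn_integral_window(2)[OF s(1) xs])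
      fix y :: "quat ^ 'n" assume y: "y \<in> polyball s"
      have "U j (x + y) \<le> ereal (pavg r (F j) (x + y))" by (rule U_le_pavg[OF r pin[OF y]])
      also have "pavg r (F j) (x + y) \<le> c + \<eta> j"
        using pavg_diff_le(1)[OF r K(2,3) K(4)[OF z(1)[OF y]], of j] z(2)[OF y] by (simp add: \<eta>_def)
      finally show "U j (x + y) \<le> ereal (c + \<eta> j)" by simp
    qed
    then have "pavg s f x \<le> c + 0"
      by (intro LIMSEQ_le[OF pavg_tendsto[OF s(1) xs] tendsto_add[OF tendsto_const \<eta>]]) auto
    then show ?case by (simp add: s_def)
  qed
qed

text \<open>An infimum of functions continuous near \<open>x\<close>, which yields upper
  semicontinuity; that it is also the limit along \<open>radius k\<close> is a consequence of the
  transfer to small radii.\<close>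

definition v :: "quat ^ 'n \<Rightarrow> ereal" where
  "v x = (INF r\<in>{r. r > 0 \<and> polyball_in \<Omega> r x}. ereal (pavg r f x))"

lemma v_le: "r > 0 \<Longrightarrow> polyball_in \<Omega> r x \<Longrightarrow> v x \<le> ereal (pavg r f x)"
  unfolding v_def by (rule INF_lower) simp

lemma v_less_iff: "v x < c \<longleftrightarrow> (\<exists>r>0. polyball_in \<Omega> r x \<and> ereal (pavg r f x) < c)"
  unfolding v_def by (auto simp: INF_less_iff)

lemma pavg_tendsto_v:
  assumes x: "x \<in> \<Omega>"
  shows "(\<lambda>k. ereal (pavg (radius k) f x)) \<longlonglongrightarrow> v x"
proof (rule order_tendstoI)
  fix c assume c: "c < v x"
  obtain r where r: "r > 0" "polyball_in \<Omega> r x" "\<forall>\<^sub>F k in sequentially. polyball_in \<Omega> (radius k) x"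
    by (rule polyball_in_radius[OF \<Omega> x])
  from r(3) show "\<forall>\<^sub>F k in sequentially. c < ereal (pavg (radius k) f x)"
    by eventually_elim (use c v_le[OF radius_pos] in \<open>auto intro: less_le_trans\<close>)
next
  fix c assume "v x < c"
  then obtain r where r: "r > 0" "polyball_in \<Omega> r x" "ereal (pavg r f x) < c" by (auto simp: v_less_iff)
  then obtain c' where c': "ereal (pavg r f x) < ereal c'" "ereal c' < c" using ereal_dense2 by blast
  have "\<forall>\<^sub>F k in sequentially. pavg (radius k) f x \<le> c'" using c' by (intro pavg_small_le[OF r(1,2)]) simp
  then show "\<forall>\<^sub>F k in sequentially. ereal (pavg (radius k) f x) < c"
    by eventually_elim (use c'(2) in \<open>auto intro: le_less_trans[of "ereal _" "ereal c'"]\<close>)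
qed

lemma v_less_PInf: "x \<in> \<Omega> \<Longrightarrow> v x < \<infinity>"
proof -
  assume "x \<in> \<Omega>"
  then obtain r where "r > 0" "polyball_in \<Omega> r x" using polyball_in_radius[OF \<Omega>] by metis
  moreover have "ereal (pavg r f x) < \<infinity>" by simp
  ultimately show ?thesis unfolding v_less_iff by blast
qed

lemma usc_v: "usc_on \<Omega> v"
proof (subst usc_on_open_iff[OF \<Omega>], rule allI, subst open_subopen, rule ballI)
  fix c x assume "x \<in> {x \<in> \<Omega>. v x < c}"
  then obtain r where r: "x \<in> \<Omega>" "r > 0" "polyball_in \<Omega> r x" "ereal (pavg r f x) < c" by (auto simp: v_less_iff)
  obtain \<delta> K where K: "\<delta> > 0" "K \<subseteq> \<Omega>" "\<And>z y. z \<in> cball x \<delta> \<Longrightarrow> y \<in> polyball r \<Longrightarrow> z + y \<in> K"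
    by (rule polyball_in_neighbourhood[OF \<Omega> r(3)]) blast
  have "((\<lambda>z. ereal (pavg r f z)) \<longlongrightarrow> ereal (pavg r f x)) (nhds x)"
    using isCont_pavg[OF \<Omega> f r(3)] by (intro tendsto_ereal) (simp add: tendsto_nhds_iff isCont_def)
  then have "\<forall>\<^sub>F z in nhds x. ereal (pavg r f z) < c" using r(4) by (rule order_tendstoD)
  then obtain T where T: "open T" "x \<in> T" "\<And>z. z \<in> T \<Longrightarrow> ereal (pavg r f z) < c" by (auto simp: eventually_nhds)
  show "\<exists>T. open T \<and> x \<in> T \<and> T \<subseteq> {x \<in> \<Omega>. v x < c}"
  proof (intro exI conjI subsetI CollectI)
    show "open (T \<inter> ball x \<delta>)" "x \<in> T \<inter> ball x \<delta>" using T K(1) by auto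
    fix z assume z: "z \<in> T \<inter> ball x \<delta>"
    then have p: "polyball_in \<Omega> r z" using K(2,3) by (auto simp: polyball_in_def)
    moreover have "0 \<in> polyball r" using r(2) by (simp add: polyball_def)
    ultimately show "z \<in> \<Omega>" by (force simp: polyball_in_def)
    show "v z < c" unfolding v_less_iff using r(2) p T(3) z by auto
  qed
qed

text \<open>By Fubini the integral of the mean over \<open>Q\<close> is the average of
  \<open>g y\<close>, the integral of \<open>f\<close> over the translate of \<open>Q\<close> by
  \<open>y\<close>. Since \<open>Q\<close> is compact and convex, \<open>g\<close> is continuous at
  0. This weak form replaces differentiation of integrals at almost every point.\<close>

lemma integral_pavg_tendsto:
  assumes Q: "compact Q" "convex Q" and r0: "r0 > 0" "thicken Q r0 \<subseteq> \<Omega>"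
  shows "(\<lambda>k. \<integral>z. indicator Q z * pavg (radius k) f z \<partial>lborel) \<longlonglongrightarrow> (\<integral>z. indicator Q z * f z \<partial>lborel)"
    and "\<forall>\<^sub>F k in sequentially. integrable lborel (\<lambda>z. indicator Q z * pavg (radius k) f z)"
proof -
  define K where "K = thicken Q r0"
  have K: "compact K" "K \<subseteq> \<Omega>" using compact_thicken[OF Q(1)] r0(2) by (auto simp: K_def)
  have [measurable]: "Q \<in> sets borel" "K \<in> sets borel" using Q K by (auto simp: compact_imp_closed)
  have finQ: "emeasure lborel Q < \<infinity>" by (rule emeasure_bounded_finite[OF compact_imp_bounded[OF Q(1)]])
  define g where "g y = (\<integral>z. indicator Q z * f (y + z) \<partial>lborel)" for y
  have "isCont g 0"
    unfolding g_def
  proof (rule isCont_window_integral[OF f_meas Q, where \<delta> = r0 and K = K])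
    show "integrable lborel (\<lambda>z. indicator K z * f z)" by (rule integrable_K[OF K])
    fix z y :: "quat ^ 'n" assume zy: "z \<in> cball 0 r0" "y \<in> Q"
    then have "z \<in> polyball r0" using cball_subset_polyball by blast
    from thickenI[OF zy(2) this] show "z + y \<in> K" by (simp add: K_def add.commute)
  qed (use r0 in auto)
  then have gc: "(g \<longlongrightarrow> g 0) (at 0)" by (simp add: isCont_def)
  have g0: "g 0 = (\<integral>z. indicator Q z * f z \<partial>lborel)" by (simp add: g_def)
  define I where "I = (\<integral>z. indicator K z * \<bar>f z\<bar> \<partial>lborel)"
  have prod: "integrable (lborel \<Otimes>\<^sub>M lborel) (\<lambda>(z, y). indicator Q z * (indicator (polyball r) y * f (z + y)))"
    if r: "0 < r" "r \<le> r0" for r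
  proof (rule lborel_pair.Fubini_integrable)
    show "(\<lambda>(z, y). indicator Q z * (indicator (polyball r) y * f (z + y))) \<in> borel_measurable (lborel \<Otimes>\<^sub>M lborel)"
      by measurable
    have inK: "z + y \<in> K" if "z \<in> Q" "y \<in> polyball r" for z y
      using that r polyball_mono[OF r(2)] by (auto simp: K_def intro!: thickenI)
    note win = window_integrable[OF f_meas borel_polyball \<open>K \<in> sets borel\<close> integrable_K(2)[OF K] inK]
    show "integrable lborel (\<lambda>z. \<integral>y. norm (case (z, y) of (z, y) \<Rightarrow> indicator Q z * (indicator (polyball r) y * f (z + y))) \<partial>lborel)"
    proof (rule integrable_bounded_support[where S = Q and B = I])
      fix z assume "z \<in> Q"
      then show "\<bar>\<integral>y. norm (case (z, y) of (z, y) \<Rightarrow> indicator Q z * (indicator (polyball r) y * f (z + y))) \<partial>lborel\<bar> \<le> I"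
        using win(3)[where x = z] by (simp add: abs_mult I_def)
    qed (use finQ in auto)
    show "AE z in lborel. integrable lborel (\<lambda>y. case (z, y) of (z, y) \<Rightarrow> indicator Q z * (indicator (polyball r) y * f (z + y)))"
    proof (intro AE_I2)
      fix z
      show "integrable lborel (\<lambda>y. case (z, y) of (z, y) \<Rightarrow> indicator Q z * (indicator (polyball r) y * f (z + y)))"
        using win(1)[where x = z] by (cases "z \<in> Q") auto
    qed
  qed
  have int: "integrable lborel (\<lambda>z. indicator Q z * pavg r f z)" if r: "0 < r" "r \<le> r0" for r
    using integrable_divide[OF lborel_pair.integrable_fst[OF prod[OF r]], of "measure lborel (polyball r :: (quat ^ 'n) set)"]
    by (simp add: pavg_def)
  then show "\<forall>\<^sub>F k in sequentially. integrable lborel (\<lambda>z. indicator Q z * pavg (radius k) f z)"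
    using radius_less[OF r0(1)] radius_pos by (auto elim!: eventually_mono)
  show "(\<lambda>k. \<integral>z. indicator Q z * pavg (radius k) f z \<partial>lborel) \<longlonglongrightarrow> (\<integral>z. indicator Q z * f z \<partial>lborel)"
  proof (rule tendstoI)
    fix e :: real assume e: "e > 0"
    then have "\<forall>\<^sub>F y in at 0. dist (g y) (g 0) < e / 2" using gc by (intro tendstoD) auto
    then obtain \<delta> where \<delta>: "\<delta> > 0" "\<And>y. y \<noteq> 0 \<Longrightarrow> norm y < \<delta> \<Longrightarrow> dist (g y) (g 0) < e / 2"
      by (auto simp: eventually_at dist_norm)
    define s where "s = min r0 (\<delta> / real (CARD('n) + 1))"
    have s: "s > 0" using r0 \<delta> by (simp add: s_def)
    show "\<forall>\<^sub>F k in sequentially. dist (\<integral>z. indicator Q z * pavg (radius k) f z \<partial>lborel) (\<integral>z. indicator Q z * f z \<partial>lborel) < e"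
      using radius_less[OF s]
    proof eventually_elim
      case (elim k)
      define r where "r = radius k"
      have r: "0 < r" "r \<le> r0" "r < \<delta> / real (CARD('n) + 1)" using elim radius_pos[of k] by (auto simp: r_def s_def)
      let ?V = "measure lborel (polyball r :: (quat ^ 'n) set)" and ?I = "indicator (polyball r) :: quat ^ 'n \<Rightarrow> real"
      have V: "?V > 0" by (rule measure_polyball(1)[OF r(1)])
      have fin: "emeasure lborel (polyball r :: (quat ^ 'n) set) < \<infinity>"
        unfolding measure_polyball(2)[OF r(1)] by simp
      have close: "\<bar>g y - g 0\<bar> \<le> e / 2" if "y \<in> polyball r" for y
      proof (cases "y = 0")
        case False
        have "norm y \<le> real CARD('n) * r" using polyball_subset_cball[of r] r(1) that by auto
        also have "\<dots> < real (CARD('n) + 1) * (\<delta> / real (CARD('n) + 1))"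
          using r by (intro mult_strict_mono) auto
        finally show ?thesis using \<delta>(2)[OF False] by (simp add: dist_real_def)
      qed (use e in simp)
      have ig: "integrable lborel (\<lambda>y. ?I y * g y)"
        using lborel_pair.integrable_snd[OF prod[OF r(1,2)]]
        by (simp add: g_def mult.left_commute[of "indicator Q _"] add.commute)
      have ic: "integrable lborel (\<lambda>y. ?I y * c)" for c
        using fin by (intro integrable_mult_left integrable_real_indicator) auto
      have "(\<integral>z. indicator Q z * pavg r f z \<partial>lborel) =
        (\<integral>z. (\<integral>y. indicator Q z * (?I y * f (z + y)) \<partial>lborel) \<partial>lborel) / ?V"
        by (simp add: pavg_def)
      also have "(\<integral>z. (\<integral>y. indicator Q z * (?I y * f (z + y)) \<partial>lborel) \<partial>lborel) =
        (\<integral>y. (\<integral>z. indicator Q z * (?I y * f (z + y)) \<partial>lborel) \<partial>lborel)"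
        using lborel_pair.Fubini_integral[OF prod[OF r(1,2)]] by simp
      also have "\<dots> = (\<integral>y. ?I y * g y \<partial>lborel)"
        by (simp add: g_def mult.left_commute[of "indicator Q _"] add.commute)
      finally have eq: "(\<integral>z. indicator Q z * pavg r f z \<partial>lborel) = (\<integral>y. ?I y * g y \<partial>lborel) / ?V" .
      have "(\<integral>y. ?I y * g y \<partial>lborel) - ?V * g 0 = (\<integral>y. ?I y * g y - ?I y * g 0 \<partial>lborel)"
        using ig ic by simp
      moreover have "\<bar>\<integral>y. ?I y * g y - ?I y * g 0 \<partial>lborel\<bar> \<le> (\<integral>y. ?I y * (e / 2) \<partial>lborel)"
      proof (rule order_trans[OF integral_abs_bound integral_mono])
        show "integrable lborel (\<lambda>y. \<bar>?I y * g y - ?I y * g 0\<bar>)" using ig ic by simp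
        show "integrable lborel (\<lambda>y. ?I y * (e / 2))" by (rule ic)
        show "\<bar>?I y * g y - ?I y * g 0\<bar> \<le> ?I y * (e / 2)" for y
          using close[of y] by (cases "y \<in> polyball r") auto
      qed
      moreover have "(\<integral>y. ?I y * (e / 2) \<partial>lborel) = ?V * (e / 2)" by simp
      ultimately have "\<bar>(\<integral>y. ?I y * g y \<partial>lborel) - ?V * g 0\<bar> \<le> ?V * (e / 2)" by simp
      then have "\<bar>(\<integral>y. ?I y * g y \<partial>lborel) / ?V - g 0\<bar> \<le> e / 2"
        using V by (simp add: abs_le_iff field_simps)
      then show ?case using e eq unfolding r_def[symmetric] by (simp add: dist_real_def g0)
    qed
  qed
qed

text \<open>The inequality between \<open>U j\<close> and its means passes to the limit along an
  almost everywhere convergent subsequence. The exceptional set does not depend on the radius, so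
  all \<open>k\<close> are treated at once.\<close>

lemma AE_le_pavg:
  assumes Q: "compact Q" and r0: "r0 > 0" "thicken Q r0 \<subseteq> \<Omega>"
  shows "AE z in lborel. z \<in> Q \<longrightarrow> (\<forall>k. radius k \<le> r0 \<longrightarrow> f z \<le> pavg (radius k) f z)"
proof -
  define K where "K = thicken Q r0"
  have K: "compact K" "K \<subseteq> \<Omega>" using compact_thicken[OF Q] r0(2) by (auto simp: K_def)
  have "0 \<in> polyball r0" using r0 by (simp add: polyball_def)
  then have QK: "z \<in> K" if "z \<in> Q" for z using thickenI[OF that, of 0 r0] by (simp add: K_def)
  have "(\<lambda>n. \<integral>z. norm (indicator K z * (F n z - f z)) \<partial>lborel) \<longlonglongrightarrow> 0"
    using lim[OF K] by (simp add: abs_mult)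
  then obtain r :: "nat \<Rightarrow> nat" where r: "strict_mono r" "AE z in lborel. (\<lambda>n. indicator K z * (F (r n) z - f z)) \<longlonglongrightarrow> 0"
    using tendsto_L1_AE_subseq[of lborel "\<lambda>n z. indicator K z * (F n z - f z)", OF integrable_K(3)[OF K]] by blast
  have "AE z in lborel. \<forall>j. z \<in> \<Omega> \<longrightarrow> U j z = ereal (F j z)" using UF by (intro AE_all_countable[THEN iffD2] allI)
  with r(2) show ?thesis
  proof eventually_elim
    case (elim z)
    show ?case
    proof (intro impI allI)
      fix k assume z: "z \<in> Q" and k: "radius k \<le> r0"
      have p: "polyball_in \<Omega> (radius k) z"
        using polyball_in_mono[OF polyball_in_thicken[OF r0(2) z] k] .
      have "(\<lambda>n. F (r n) z - f z) \<longlonglongrightarrow> 0" using elim(1) QK[OF z] by simp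
      then have 1: "(\<lambda>n. F (r n) z) \<longlonglongrightarrow> f z" by (rule LIM_zero_cancel)
      have 2: "(\<lambda>n. pavg (radius k) (F (r n)) z) \<longlonglongrightarrow> pavg (radius k) f z"
        using LIMSEQ_subseq_LIMSEQ[OF pavg_tendsto[OF radius_pos p] r(1)] by (simp add: o_def)
      have "F j z \<le> pavg (radius k) (F j) z" for j
        using U_le_pavg[OF radius_pos p, of j] elim(2) QK[OF z] K(2) by auto
      then show "f z \<le> pavg (radius k) f z" by (intro LIMSEQ_le[OF 1 2]) auto
    qed
  qed
qed

text \<open>Almost everywhere \<open>f\<close> is at most \<open>v\<close>, and \<open>v\<close> is
  at most every mean of \<open>f\<close> of small radius. The integrals of these means over
  \<open>Q\<close> tend to that of \<open>f\<close>, which squeezes \<open>v - f\<close> to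
  0.\<close>

lemma AE_eq_v_local:
  assumes Q: "compact Q" "convex Q" "Q \<subseteq> \<Omega>"
  shows "AE z in lborel. z \<in> Q \<longrightarrow> v z = ereal (f z)"
proof -
  obtain r0 where r0: "r0 > 0" "thicken Q r0 \<subseteq> \<Omega>" by (rule thicken_subset[OF Q(1) \<Omega> Q(3)])
  have [measurable]: "Q \<in> sets borel" using Q by (simp add: compact_imp_closed)
  define v' where "v' x = (if x \<in> \<Omega> then v x else 0)" for x
  have [measurable]: "v' \<in> borel_measurable borel"
    using usc_on_borel_measurable[OF \<Omega> usc_v] by (simp add: v'_def[abs_def])
  have ev: "\<forall>\<^sub>F k in sequentially. radius k \<le> r0" using radius_less[OF r0(1)] by (auto elim!: eventually_mono)
  note AE1 = AE_le_pavg[OF Q(1) r0]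
  have AE2: "AE z in lborel. z \<in> Q \<longrightarrow> ereal (f z) \<le> v z"
    using AE1
  proof eventually_elim
    case (elim z)
    show ?case
    proof
      assume z: "z \<in> Q"
      then have "\<forall>\<^sub>F k in sequentially. ereal (f z) \<le> ereal (pavg (radius k) f z)"
        using ev elim by (auto elim!: eventually_mono)
      moreover have "(\<lambda>k. ereal (pavg (radius k) f z)) \<longlonglongrightarrow> v z" using z Q(3) by (intro pavg_tendsto_v) auto
      ultimately show "ereal (f z) \<le> v z" by (intro tendsto_lowerbound[of _ "v z"]) auto
    qed
  qed
  let ?J = "\<integral>\<^sup>+z\<in>Q. e2ennreal (v' z - ereal (f z)) \<partial>lborel"
  let ?D = "\<lambda>k. (\<integral>z. indicator Q z * pavg (radius k) f z \<partial>lborel) - (\<integral>z. indicator Q z * f z \<partial>lborel)"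
  have intf: "integrable lborel (\<lambda>z. indicator Q z * f z)" by (rule integrable_K[OF Q(1,3)])
  have "\<forall>\<^sub>F k in sequentially. ?J \<le> ennreal (?D k)"
    using ev integral_pavg_tendsto(2)[OF Q(1,2) r0]
  proof eventually_elim
    case (elim k)
    have "?J \<le> (\<integral>\<^sup>+z. ennreal (indicator Q z * pavg (radius k) f z - indicator Q z * f z) \<partial>lborel)"
    proof (rule nn_integral_mono)
      fix z
      show "e2ennreal (v' z - ereal (f z)) * indicator Q z \<le> ennreal (indicator Q z * pavg (radius k) f z - indicator Q z * f z)"
      proof (cases "z \<in> Q")
        case True
        have "v z \<le> ereal (pavg (radius k) f z)"
          by (rule v_le[OF radius_pos polyball_in_mono[OF polyball_in_thicken[OF r0(2) True] elim(1)]])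
        then have "v' z - ereal (f z) \<le> ereal (pavg (radius k) f z - f z)"
          using True Q(3) by (cases "v z") (auto simp: v'_def)
        then show ?thesis using True e2ennreal_mono by fastforce
      qed simp
    qed
    also have "\<dots> = ennreal (\<integral>z. indicator Q z * pavg (radius k) f z - indicator Q z * f z \<partial>lborel)"
    proof (rule nn_integral_eq_integral)
      show "integrable lborel (\<lambda>z. indicator Q z * pavg (radius k) f z - indicator Q z * f z)"
        using elim(2) intf by (rule Bochner_Integration.integrable_diff)
      show "AE z in lborel. 0 \<le> indicator Q z * pavg (radius k) f z - indicator Q z * f z"
        using AE1 by eventually_elim (use elim(1) in \<open>auto simp: indicator_def\<close>)
    qed
    also have "\<dots> = ennreal (?D k)" using elim(2) intf by simp
    finally show ?case .
  qed
  moreover have "(\<lambda>k. ennreal (?D k)) \<longlonglongrightarrow> ennreal 0"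
    using LIM_zero[OF integral_pavg_tendsto(1)[OF Q(1,2) r0]] by (rule tendsto_ennrealI)
  ultimately have "?J \<le> ennreal 0" by (intro tendsto_lowerbound[of _ "ennreal 0"]) auto
  then have "?J = 0" by simp
  then have "AE z in lborel. e2ennreal (v' z - ereal (f z)) * indicator Q z = 0"
    by (subst (asm) nn_integral_0_iff_AE) auto
  with AE2 show ?thesis
  proof eventually_elim
    case (elim z)
    show ?case
    proof
      assume z: "z \<in> Q"
      then have "e2ennreal (v z - ereal (f z)) = 0" "ereal (f z) \<le> v z" using elim Q(3) by (auto simp: v'_def)
      then show "v z = ereal (f z)" using v_less_PInf[of z] z Q(3) by (cases "v z") (auto simp: ennreal_eq_0_iff)
    qed
  qed
qed

end

section \<open>Plurisubharmonicity of the limit function\<close>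

lemma nn_integral_Fatou_le:
  fixes u :: "nat \<Rightarrow> 'a \<Rightarrow> ennreal"
  assumes [measurable]: "\<And>n. u n \<in> borel_measurable M"
    and lim: "\<And>x. (\<lambda>n. u n x) \<longlonglongrightarrow> w x"
    and le: "\<forall>\<^sub>F n in sequentially. (\<integral>\<^sup>+x. u n x \<partial>M) \<le> c n" and c: "c \<longlonglongrightarrow> C"
  shows "(\<integral>\<^sup>+x. w x \<partial>M) \<le> C"
proof -
  have "w x = liminf (\<lambda>n. u n x)" for x using lim_imp_Liminf[OF _ lim] by simp
  then have "(\<integral>\<^sup>+x. w x \<partial>M) = (\<integral>\<^sup>+x. liminf (\<lambda>n. u n x) \<partial>M)" by simp
  also have "\<dots> \<le> liminf (\<lambda>n. \<integral>\<^sup>+x. u n x \<partial>M)" by (rule nn_integral_liminf) measurable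
  also have "\<dots> \<le> liminf c" by (rule Liminf_mono[OF le])
  also have "\<dots> = C" by (rule lim_imp_Liminf[OF _ c]) simp
  finally show ?thesis .
qed

lemma AE_open_local:
  fixes \<Omega> :: "'a::second_countable_topology set"
  assumes local: "\<And>x. x \<in> \<Omega> \<Longrightarrow> \<exists>T. open T \<and> x \<in> T \<and> (AE y in M. y \<in> T \<longrightarrow> P y)"
  shows "AE y in M. y \<in> \<Omega> \<longrightarrow> P y"
proof -
  let ?F = "{T. open T \<and> (AE y in M. y \<in> T \<longrightarrow> P y)}"
  obtain G where G: "G \<subseteq> ?F" "countable G" "\<Union>G = \<Union>?F" using Lindelof[of ?F] by auto
  have "AE y in M. \<forall>T\<in>G. y \<in> T \<longrightarrow> P y" using G by (subst AE_ball_countable) auto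
  then show ?thesis
  proof eventually_elim
    case (elim y)
    show ?case
    proof
      assume "y \<in> \<Omega>"
      then obtain T where "open T" "y \<in> T" "AE y in M. y \<in> T \<longrightarrow> P y" using local by blast
      then have "y \<in> \<Union>G" unfolding G(3) by auto
      then show "P y" using elim by auto
    qed
  qed
qed

lemma tendsto_e2ennreal_diff:
  assumes "((\<lambda>k. ereal (x k)) \<longlongrightarrow> y) F"
  shows "((\<lambda>k. ennreal (M - x k)) \<longlongrightarrow> e2ennreal (ereal M - y)) F"
proof -
  have "((\<lambda>k. - ereal (x k) + ereal M) \<longlongrightarrow> - y + ereal M) F"
    by (intro tendsto_add_left_ereal tendsto_uminus_ereal assms) simp
  from tendsto_e2ennrealI[OF this] show ?thesis
    by (simp add: minus_ereal_def add.commute)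
qed

context qpsh_limit
begin

text \<open>Averaging over translations preserves the mean value inequality on lines: for fixed
  \<open>y\<close> the translated line through \<open>a + y\<close> satisfies it, and Tonelli
  exchanges the two integrals.\<close>

lemma pavg_line_mean:
  assumes \<rho>: "\<rho> > 0" and s: "s > 0"
    and M: "\<And>q y. q \<in> cball q0 \<rho> \<Longrightarrow> y \<in> polyball s \<Longrightarrow> a + qscale_right b q + y \<in> \<Omega> \<and> U j (a + qscale_right b q + y) \<le> ereal M"
  shows "(\<integral>\<^sup>+q\<in>cball q0 \<rho>. ennreal (M - pavg s (F j) (a + qscale_right b q)) \<partial>lborel) \<le>
    emeasure lborel (cball q0 \<rho>) * ennreal (M - pavg s (F j) (a + qscale_right b q0))"
proof -
  let ?B = "cball q0 \<rho>" and ?P = "polyball s :: (quat ^ 'n) set"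
  let ?V = "measure lborel ?P"
  have V: "?V > 0" by (rule measure_polyball(1)[OF s])
  have q0: "q0 \<in> ?B" using \<rho> by simp
  define U' where "U' z = (if z \<in> \<Omega> then U j z else 0)" for z
  have [measurable]: "U' \<in> borel_measurable borel"
    using usc_on_borel_measurable[OF \<Omega> QPSH_D(2)[OF U]] by (simp add: U'_def[abs_def])
  define W where "W z = e2ennreal (ereal M - U' z)" for z
  have [measurable]: "W \<in> borel_measurable borel" unfolding W_def by measurable
  have [measurable]: "?B \<in> sets borel" by simp
  have [measurable]: "qscale_right b \<in> borel_measurable borel"
    by (intro borel_measurable_continuous_onI continuous_qscale_right)
  have W: "W (a + qscale_right b q + y) = e2ennreal (ereal M - U j (a + qscale_right b q + y))"
    if "q \<in> ?B" "y \<in> ?P" for q y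
    using M[OF that] by (simp add: W_def U'_def)
  have win: "(\<integral>\<^sup>+y\<in>?P. W (a + qscale_right b q + y) \<partial>lborel) = ennreal ?V * ennreal (M - pavg s (F j) (a + qscale_right b q))"
    if q: "q \<in> ?B" for q
  proof -
    have "(\<integral>\<^sup>+y\<in>?P. W (a + qscale_right b q + y) \<partial>lborel) = (\<integral>\<^sup>+y\<in>?P. e2ennreal (ereal M - U j (a + qscale_right b q + y)) \<partial>lborel)"
      using W[OF q] by (intro nn_integral_cong) (auto simp: indicator_def)
    also have "\<dots> = ennreal ?V * ennreal (M - pavg s (F j) (a + qscale_right b q))"
      using M[OF q] by (intro nn_integral_window(1)[OF s]) (auto simp: polyball_in_def)
    finally show ?thesis .
  qed
  have "ennreal ?V * (\<integral>\<^sup>+q\<in>?B. ennreal (M - pavg s (F j) (a + qscale_right b q)) \<partial>lborel) =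
    (\<integral>\<^sup>+q. ennreal ?V * (ennreal (M - pavg s (F j) (a + qscale_right b q)) * indicator ?B q) \<partial>lborel)"
    by (rule nn_integral_cmult[symmetric]) measurable
  also have "\<dots> = (\<integral>\<^sup>+q. (\<integral>\<^sup>+y. W (a + qscale_right b q + y) * indicator ?P y * indicator ?B q \<partial>lborel) \<partial>lborel)"
  proof (rule nn_integral_cong)
    fix q
    have "(\<integral>\<^sup>+y. W (a + qscale_right b q + y) * indicator ?P y * indicator ?B q \<partial>lborel) =
      (\<integral>\<^sup>+y\<in>?P. W (a + qscale_right b q + y) \<partial>lborel) * indicator ?B q"
      by (rule nn_integral_multc) measurable
    then show "ennreal ?V * (ennreal (M - pavg s (F j) (a + qscale_right b q)) * indicator ?B q) =
      (\<integral>\<^sup>+y. W (a + qscale_right b q + y) * indicator ?P y * indicator ?B q \<partial>lborel)"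
      using win[of q] by (cases "q \<in> ?B") auto
  qed
  also have "\<dots> = (\<integral>\<^sup>+y. (\<integral>\<^sup>+q. W (a + qscale_right b q + y) * indicator ?P y * indicator ?B q \<partial>lborel) \<partial>lborel)"
    by (rule lborel_pair.Fubini'[symmetric]) measurable
  also have "\<dots> \<le> (\<integral>\<^sup>+y. emeasure lborel ?B * (W (a + qscale_right b q0 + y) * indicator ?P y) \<partial>lborel)"
  proof (rule nn_integral_mono)
    fix y
    show "(\<integral>\<^sup>+q. W (a + qscale_right b q + y) * indicator ?P y * indicator ?B q \<partial>lborel) \<le>
      emeasure lborel ?B * (W (a + qscale_right b q0 + y) * indicator ?P y)"
    proof (cases "y \<in> ?P")
      case True
      have e: "a + qscale_right b q + y = (a + y) + qscale_right b q" for q by (simp add: algebra_simps)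
      have "(\<integral>\<^sup>+q. W (a + qscale_right b q + y) * indicator ?P y * indicator ?B q \<partial>lborel) =
        (\<integral>\<^sup>+q\<in>?B. e2ennreal (ereal M - U j ((a + y) + qscale_right b q)) \<partial>lborel)"
        using True W[OF _ True, unfolded e] by (intro nn_integral_cong) (auto simp: indicator_def e)
      also have "\<dots> \<le> emeasure lborel ?B * e2ennreal (ereal M - U j ((a + y) + qscale_right b q0))"
        using M True by (intro qpsh_line_mean[OF U \<rho>]) (auto simp flip: e)
      also have "e2ennreal (ereal M - U j ((a + y) + qscale_right b q0)) = W (a + qscale_right b q0 + y)"
        using W[OF q0 True] by (simp add: e)
      finally show ?thesis using True by simp
    qed simp
  qed
  also have "\<dots> = emeasure lborel ?B * (\<integral>\<^sup>+y\<in>?P. W (a + qscale_right b q0 + y) \<partial>lborel)"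
    by (rule nn_integral_cmult) measurable
  also have "\<dots> = ennreal ?V * (emeasure lborel ?B * ennreal (M - pavg s (F j) (a + qscale_right b q0)))"
    unfolding win[OF q0] by (simp add: mult_ac)
  finally show ?thesis using V by (simp add: ennreal_mult_le_mult_iff)
qed

text \<open>Fatou's lemma twice, first in \<open>j\<close> at a fixed radius, then as the radius
  tends to 0. Passing to \<open>M - v\<close> makes both uses go in the required direction, while at
  the centre the values converge. The uniform upper bound on the \<open>U j\<close> supplies one
  \<open>M\<close> for all stages.\<close>

lemma v_line_mean:
  assumes \<rho>: "\<rho> > 0" and sub: "\<And>q. q \<in> cball q0 \<rho> \<Longrightarrow> a + qscale_right b q \<in> \<Omega>"
  obtains M where "\<And>q. q \<in> cball q0 \<rho> \<Longrightarrow> v (a + qscale_right b q) \<le> ereal M"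
    "(\<integral>\<^sup>+q\<in>cball q0 \<rho>. e2ennreal (ereal M - v (a + qscale_right b q)) \<partial>lborel) \<le>
      emeasure lborel (cball q0 \<rho>) * e2ennreal (ereal M - v (a + qscale_right b q0))"
proof -
  let ?B = "cball q0 \<rho>"
  define D where "D = (\<lambda>q. a + qscale_right b q) ` ?B"
  have D: "compact D" "D \<subseteq> \<Omega>"
    unfolding D_def using sub
    by (auto intro!: compact_continuous_image continuous_intros continuous_qscale_right)
  obtain r0 where r0: "r0 > 0" "thicken D r0 \<subseteq> \<Omega>" by (rule thicken_subset[OF D(1) \<Omega> D(2)])
  obtain M where M: "\<And>j z. z \<in> thicken D r0 \<Longrightarrow> U j z \<le> ereal M"
    using uniformly_bounded_above[OF compact_thicken[OF D(1)] r0(2)] by blast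
  have [measurable]: "?B \<in> sets borel" by simp
  have [measurable]: "qscale_right b \<in> borel_measurable borel"
    by (intro borel_measurable_continuous_onI continuous_qscale_right)
  have q0: "q0 \<in> ?B" using \<rho> by simp
  have fin: "emeasure lborel ?B < top" using emeasure_lborel_cball_finite[of q0 \<rho>] by simp
  have th: "a + qscale_right b q + y \<in> thicken D r0" if "q \<in> ?B" "y \<in> polyball s" "s \<le> r0" for q y s
    using that polyball_mono[OF that(3)] by (intro thickenI) (auto simp: D_def)
  have pin: "polyball_in \<Omega> s (a + qscale_right b q)" if "q \<in> ?B" "s \<le> r0" for q s
    using th[OF that(1) _ that(2)] r0(2) by (auto simp: polyball_in_def)
  have mean_f: "(\<integral>\<^sup>+q\<in>?B. ennreal (M - pavg s f (a + qscale_right b q)) \<partial>lborel) \<le>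
      emeasure lborel ?B * ennreal (M - pavg s f (a + qscale_right b q0))" if s: "0 < s" "s \<le> r0" for s
  proof (rule nn_integral_Fatou_le)
    show "(\<lambda>q. ennreal (M - pavg s (F j) (a + qscale_right b q)) * indicator ?B q) \<in> borel_measurable lborel" for j
      by measurable
    show "(\<lambda>j. ennreal (M - pavg s (F j) (a + qscale_right b q)) * indicator ?B q) \<longlonglongrightarrow>
        ennreal (M - pavg s f (a + qscale_right b q)) * indicator ?B q" for q
    proof (cases "q \<in> ?B")
      case True
      have "(\<lambda>j. ennreal (M - pavg s (F j) (a + qscale_right b q))) \<longlonglongrightarrow> ennreal (M - pavg s f (a + qscale_right b q))"
        by (intro tendsto_ennrealI tendsto_intros pavg_tendsto s pin True)
      then show ?thesis using True by simp
    qed simp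
    show "\<forall>\<^sub>F j in sequentially. (\<integral>\<^sup>+q\<in>?B. ennreal (M - pavg s (F j) (a + qscale_right b q)) \<partial>lborel) \<le>
        emeasure lborel ?B * ennreal (M - pavg s (F j) (a + qscale_right b q0))"
    proof (intro always_eventually allI pavg_line_mean[OF \<rho> s(1)])
      fix j q and y :: "quat ^ 'n" assume "q \<in> ?B" "y \<in> polyball s"
      then show "a + qscale_right b q + y \<in> \<Omega> \<and> U j (a + qscale_right b q + y) \<le> ereal M"
        using th[OF _ _ s(2)] M r0(2) by blast
    qed
    show "(\<lambda>j. emeasure lborel ?B * ennreal (M - pavg s (F j) (a + qscale_right b q0))) \<longlonglongrightarrow>
        emeasure lborel ?B * ennreal (M - pavg s f (a + qscale_right b q0))"
      by (intro ennreal_tendsto_cmult fin tendsto_ennrealI tendsto_intros pavg_tendsto s pin q0)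
  qed
  show thesis
  proof
    fix q assume q: "q \<in> ?B"
    have "pavg r0 (F j) (a + qscale_right b q) \<le> M" for j
      using th[OF q] M by (intro nn_integral_window(2)[OF r0(1) pin[OF q order_refl]]) auto
    then have "pavg r0 f (a + qscale_right b q) \<le> M"
      by (intro LIMSEQ_le_const2[OF pavg_tendsto[OF r0(1) pin[OF q order_refl]]]) auto
    moreover have "v (a + qscale_right b q) \<le> ereal (pavg r0 f (a + qscale_right b q))"
      by (rule v_le[OF r0(1) pin[OF q order_refl]])
    ultimately show "v (a + qscale_right b q) \<le> ereal M" by (meson ereal_less_eq(3) order_trans)
  next
    show "(\<integral>\<^sup>+q\<in>?B. e2ennreal (ereal M - v (a + qscale_right b q)) \<partial>lborel) \<le>
      emeasure lborel ?B * e2ennreal (ereal M - v (a + qscale_right b q0))"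
    proof (rule nn_integral_Fatou_le)
      show "(\<lambda>q. ennreal (M - pavg (radius k) f (a + qscale_right b q)) * indicator ?B q) \<in> borel_measurable lborel" for k
        by measurable
      show "(\<lambda>k. ennreal (M - pavg (radius k) f (a + qscale_right b q)) * indicator ?B q) \<longlonglongrightarrow>
          e2ennreal (ereal M - v (a + qscale_right b q)) * indicator ?B q" for q
        using tendsto_e2ennreal_diff[OF pavg_tendsto_v[OF sub], of q M] by (cases "q \<in> ?B") auto
      show "\<forall>\<^sub>F k in sequentially. (\<integral>\<^sup>+q\<in>?B. ennreal (M - pavg (radius k) f (a + qscale_right b q)) \<partial>lborel) \<le>
          emeasure lborel ?B * ennreal (M - pavg (radius k) f (a + qscale_right b q0))"
        using radius_less[OF r0(1)] by (rule eventually_mono) (intro mean_f radius_pos less_imp_le)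
      show "(\<lambda>k. emeasure lborel ?B * ennreal (M - pavg (radius k) f (a + qscale_right b q0))) \<longlonglongrightarrow>
          emeasure lborel ?B * e2ennreal (ereal M - v (a + qscale_right b q0))"
        by (intro ennreal_tendsto_cmult fin tendsto_e2ennreal_diff pavg_tendsto_v sub q0)
    qed
  qed
qed

lemma v_QPSH: "v \<in> QPSH \<Omega>"
proof -
  have "subharmonic_on {q. a + qscale_right b q \<in> \<Omega>} (\<lambda>q. v (a + qscale_right b q))" for a b
    unfolding subharmonic_on_def
  proof (intro conjI allI impI ballI)
    let ?L = "{q. a + qscale_right b q \<in> \<Omega>}" and ?v = "\<lambda>q. v (a + qscale_right b q)"
    show L: "open ?L" by (rule open_qline[OF \<Omega>])
    show "?v q < \<infinity>" if "q \<in> ?L" for q using that v_less_PInf by simp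
    show usc: "usc_on ?L ?v"
    proof (subst usc_on_open_iff[OF L], rule allI)
      fix c
      have "open {x\<in>\<Omega>. v x < c}" using usc_v usc_on_open_iff[OF \<Omega>] by blast
      from open_qline[OF this, of a b] show "open {q\<in>?L. ?v q < c}" by simp
    qed
    fix x r assume r: "0 < r \<and> cball x r \<subseteq> ?L"
    then have sub: "\<And>q. q \<in> cball x r \<Longrightarrow> a + qscale_right b q \<in> \<Omega>" and r0: "r > 0" by auto
    obtain M where M: "\<And>q. q \<in> cball x r \<Longrightarrow> ?v q \<le> ereal M"
      "(\<integral>\<^sup>+q\<in>cball x r. e2ennreal (ereal M - ?v q) \<partial>lborel) \<le> emeasure lborel (cball x r) * e2ennreal (ereal M - ?v x)"
      using v_line_mean[OF r0 sub] by blast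
    have m: "(\<lambda>q. if q \<in> cball x r then ?v q else 0) \<in> borel_measurable borel"
      using r by (intro usc_on_borel_measurable_subset[OF L usc]) auto
    have x: "x \<in> cball x r" using r0 by simp
    show "?v x \<le> ereal_integral (uniform_measure lborel (cball x r)) ?v"
      using emeasure_lborel_cball_pos[OF r0, of x] emeasure_lborel_cball_finite[of x r] M(1) M(1)[OF x] M(2)
      by (subst le_ereal_integral_iff[OF _ _ _ m, of M]) auto
  qed
  then show ?thesis using v_less_PInf usc_v by (auto simp: QPSH_def)
qed

lemma AE_eq_v: "AE z in lborel. z \<in> \<Omega> \<longrightarrow> v z = ereal (f z)"
proof (rule AE_open_local)
  fix x assume "x \<in> \<Omega>"
  then obtain e where e: "e > 0" "cball x e \<subseteq> \<Omega>" using \<Omega> open_contains_cball by blast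
  have "AE z in lborel. z \<in> cball x e \<longrightarrow> v z = ereal (f z)" by (rule AE_eq_v_local) (use e in auto)
  then have "AE z in lborel. z \<in> ball x e \<longrightarrow> v z = ereal (f z)" by (rule eventually_mono) auto
  then show "\<exists>T. open T \<and> x \<in> T \<and> (AE z in lborel. z \<in> T \<longrightarrow> v z = ereal (f z))"
    using e by (intro exI[of _ "ball x e"]) auto
qed

section \<open>Bounds uniform along the sequence\<close>

lemma uniform_Lq_local:
  assumes q: "0 < q" "q < 2" and c: "c \<in> \<Omega>"
  shows "\<exists>\<delta> C. \<delta> > 0 \<and> (\<forall>j. (\<integral>\<^sup>+x\<in>ball c \<delta>. ennreal (\<bar>F j x\<bar> powr q) \<partial>lborel) \<le> ennreal C)"
proof -
  obtain \<rho> where \<rho>: "\<rho> > 0" "cball c \<rho> \<subseteq> \<Omega>" using \<Omega> c open_contains_cball by blast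
  define R where "R = \<rho> / 4"
  have R: "R > 0" using \<rho> by (simp add: R_def)
  define Q where "Q = cball c (R / 4)"
  have Q: "compact Q" "Q \<subseteq> \<Omega>" "Q \<in> sets borel"
  proof -
    have "Q \<subseteq> cball c \<rho>" unfolding Q_def using R by (auto simp: R_def)
    then show "Q \<subseteq> \<Omega>" using \<rho> by blast
  qed (simp_all add: Q_def)
  obtain M where M: "M \<ge> 0" "\<And>j z. z \<in> cball c \<rho> \<Longrightarrow> U j z \<le> ereal M"
    by (rule uniformly_bounded_above[OF compact_cball \<rho>(2)]) blast
  obtain B where B: "B \<ge> 0" "\<And>j. (\<integral>z. indicator Q z * \<bar>F j z\<bar> \<partial>lborel) \<le> B"
    using bounded_L1[OF Q(1,2)] by blast
  have finQ: "emeasure lborel Q < \<infinity>" unfolding Q_def by (rule emeasure_lborel_cball_finite)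
  define m where "m = measure lborel Q"
  have m: "m > 0"
  proof -
    have "emeasure lborel Q \<noteq> 0" using emeasure_lborel_cball_pos[of "R / 4" c] R by (simp add: Q_def)
    then show ?thesis using finQ by (simp add: m_def zero_less_measure_iff emeasure_eq_ennreal_measure less_top)
  qed
  \<comment> \<open>If \<open>|F j|\<close> were at least \<open>N\<close> almost everywhere on
    \<open>Q\<close>, its integral there would be at least \<open>B + 1\<close>. So each
    \<open>U j\<close> has a good point in \<open>Q\<close>, with a bound that does not depend on
    \<open>j\<close>.\<close>
  define N where "N = (B + 1) / m"
  have ex: "\<exists>a\<in>Q. U j a = ereal (F j a) \<and> \<bar>F j a\<bar> < N" for j
  proof (rule ccontr)
    assume "\<not> ?thesis"
    then have "AE a in lborel. a \<in> Q \<longrightarrow> N \<le> \<bar>F j a\<bar>"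
      using UF[of j] Q(2) by (auto elim!: eventually_mono simp: not_less)
    then have AE: "AE a in lborel. indicator Q a * N \<le> indicator Q a * \<bar>F j a\<bar>"
      by (rule eventually_mono) (auto simp: indicator_def)
    have "(\<integral>a. indicator Q a * N \<partial>lborel) \<le> (\<integral>a. indicator Q a * \<bar>F j a\<bar> \<partial>lborel)"
    proof (rule integral_mono_AE[OF _ _ AE])
      show "integrable lborel (\<lambda>a. indicator Q a * N)"
        using finQ Q(3) by (intro integrable_mult_left integrable_real_indicator) auto
      show "integrable lborel (\<lambda>a. indicator Q a * \<bar>F j a\<bar>)"
        using integrable_abs[OF integrable_K(1)[OF Q(1,2), of j]] by (simp add: abs_mult)
    qed
    also have "\<dots> \<le> B" by (rule B(2))
    also have "(\<integral>a. indicator Q a * N \<partial>lborel) = m * N" by (simp add: m_def)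
    finally show False using m by (simp add: N_def)
  qed
  obtain C :: real where C: "\<And>\<Omega> (u :: quat ^ 'n \<Rightarrow> ereal) a. open \<Omega> \<Longrightarrow> u \<in> QPSH \<Omega> \<Longrightarrow> cball a (3 * R) \<subseteq> \<Omega> \<Longrightarrow>
      (\<And>x. x \<in> cball a (3 * R) \<Longrightarrow> u x \<le> ereal M) \<Longrightarrow> ereal M - u a \<le> ereal (max 0 (M + N)) \<Longrightarrow>
      (\<integral>\<^sup>+x\<in>cball a (R / 2). abs_powr (u x) q \<partial>lebesgue) \<le> ennreal C"
    by (rule qpsh_Lq_bound[OF R M(1) _ q, of "max 0 (M + N)"]) auto
  have "(\<integral>\<^sup>+x\<in>ball c (R / 4). ennreal (\<bar>F j x\<bar> powr q) \<partial>lborel) \<le> ennreal C" for j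
  proof -
    \<comment> \<open>The centre depends on \<open>j\<close> but stays within \<open>R / 4\<close>
      of \<open>c\<close>. The ball of radius \<open>R / 2\<close> around it therefore always covers
      the same ball around \<open>c\<close>, and the constant \<open>C\<close> does not see
      \<open>a\<close>.\<close>
    obtain a where a: "a \<in> Q" "U j a = ereal (F j a)" "\<bar>F j a\<bar> < N" using ex by blast
    have ac: "dist c a \<le> R / 4" using a(1) by (simp add: Q_def)
    have sub: "cball a (3 * R) \<subseteq> cball c \<rho>"
    proof
      fix x assume "x \<in> cball a (3 * R)"
      then show "x \<in> cball c \<rho>" using dist_triangle[of c x a] ac \<rho>(1) by (simp add: R_def)
    qed
    have "ball c (R / 4) \<subseteq> cball a (R / 2)"
    proof
      fix x assume "x \<in> ball c (R / 4)"
      then show "x \<in> cball a (R / 2)" using dist_triangle[of a x c] ac by (simp add: dist_commute)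
    qed
    moreover have "ball c (R / 4) \<subseteq> \<Omega>" using Q(2) by (auto simp: Q_def)
    ultimately have "(\<integral>\<^sup>+x\<in>ball c (R / 4). ennreal (\<bar>F j x\<bar> powr q) \<partial>lborel) \<le> (\<integral>\<^sup>+x\<in>cball a (R / 2). abs_powr (U j x) q \<partial>lborel)"
      using UF[of j]
      by (intro nn_integral_mono_AE) (auto elim!: eventually_mono simp: indicator_def abs_powr_def subset_iff)
    also have "\<dots> = (\<integral>\<^sup>+x\<in>cball a (R / 2). abs_powr (U j x) q \<partial>lebesgue)"
      by (simp add: nn_integral_completion)
    also have "\<dots> \<le> ennreal C"
    proof (rule C[OF \<Omega> U])
      show "cball a (3 * R) \<subseteq> \<Omega>" using sub \<rho>(2) by blast
      show "U j x \<le> ereal M" if "x \<in> cball a (3 * R)" for x using that sub M(2) by blast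
      show "ereal M - U j a \<le> ereal (max 0 (M + N))"
        using a(3) unfolding a(2) ereal_minus ereal_less_eq by linarith
    qed
    finally show ?thesis .
  qed
  then show ?thesis using R by (intro exI[of _ "R / 4"] exI[of _ C]) auto
qed

lemma uniform_Lq:
  assumes q: "0 < q" "q < 2" and K: "compact K" "K \<subseteq> \<Omega>"
  obtains C :: real where "C \<ge> 0" "\<And>j. (\<integral>\<^sup>+x\<in>K. ennreal (\<bar>F j x\<bar> powr q) \<partial>lborel) \<le> ennreal C"
proof -
  have "\<forall>c\<in>K. \<exists>\<delta> C. \<delta> > 0 \<and> (\<forall>j. (\<integral>\<^sup>+x\<in>ball c \<delta>. ennreal (\<bar>F j x\<bar> powr q) \<partial>lborel) \<le> ennreal C)"
    using uniform_Lq_local[OF q] K(2) by blast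
  from bchoice[OF this] obtain \<delta> where
    "\<forall>c\<in>K. \<exists>C. \<delta> c > 0 \<and> (\<forall>j. (\<integral>\<^sup>+x\<in>ball c (\<delta> c). ennreal (\<bar>F j x\<bar> powr q) \<partial>lborel) \<le> ennreal C)" ..
  from bchoice[OF this] obtain D where
    \<delta>: "\<forall>c\<in>K. \<delta> c > 0 \<and> (\<forall>j. (\<integral>\<^sup>+x\<in>ball c (\<delta> c). ennreal (\<bar>F j x\<bar> powr q) \<partial>lborel) \<le> ennreal (D c))" ..
  obtain C :: real where C: "\<And>f. f \<in> borel_measurable borel \<Longrightarrow>
      (\<And>x. x \<in> K \<Longrightarrow> (\<integral>\<^sup>+y\<in>ball x (\<delta> x). f y \<partial>lborel) \<le> ennreal (D x)) \<Longrightarrow>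
      (\<integral>\<^sup>+y\<in>K. f y \<partial>lborel) \<le> ennreal C"
    by (rule nn_integral_compact_bound[of K \<delta> D]) (use K \<delta> in auto)
  have "(\<integral>\<^sup>+x\<in>K. ennreal (\<bar>F j x\<bar> powr q) \<partial>lborel) \<le> ennreal (max 0 C)" for j
    using C[of "\<lambda>x. ennreal (\<bar>F j x\<bar> powr q)"] \<delta> by (simp add: ennreal_max_0)
  then show thesis using that[of "max 0 C"] by simp
qed

end

section \<open>Convergence in exponents below 2\<close>

text \<open>Small \<open>x\<close> have \<open>x powr p\<close> at most \<eta>, large
  \<open>x\<close> have it at most \<open>\<eta> * x powr q\<close>, and on the bounded range
  between them a linear bound holds. In contrast to Hoelder interpolation this treats
  \<open>p < 1\<close> and \<open>p \<ge> 1\<close> alike.\<close>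

lemma powr_interpolation:
  fixes p q \<eta> :: real
  assumes p: "0 < p" "p < q" and \<eta>: "\<eta> > 0"
  obtains C where "C \<ge> 0" "\<And>x. x \<ge> 0 \<Longrightarrow> x powr p \<le> \<eta> + C * x + \<eta> * x powr q"
proof -
  define a where "a = \<eta> powr (1 / p)"
  define b where "b = (1 / \<eta>) powr (1 / (q - p))"
  have a: "a > 0" "a powr p = \<eta>" using p \<eta> by (simp_all add: a_def powr_powr)
  have b: "b > 0" "b powr (q - p) = 1 / \<eta>" using p \<eta> by (simp_all add: b_def powr_powr)
  show thesis
  proof
    show "b powr p / a \<ge> 0" using a by simp
    fix x :: real assume x: "x \<ge> 0"
    have nn: "0 \<le> b powr p / a * x" "0 \<le> \<eta> * x powr q" using a \<eta> x by simp_all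
    consider "x \<le> a" | "a < x" "x \<le> b" | "b < x" by linarith
    then show "x powr p \<le> \<eta> + b powr p / a * x + \<eta> * x powr q"
    proof cases
      case 1
      then have "x powr p \<le> a powr p" using x p by (intro powr_mono2) auto
      then show ?thesis using a nn by linarith
    next
      case 2
      have "x powr p \<le> b powr p" using 2 x p by (intro powr_mono2) auto
      also have "\<dots> = b powr p / a * a" using a by simp
      also have "\<dots> \<le> b powr p / a * x" using 2 a by (intro mult_left_mono) auto
      finally show ?thesis using nn \<eta> by linarith
    next
      case 3
      then have "1 / \<eta> \<le> x powr (q - p)" using b p powr_mono2[of "q - p" b x] by simp
      then have "1 \<le> \<eta> * x powr (q - p)" using \<eta> by (simp add: field_simps)
      then have "x powr p * 1 \<le> x powr p * (\<eta> * x powr (q - p))" by (intro mult_left_mono) auto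
      also have "\<dots> = \<eta> * (x powr p * x powr (q - p))" by simp
      also have "\<dots> = \<eta> * x powr q" by (simp flip: powr_add)
      finally show ?thesis using nn \<eta> by linarith
    qed
  qed
qed

lemma abs_diff_powr_le:
  fixes a b q :: real
  assumes "q > 0"
  shows "\<bar>a - b\<bar> powr q \<le> 2 powr q * (\<bar>a\<bar> powr q + \<bar>b\<bar> powr q)"
proof -
  let ?m = "max \<bar>a\<bar> \<bar>b\<bar>"
  have "\<bar>a - b\<bar> powr q \<le> (2 * ?m) powr q" using assms by (intro powr_mono2) auto
  also have "\<dots> = 2 powr q * ?m powr q" by (simp add: powr_mult)
  also have "?m powr q \<le> \<bar>a\<bar> powr q + \<bar>b\<bar> powr q" by (simp add: max_def)
  finally show ?thesis by simp
qed

text \<open>Local integrability forces finiteness almost everywhere. The real part of the extension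
  by 0 is Lebesgue measurable and hence agrees almost everywhere with a Borel function, as the
  product integrals of the limit argument require.\<close>

lemma Lp_loc_real_version:
  fixes g :: "quat ^ 'n \<Rightarrow> ereal"
  assumes \<Omega>: "open \<Omega>" and g: "Lp_loc 1 \<Omega> g"
  obtains h where "loc_integrable \<Omega> h" "AE x in lborel. x \<in> \<Omega> \<longrightarrow> g x = ereal (h x)"
proof -
  define g' where "g' x = (if x \<in> \<Omega> then g x else 0)" for x
  have g'_meas: "g' \<in> borel_measurable lebesgue"
    using g \<Omega> unfolding Lp_loc_def g'_def[abs_def]
    by (subst (asm) measurable_restrict_space_iff[where c = 0]) auto
  have fin: "AE x in lborel. x \<in> \<Omega> \<longrightarrow> \<bar>g x\<bar> \<noteq> \<infinity>"
  proof (rule AE_open_local)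
    fix x assume "x \<in> \<Omega>"
    then obtain e where e: "e > 0" "cball x e \<subseteq> \<Omega>" using \<Omega> open_contains_cball by blast
    let ?h = "\<lambda>y. abs_powr (g' y) 1 * indicator (cball x e) y"
    have "(\<integral>\<^sup>+y. ?h y \<partial>lebesgue) = (\<integral>\<^sup>+y\<in>cball x e. abs_powr (g y) 1 \<partial>lebesgue)"
      using e(2) by (intro nn_integral_cong) (auto simp: indicator_def g'_def subset_iff)
    also have "\<dots> < \<infinity>" using g e(2) by (auto simp: Lp_loc_def)
    finally have lt: "(\<integral>\<^sup>+y. ?h y \<partial>lebesgue) < \<infinity>" .
    note [measurable] = g'_meas
    have [measurable]: "cball x e \<in> sets lebesgue" by simp
    have "?h \<in> borel_measurable lebesgue" by measurable
    then have "AE y in lebesgue. ?h y \<noteq> \<infinity>" by (rule nn_integral_PInf_AE) (use lt in simp)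
    then have "AE y in lborel. ?h y \<noteq> \<infinity>" by (simp add: AE_completion_iff)
    then have "AE y in lborel. y \<in> ball x e \<longrightarrow> \<bar>g y\<bar> \<noteq> \<infinity>"
      by (rule eventually_mono) (use e(2) in \<open>auto simp: abs_powr_def g'_def subset_iff indicator_def split: if_splits\<close>)
    then show "\<exists>T. open T \<and> x \<in> T \<and> (AE y in lborel. y \<in> T \<longrightarrow> \<bar>g y\<bar> \<noteq> \<infinity>)"
      using e by (intro exI[of _ "ball x e"]) auto
  qed
  have "(\<lambda>x. real_of_ereal (g' x)) \<in> borel_measurable lebesgue" using g'_meas by measurable
  then obtain h where h: "h \<in> borel_measurable lborel" "AE x in lborel. real_of_ereal (g' x) = h x"
    using completion_ex_borel_measurable_real by blast
  have eq: "AE x in lborel. x \<in> \<Omega> \<longrightarrow> g x = ereal (h x)"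
    using h(2) fin
  proof eventually_elim
    case (elim x)
    then show ?case by (cases "g x") (auto simp: g'_def)
  qed
  have "loc_integrable \<Omega> h"
    unfolding loc_integrable_def
  proof (intro conjI allI impI)
    show hm: "h \<in> borel_measurable borel" using h(1) by simp
    fix K assume K: "compact K \<and> K \<subseteq> \<Omega>"
    have Kb: "K \<in> sets borel" using K by (simp add: compact_imp_closed)
    have "(\<integral>\<^sup>+z. ennreal (norm (indicator K z * h z)) \<partial>lborel) = (\<integral>\<^sup>+z\<in>K. abs_powr (g z) 1 \<partial>lborel)"
      using eq K by (intro nn_integral_cong_AE) (auto elim!: eventually_mono simp: indicator_def abs_powr_def subset_iff)
    also have "\<dots> = (\<integral>\<^sup>+z\<in>K. abs_powr (g z) 1 \<partial>lebesgue)" by (simp add: nn_integral_completion)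
    also have "\<dots> < \<infinity>" using g K by (auto simp: Lp_loc_def)
    finally show "integrable lborel (\<lambda>z. indicator K z * h z)"
      using hm Kb by (intro integrableI_bounded) auto
  qed
  then show thesis using that eq by blast
qed

text \<open>In the pointwise interpolation the two terms with \<eta> are small by the uniform bound
  in exponent \<open>q\<close>; the linear term has a large constant but meets an L^1 norm that
  tends to 0. The bounds on \<open>f\<close> are later supplied by the plurisubharmonic function
  equal to it almost everywhere.\<close>

lemma (in qpsh_limit) Lp_tendsto:
  assumes p: "0 < p" "p < 2" and K: "compact K" "K \<subseteq> \<Omega>"
    and fq: "\<And>q. 0 < q \<Longrightarrow> q < 2 \<Longrightarrow> (\<integral>\<^sup>+x\<in>K. ennreal (\<bar>f x\<bar> powr q) \<partial>lborel) < \<infinity>"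
  shows "(\<lambda>j. \<integral>\<^sup>+x\<in>K. ennreal (\<bar>F j x - f x\<bar> powr p) \<partial>lborel) \<longlonglongrightarrow> 0"
proof (rule order_tendstoI)
  fix c :: ennreal assume "0 < c"
  then obtain e' where e': "0 < e'" "e' < c" using dense by blast
  then obtain e where e: "e' = ennreal e" "e > 0" by (cases e') auto
  have [measurable]: "K \<in> sets borel" using K(1) by (simp add: compact_imp_closed)
  \<comment> \<open>The midpoint of \<open>p\<close> and 2, an exponent above \<open>p\<close> in
    which uniform bounds still hold.\<close>
  define q where "q = (p + 2) / 2"
  have q: "0 < q" "q < 2" "p < q" using p by (auto simp: q_def)
  obtain C1 where C1: "C1 \<ge> 0" "\<And>j. (\<integral>\<^sup>+x\<in>K. ennreal (\<bar>F j x\<bar> powr q) \<partial>lborel) \<le> ennreal C1"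
    by (rule uniform_Lq[OF q(1,2) K]) blast
  obtain C2 where C2: "C2 \<ge> 0" "(\<integral>\<^sup>+x\<in>K. ennreal (\<bar>f x\<bar> powr q) \<partial>lborel) = ennreal C2"
    using fq[OF q(1,2)] by (cases "\<integral>\<^sup>+x\<in>K. ennreal (\<bar>f x\<bar> powr q) \<partial>lborel") auto
  define m where "m = measure lborel K"
  have "emeasure lborel K < \<infinity>" by (rule emeasure_bounded_finite[OF compact_imp_bounded[OF K(1)]])
  then have m: "emeasure lborel K = ennreal m" "m \<ge> 0" by (auto simp: m_def emeasure_eq_ennreal_measure less_top)
  define A where "A = 2 powr q * (C1 + C2)"
  have A: "A \<ge> 0" using C1(1) C2(1) by (simp add: A_def)
  \<comment> \<open>Both terms with \<eta> together cost at most \<open>e / 2\<close>; the other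
    half is reserved for \<open>C * L j\<close>.\<close>
  define \<eta> where "\<eta> = e / (2 * (m + A + 1))"
  have \<eta>: "\<eta> > 0" "\<eta> * m + \<eta> * A \<le> e / 2"
  proof -
    show "\<eta> > 0" using e(2) m A by (simp add: \<eta>_def)
    have "\<eta> * (m + A) \<le> \<eta> * (m + A + 1)" using \<open>\<eta> > 0\<close> by simp
    also have "\<dots> = e / 2" using m A by (simp add: \<eta>_def field_simps)
    finally show "\<eta> * m + \<eta> * A \<le> e / 2" by (simp add: distrib_left)
  qed
  obtain C where C: "C \<ge> 0" "\<And>x. x \<ge> 0 \<Longrightarrow> x powr p \<le> \<eta> + C * x + \<eta> * x powr q"
    by (rule powr_interpolation[OF p(1) q(3) \<eta>(1)]) blast
  let ?d = "\<lambda>j x. \<bar>F j x - f x\<bar>"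
  define L where "L j = (\<integral>z. indicator K z * ?d j z \<partial>lborel)" for j
  have L0: "L j \<ge> 0" for j unfolding L_def by (intro Bochner_Integration.integral_nonneg) auto
  have L1: "(\<integral>\<^sup>+x\<in>K. ennreal (?d j x) \<partial>lborel) = ennreal (L j)" for j
  proof -
    have "(\<integral>\<^sup>+x\<in>K. ennreal (?d j x) \<partial>lborel) = (\<integral>\<^sup>+x. ennreal (indicator K x * ?d j x) \<partial>lborel)"
      by (intro nn_integral_cong) (auto simp: indicator_def)
    also have "\<dots> = ennreal (L j)"
      unfolding L_def using integrable_abs[OF integrable_K(3)[OF K, of j]]
      by (intro nn_integral_eq_integral) (auto simp: abs_mult)
    finally show ?thesis .
  qed
  have Lq: "(\<integral>\<^sup>+x\<in>K. ennreal (?d j x powr q) \<partial>lborel) \<le> ennreal A" for j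
  proof -
    have "(\<integral>\<^sup>+x\<in>K. ennreal (?d j x powr q) \<partial>lborel) \<le>
      (\<integral>\<^sup>+x. ennreal (2 powr q) * (ennreal (\<bar>F j x\<bar> powr q) * indicator K x + ennreal (\<bar>f x\<bar> powr q) * indicator K x) \<partial>lborel)"
    proof (rule nn_integral_mono)
      fix x
      have "ennreal (?d j x powr q) \<le> ennreal (2 powr q * (\<bar>F j x\<bar> powr q + \<bar>f x\<bar> powr q))"
        by (rule ennreal_leI[OF abs_diff_powr_le[OF q(1)]])
      also have "\<dots> = ennreal (2 powr q) * (ennreal (\<bar>F j x\<bar> powr q) + ennreal (\<bar>f x\<bar> powr q))"
        by (simp add: ennreal_mult)
      finally show "ennreal (?d j x powr q) * indicator K x \<le>
        ennreal (2 powr q) * (ennreal (\<bar>F j x\<bar> powr q) * indicator K x + ennreal (\<bar>f x\<bar> powr q) * indicator K x)"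
        by (cases "x \<in> K") auto
    qed
    also have "\<dots> = ennreal (2 powr q) * (\<integral>\<^sup>+x. ennreal (\<bar>F j x\<bar> powr q) * indicator K x + ennreal (\<bar>f x\<bar> powr q) * indicator K x \<partial>lborel)"
      by (rule nn_integral_cmult) measurable
    also have "(\<integral>\<^sup>+x. ennreal (\<bar>F j x\<bar> powr q) * indicator K x + ennreal (\<bar>f x\<bar> powr q) * indicator K x \<partial>lborel) =
      (\<integral>\<^sup>+x\<in>K. ennreal (\<bar>F j x\<bar> powr q) \<partial>lborel) + (\<integral>\<^sup>+x\<in>K. ennreal (\<bar>f x\<bar> powr q) \<partial>lborel)"
      by (rule nn_integral_add) measurable
    also have "ennreal (2 powr q) * \<dots> \<le> ennreal (2 powr q) * (ennreal C1 + ennreal C2)"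
      unfolding C2(2) by (intro mult_left_mono add_right_mono C1(2)) simp
    also have "\<dots> = ennreal A" using C1(1) C2(1) by (simp add: A_def ennreal_mult)
    finally show ?thesis .
  qed
  have bound: "(\<integral>\<^sup>+x\<in>K. ennreal (?d j x powr p) \<partial>lborel) \<le> ennreal (\<eta> * m + C * L j + \<eta> * A)" for j
  proof -
    have "(\<integral>\<^sup>+x\<in>K. ennreal (?d j x powr p) \<partial>lborel) \<le>
      (\<integral>\<^sup>+x. (ennreal \<eta> * indicator K x + ennreal C * (ennreal (?d j x) * indicator K x)) + ennreal \<eta> * (ennreal (?d j x powr q) * indicator K x) \<partial>lborel)"
    proof (rule nn_integral_mono)
      fix x
      have "ennreal (?d j x powr p) \<le> ennreal (\<eta> + C * ?d j x + \<eta> * ?d j x powr q)"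
        by (rule ennreal_leI[OF C(2)]) simp
      also have "\<dots> = ennreal \<eta> + ennreal C * ennreal (?d j x) + ennreal \<eta> * ennreal (?d j x powr q)"
        using \<eta>(1) C(1) by (simp add: ennreal_mult)
      finally show "ennreal (?d j x powr p) * indicator K x \<le>
        (ennreal \<eta> * indicator K x + ennreal C * (ennreal (?d j x) * indicator K x)) + ennreal \<eta> * (ennreal (?d j x powr q) * indicator K x)"
        by (cases "x \<in> K") auto
    qed
    also have "\<dots> = (\<integral>\<^sup>+x. ennreal \<eta> * indicator K x + ennreal C * (ennreal (?d j x) * indicator K x) \<partial>lborel) +
      (\<integral>\<^sup>+x. ennreal \<eta> * (ennreal (?d j x powr q) * indicator K x) \<partial>lborel)"
      by (rule nn_integral_add) measurable
    also have "(\<integral>\<^sup>+x. ennreal \<eta> * indicator K x + ennreal C * (ennreal (?d j x) * indicator K x) \<partial>lborel) =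
      (\<integral>\<^sup>+x. ennreal \<eta> * indicator K x \<partial>lborel) + (\<integral>\<^sup>+x. ennreal C * (ennreal (?d j x) * indicator K x) \<partial>lborel)"
      by (rule nn_integral_add) measurable
    also have "(\<integral>\<^sup>+x. ennreal \<eta> * indicator K x \<partial>lborel) = ennreal \<eta> * ennreal m"
      unfolding m(1)[symmetric] by (rule nn_integral_cmult_indicator) measurable
    also have "(\<integral>\<^sup>+x. ennreal C * (ennreal (?d j x) * indicator K x) \<partial>lborel) = ennreal C * ennreal (L j)"
      unfolding L1[symmetric] by (rule nn_integral_cmult) measurable
    also have "(\<integral>\<^sup>+x. ennreal \<eta> * (ennreal (?d j x powr q) * indicator K x) \<partial>lborel) =
      ennreal \<eta> * (\<integral>\<^sup>+x\<in>K. ennreal (?d j x powr q) \<partial>lborel)"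
      by (rule nn_integral_cmult) measurable
    also have "ennreal \<eta> * ennreal m + ennreal C * ennreal (L j) + ennreal \<eta> * (\<integral>\<^sup>+x\<in>K. ennreal (?d j x powr q) \<partial>lborel) \<le>
      ennreal \<eta> * ennreal m + ennreal C * ennreal (L j) + ennreal \<eta> * ennreal A"
      by (intro add_left_mono mult_left_mono Lq) simp
    also have "\<dots> = ennreal (\<eta> * m + C * L j + \<eta> * A)"
      using \<eta>(1) m(2) C(1) L0[of j] A by (simp add: ennreal_mult)
    finally show ?thesis .
  qed
  have "(\<lambda>j. C * L j) \<longlonglongrightarrow> C * 0" unfolding L_def by (intro tendsto_intros lim K)
  then have "\<forall>\<^sub>F j in sequentially. C * L j < e / 2" using e(2) by (intro order_tendstoD) auto
  then show "\<forall>\<^sub>F j in sequentially. (\<integral>\<^sup>+x\<in>K. ennreal (?d j x powr p) \<partial>lborel) < c"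
  proof eventually_elim
    case (elim j)
    then have "\<eta> * m + C * L j + \<eta> * A \<le> e" using \<eta>(2) by linarith
    then have "(\<integral>\<^sup>+x\<in>K. ennreal (?d j x powr p) \<partial>lborel) \<le> ennreal e"
      using bound[of j] by (meson ennreal_leI order_trans)
    then show ?case using e' e(1) by simp
  qed
qed simp

theorem proposition2:
  fixes \<Omega> :: "(quat ^ 'n) set"
  assumes "domain \<Omega>"
  shows "(\<forall>u\<in>QPSH \<Omega>. (\<exists>x\<in>\<Omega>. u x \<noteq> -\<infinity>) \<longrightarrow> (\<forall>p. 0 < p \<and> p < 2 \<longrightarrow> Lp_loc p \<Omega> u))
    \<and> (\<forall>p\<ge>2. \<exists>(D :: (quat ^ 'n) set) v. domain D \<and> v \<in> QPSH D \<and> (\<exists>x\<in>D. v x \<noteq> -\<infinity>) \<and> \<not> Lp_loc p D v)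
    \<and> (\<forall>U u. (\<forall>j. U j \<in> QPSH \<Omega> \<and> (\<exists>x\<in>\<Omega>. U j x \<noteq> -\<infinity>)) \<and> Lp_loc_tendsto 1 \<Omega> U u \<longrightarrow>
        (\<exists>v\<in>QPSH \<Omega>. AE x in lebesgue. x \<in> \<Omega> \<longrightarrow> u x = v x) \<and>
        (\<forall>p. 0 < p \<and> p < 2 \<longrightarrow> Lp_loc_tendsto p \<Omega> U u))"
proof (intro conjI)
  show "\<forall>u\<in>QPSH \<Omega>. (\<exists>x\<in>\<Omega>. u x \<noteq> -\<infinity>) \<longrightarrow> (\<forall>p. 0 < p \<and> p < 2 \<longrightarrow> Lp_loc p \<Omega> u)"
    using qpsh_Lp_loc[OF assms] by blast
next
  show "\<forall>p\<ge>2. \<exists>(D :: (quat ^ 'n) set) v. domain D \<and> v \<in> QPSH D \<and> (\<exists>x\<in>D. v x \<noteq> -\<infinity>) \<and> \<not> Lp_loc p D v"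
  proof (intro allI impI)
    fix p :: real assume p: "p \<ge> 2"
    let ?v = "newton_fun (undefined :: 'n)"
    \<comment> \<open>At the point with all coordinates equal to 1 the function has the finite value
      -1.\<close>
    have "?v (\<chi> i. axis 1 1) \<noteq> -\<infinity>"
      by (simp add: newton_fun_def norm_eq_sqrt_inner inner_axis_axis one_ennreal.rep_eq)
    then have "\<exists>x. ?v x \<noteq> -\<infinity>" ..
    then show "\<exists>(D :: (quat ^ 'n) set) v. domain D \<and> v \<in> QPSH D \<and> (\<exists>x\<in>D. v x \<noteq> -\<infinity>) \<and> \<not> Lp_loc p D v"
      using newton_fun_QPSH newton_fun_not_Lp_loc[OF p]
      by (intro exI[of _ UNIV] exI[of _ ?v]) (auto simp: domain_def)
  qed
next
  show "\<forall>U u. (\<forall>j. U j \<in> QPSH \<Omega> \<and> (\<exists>x\<in>\<Omega>. U j x \<noteq> -\<infinity>)) \<and> Lp_loc_tendsto 1 \<Omega> U u \<longrightarrow>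
        (\<exists>v\<in>QPSH \<Omega>. AE x in lebesgue. x \<in> \<Omega> \<longrightarrow> u x = v x) \<and>
        (\<forall>p. 0 < p \<and> p < 2 \<longrightarrow> Lp_loc_tendsto p \<Omega> U u)"
  proof (intro allI impI)
    fix U and u :: "quat ^ 'n \<Rightarrow> ereal"
    assume *: "(\<forall>j. U j \<in> QPSH \<Omega> \<and> (\<exists>x\<in>\<Omega>. U j x \<noteq> -\<infinity>)) \<and> Lp_loc_tendsto 1 \<Omega> U u"
    then have hU: "U j \<in> QPSH \<Omega>" "\<exists>x\<in>\<Omega>. U j x \<noteq> -\<infinity>" and L1: "Lp_loc 1 \<Omega> (U j)" "Lp_loc 1 \<Omega> u" for j
      by (auto simp: Lp_loc_tendsto_def)
    have conv: "(\<lambda>j. \<integral>\<^sup>+x\<in>K. abs_powr (U j x - u x) 1 \<partial>lebesgue) \<longlonglongrightarrow> 0" if "compact K" "K \<subseteq> \<Omega>" for K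
      using * that by (simp add: Lp_loc_tendsto_def)
    have o: "open \<Omega>" "\<Omega> \<noteq> {}" using assms by (auto simp: domain_def)
    obtain f where hf: "loc_integrable \<Omega> f" "AE x in lborel. x \<in> \<Omega> \<longrightarrow> u x = ereal (f x)"
      by (rule Lp_loc_real_version[OF o(1) L1(2)])
    have "\<exists>h. loc_integrable \<Omega> h \<and> (AE x in lborel. x \<in> \<Omega> \<longrightarrow> U j x = ereal (h x))" for j
      using Lp_loc_real_version[OF o(1) L1(1)[of j]] by blast
    then have "\<forall>j. \<exists>h. loc_integrable \<Omega> h \<and> (AE x in lborel. x \<in> \<Omega> \<longrightarrow> U j x = ereal (h x))" ..
    from choice[OF this] obtain F where
      "\<forall>j. loc_integrable \<Omega> (F j) \<and> (AE x in lborel. x \<in> \<Omega> \<longrightarrow> U j x = ereal (F j x))" ..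
    then have hF: "loc_integrable \<Omega> (F j)" "AE x in lborel. x \<in> \<Omega> \<longrightarrow> U j x = ereal (F j x)" for j
      by simp_all
    have [measurable]: "F j \<in> borel_measurable borel" "f \<in> borel_measurable borel" for j
      using hF hf by (auto simp: loc_integrable_def)
    \<comment> \<open>The extended-valued difference may be undefined in meaning only on a null set,
      so the integrals are those of the real representatives, for every exponent.\<close>
    have diff: "(\<integral>\<^sup>+x\<in>K. abs_powr (U j x - u x) p \<partial>lebesgue) = (\<integral>\<^sup>+x\<in>K. ennreal (\<bar>F j x - f x\<bar> powr p) \<partial>lborel)"
      if K: "K \<subseteq> \<Omega>" for K j p
    proof -
      have "(\<integral>\<^sup>+x\<in>K. abs_powr (U j x - u x) p \<partial>lborel) = (\<integral>\<^sup>+x\<in>K. ennreal (\<bar>F j x - f x\<bar> powr p) \<partial>lborel)"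
      proof (rule nn_integral_cong_AE)
        show "AE x in lborel. abs_powr (U j x - u x) p * indicator K x = ennreal (\<bar>F j x - f x\<bar> powr p) * indicator K x"
          using hF(2)[of j] hf(2) by eventually_elim (use K in \<open>auto simp: indicator_def abs_powr_def\<close>)
      qed
      then show ?thesis by (simp add: nn_integral_completion)
    qed
    interpret qpsh_limit \<Omega> U F f
    proof
      fix K :: "(quat ^ 'n) set" assume K: "compact K" "K \<subseteq> \<Omega>"
      have [measurable]: "K \<in> sets borel" using K(1) by (simp add: compact_imp_closed)
      have "integrable lborel (\<lambda>z. indicator K z * F j z - indicator K z * f z)" for j
        using hF(1)[of j] hf(1) K by (intro Bochner_Integration.integrable_diff) (auto simp: loc_integrable_def)
      then have i: "integrable lborel (\<lambda>z. indicator K z * \<bar>F j z - f z\<bar>)" for j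
        using integrable_abs[of lborel "\<lambda>z. indicator K z * (F j z - f z)"] by (simp add: right_diff_distrib[symmetric] abs_mult)
      have "(\<integral>\<^sup>+x\<in>K. abs_powr (U j x - u x) 1 \<partial>lebesgue) = ennreal (\<integral>z. indicator K z * \<bar>F j z - f z\<bar> \<partial>lborel)" for j
      proof -
        have "(\<integral>\<^sup>+x\<in>K. abs_powr (U j x - u x) 1 \<partial>lebesgue) = (\<integral>\<^sup>+z. ennreal (indicator K z * \<bar>F j z - f z\<bar>) \<partial>lborel)"
          unfolding diff[OF K(2)] by (intro nn_integral_cong) (auto simp: indicator_def)
        also have "\<dots> = ennreal (\<integral>z. indicator K z * \<bar>F j z - f z\<bar> \<partial>lborel)"
          by (intro nn_integral_eq_integral i) auto
        finally show ?thesis .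
      qed
      then have "(\<lambda>j. ennreal (\<integral>z. indicator K z * \<bar>F j z - f z\<bar> \<partial>lborel)) \<longlonglongrightarrow> ennreal 0"
        using conv[OF K] by simp
      then show "(\<lambda>j. \<integral>z. indicator K z * \<bar>F j z - f z\<bar> \<partial>lborel) \<longlonglongrightarrow> 0"
        by (rule tendsto_ennrealD) auto
    qed (use o hU hF hf in auto)
    have uv: "AE x in lborel. x \<in> \<Omega> \<longrightarrow> u x = v x" using hf(2) AE_eq_v by eventually_elim auto
    \<comment> \<open>\<open>v\<close> equals the real-valued \<open>f\<close> almost everywhere on
      a set of positive measure. Hence the integrability result applies to \<open>v\<close> itself
      and yields the bounds for the limit in every exponent below 2.\<close>
    have "\<exists>x\<in>\<Omega>. v x \<noteq> -\<infinity>"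
    proof (rule ccontr)
      assume "\<not> ?thesis"
      then have "AE x in lborel. x \<notin> \<Omega>" using AE_eq_v by (auto elim!: eventually_mono)
      then have n: "\<Omega> \<in> null_sets lborel" using AE_iff_null_sets[of \<Omega> lborel] o(1) by simp
      obtain x e where e: "e > 0" "ball x e \<subseteq> \<Omega>" using o open_contains_ball by blast
      have "emeasure lborel (ball x e) \<le> emeasure lborel \<Omega>" using e(2) o(1) by (intro emeasure_mono) auto
      then show False using n emeasure_lborel_ball_neq_0[OF e(1), of x] by (simp add: null_sets_def)
    qed
    then have vLp: "Lp_loc p \<Omega> v" if "0 < p" "p < 2" for p using qpsh_Lp_loc[OF assms v_QPSH] that by blast
    have vK: "(\<integral>\<^sup>+x\<in>K. abs_powr (v x) p \<partial>lebesgue) < \<infinity>" if "compact K" "K \<subseteq> \<Omega>" "0 < p" "p < 2" for K p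
      using vLp[OF that(3,4)] that by (simp add: Lp_loc_def)
    have "Lp_loc_tendsto p \<Omega> U u" if p: "0 < p" "p < 2" for p
      unfolding Lp_loc_tendsto_def
    proof (intro conjI allI impI)
      show "Lp_loc p \<Omega> (U j)" for j using qpsh_Lp_loc[OF assms hU(1) hU(2) p] .
      show "Lp_loc p \<Omega> u"
        unfolding Lp_loc_def
      proof (intro conjI allI impI)
        show "u \<in> borel_measurable (lebesgue_on \<Omega>)" using L1(2) by (simp add: Lp_loc_def)
        fix K assume K: "compact K \<and> K \<subseteq> \<Omega>"
        have "(\<integral>\<^sup>+x\<in>K. abs_powr (u x) p \<partial>lborel) = (\<integral>\<^sup>+x\<in>K. abs_powr (v x) p \<partial>lborel)"
          using uv K by (intro nn_integral_cong_AE) (auto elim!: eventually_mono simp: indicator_def)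
        then show "(\<integral>\<^sup>+x\<in>K. abs_powr (u x) p \<partial>lebesgue) < \<infinity>"
          using vK[of K p] K p by (simp add: nn_integral_completion)
      qed
      fix K assume K: "compact K \<and> K \<subseteq> \<Omega>"
      have "(\<lambda>j. \<integral>\<^sup>+x\<in>K. ennreal (\<bar>F j x - f x\<bar> powr p) \<partial>lborel) \<longlonglongrightarrow> 0"
      proof (rule Lp_tendsto[OF p])
        fix q :: real assume q: "0 < q" "q < 2"
        have "(\<integral>\<^sup>+x\<in>K. ennreal (\<bar>f x\<bar> powr q) \<partial>lborel) = (\<integral>\<^sup>+x\<in>K. abs_powr (v x) q \<partial>lborel)"
          using AE_eq_v K by (intro nn_integral_cong_AE) (auto elim!: eventually_mono simp: indicator_def abs_powr_def)
        then show "(\<integral>\<^sup>+x\<in>K. ennreal (\<bar>f x\<bar> powr q) \<partial>lborel) < \<infinity>"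
          using vK[of K q] K q by (simp add: nn_integral_completion)
      qed (use K in auto)
      then show "(\<lambda>j. \<integral>\<^sup>+x\<in>K. abs_powr (U j x - u x) p \<partial>lebesgue) \<longlonglongrightarrow> 0"
        using K by (simp add: diff)
    qed
    then show "(\<exists>v\<in>QPSH \<Omega>. AE x in lebesgue. x \<in> \<Omega> \<longrightarrow> u x = v x) \<and>
        (\<forall>p. 0 < p \<and> p < 2 \<longrightarrow> Lp_loc_tendsto p \<Omega> U u)"
      using v_QPSH uv by (auto simp: AE_completion_iff)
  qed
qed

end
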